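(* Let $W$ be a finite Coxeter group and $c$ a standard Coxeter element of $W$. For each $u\in W_c^+$, the set $\mathrm{Class}_c(u)$ contains the $\preceq_c$-increasing commutation class $\mathcal I_c$ and contains exactly one $\preceq_c$-decreasing commutation class.
   Context: Let $W$ be a finite Coxeter group of rank $r$ with simple reflections $S$ and set of reflections $T$; $\ell_S$ and $\ell_T$ denote length with respect to $S$ and $T$. Bruhat order $\leq_{\mathrm B}$: covers $u\lessdot_{\mathrm B}v$ iff $v=ut$ with $t\in T$ and $\ell_S(v)=\ell_S(u)+1$. Absolute order: $u\leq_T v$ iff $\ell_T(u)+\ell_T(u^{-1}v)=\ell_T(v)$. A standard Coxeter element $c$ is a product of all elements of $S$ each once in some order; $\ell_S(c)=\ell_T(c)=r$. Let $\mathsf{MC}(W,c)$ be the set of maximal chains $\vec\pi=\{e=\pi_0\lessdot_T\pi_1\lessdot_T\cdots\lessdot_T\pi_r=c\}$ of the interval $[e,c]_T$ (the $c$-noncrossing partition lattice), and let $\mathrm{rw}(\vec\pi)=t_1\cdots t_r$ with $t_i=\pi_{i-1}^{-1}\pi_i\in T$ (a reduced $T$-word for $c$). Two chains are commutation equivalent if their words $\mathrm{rw}$ are related by swapping adjacent commuting letters; $\mathcal C_{\vec\pi}$ denotes the class of $\vec\pi$. Let $W_c^+=\{u\in W:\ell_S(uc)=\ell_S(u)+r\}$. An element $u\in W_c^+$ and $\vec\pi\in\mathsf{MC}(W,c)$ are concordant if $u\pi_0\leq_{\mathrm B}u\pi_1\leq_{\mathrm B}\cdots\leq_{\mathrm B}u\pi_r$;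 $\mathrm{Class}_c(u)$ is the set of commutation classes of chains concordant with $u$ (concordance is constant on classes). The order $\preceq_c$ on $T$: fix a reduced $S$-word $\mathsf c$ for $c$; the $c$-sorting word of $w\in W$ is the lexicographically first (by positions) subword of $\mathsf c\mathsf c\mathsf c\cdots$ that is a reduced $S$-word for $w$. The inversion sequence of a reduced $S$-word $s_1\cdots s_k$ is $(t_1,\ldots,t_k)$ with $t_i=s_1\cdots s_{i-1}s_is_{i-1}\cdots s_1$. Declare $t\preceq_c t'$ if $t$ appears to the left of $t'$ in the inversion sequence of every reduced $S$-word for the longest element $w_\circ$ obtained from the $c$-sorting word of $w_\circ$ by swapping adjacent commuting letters. A chain with $\mathrm{rw}(\vec\pi)=t_1\cdots t_r$ is $\preceq_c$-increasing (resp. $\preceq_c$-decreasing) if there are no $i<j$ with $t_j\preceq_c t_i$ (resp. $t_i\preceq_c t_j$); this property is constant on commutation classes. It is known that there is a unique $\preceq_c$-increasing class, denoted $\mathcal I_c$. *)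

theory Defs
  imports "HOL-Algebra.Multiplicative_Group"
begin

definition word_prod :: "('a, 'b) monoid_scheme \<Rightarrow> 'a list \<Rightarrow> 'a" where
  "word_prod G ws = foldr (mult G) ws (one G)"

text \<open>
  The congruence on words generated by the relators \<open>(st)\<^bsup>m(s,t)\<^esup>\<close>, where \<open>m(s,t)\<close> is the
  order of \<open>st\<close>. If the order is infinite, \<open>group.ord\<close> is \<open>0\<close> and no relation is imposed. For
  \<open>s = t\<close> an involution, \<open>m(s,s) = 1\<close> and the relator is \<open>ss\<close>; hence letters are invertible
  modulo the congruence, and the monoid presentation is the group presentation.
\<close>
inductive coxeter_cong :: "('a, 'b) monoid_scheme \<Rightarrow> 'a set \<Rightarrow> 'a list \<Rightarrow> 'a list \<Rightarrow> bool"
  for G S where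
  refl: "coxeter_cong G S xs xs"
| sym: "coxeter_cong G S xs ys \<Longrightarrow> coxeter_cong G S ys xs"
| trans: "coxeter_cong G S xs ys \<Longrightarrow> coxeter_cong G S ys zs \<Longrightarrow> coxeter_cong G S xs zs"
| relator: "s \<in> S \<Longrightarrow> t \<in> S \<Longrightarrow>
    coxeter_cong G S (xs @ concat (replicate (group.ord G (s \<otimes>\<^bsub>G\<^esub> t)) [s, t]) @ ys) (xs @ ys)"

locale coxeter_system = group G for G (structure) +
  fixes S :: "'a set"
  assumes simple_closed: "S \<subseteq> carrier G"
    and simple_not_one: "\<one> \<notin> S"
    and simple_involution: "s \<in> S \<Longrightarrow> s \<otimes> s = \<one>"
    and simple_generate: "generate G S = carrier G"
    and presentation: "\<lbrakk>set xs \<subseteq> S; set ys \<subseteq> S; word_prod G xs = word_prod G ys\<rbrakk>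
      \<Longrightarrow> coxeter_cong G S xs ys"

definition reflections :: "('a, 'b) monoid_scheme \<Rightarrow> 'a set \<Rightarrow> 'a set" where
  "reflections G S = {w \<otimes>\<^bsub>G\<^esub> s \<otimes>\<^bsub>G\<^esub> inv\<^bsub>G\<^esub> w | w s. w \<in> carrier G \<and> s \<in> S}"

text \<open>Length with respect to a generating set \<open>X\<close>, used with \<open>X = S\<close> and \<open>X = T\<close>.\<close>
definition len :: "('a, 'b) monoid_scheme \<Rightarrow> 'a set \<Rightarrow> 'a \<Rightarrow> nat" where
  "len G X w = (LEAST n. \<exists>ws. set ws \<subseteq> X \<and> length ws = n \<and> word_prod G ws = w)"

abbreviation len_T :: "('a, 'b) monoid_scheme \<Rightarrow> 'a set \<Rightarrow> 'a \<Rightarrow> nat" where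
  "len_T G S \<equiv> len G (reflections G S)"

definition reduced_word :: "('a, 'b) monoid_scheme \<Rightarrow> 'a set \<Rightarrow> 'a list \<Rightarrow> 'a \<Rightarrow> bool" where
  "reduced_word G X ws w \<longleftrightarrow> set ws \<subseteq> X \<and> word_prod G ws = w \<and> length ws = len G X w"

definition bruhat_cover :: "('a, 'b) monoid_scheme \<Rightarrow> 'a set \<Rightarrow> 'a \<Rightarrow> 'a \<Rightarrow> bool" where
  "bruhat_cover G S u v \<longleftrightarrow> u \<in> carrier G \<and>
     (\<exists>t \<in> reflections G S. v = u \<otimes>\<^bsub>G\<^esub> t) \<and> len G S v = len G S u + 1"

definition bruhat_le :: "('a, 'b) monoid_scheme \<Rightarrow> 'a set \<Rightarrow> 'a \<Rightarrow> 'a \<Rightarrow> bool" where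
  "bruhat_le G S u v \<longleftrightarrow> u \<in> carrier G \<and> v \<in> carrier G \<and> (bruhat_cover G S)\<^sup>*\<^sup>* u v"

definition abs_le :: "('a, 'b) monoid_scheme \<Rightarrow> 'a set \<Rightarrow> 'a \<Rightarrow> 'a \<Rightarrow> bool" where
  "abs_le G S u v \<longleftrightarrow> u \<in> carrier G \<and> v \<in> carrier G \<and>
     len_T G S u + len_T G S (inv\<^bsub>G\<^esub> u \<otimes>\<^bsub>G\<^esub> v) = len_T G S v"

definition abs_cover :: "('a, 'b) monoid_scheme \<Rightarrow> 'a set \<Rightarrow> 'a \<Rightarrow> 'a \<Rightarrow> bool" where
  "abs_cover G S u v \<longleftrightarrow> abs_le G S u v \<and> u \<noteq> v \<and>
     (\<forall>x. abs_le G S u x \<and> abs_le G S x v \<longrightarrow> x = u \<or> x = v)"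

definition standard_coxeter_element :: "('a, 'b) monoid_scheme \<Rightarrow> 'a set \<Rightarrow> 'a \<Rightarrow> bool" where
  "standard_coxeter_element G S c \<longleftrightarrow>
     (\<exists>ws. distinct ws \<and> set ws = S \<and> word_prod G ws = c)"

text \<open>A chain is the list of its elements \<open>[\<pi>\<^sub>0, \<dots>, \<pi>\<^sub>r]\<close>, where \<open>r = card S\<close> is the rank.\<close>
definition max_chains :: "('a, 'b) monoid_scheme \<Rightarrow> 'a set \<Rightarrow> 'a \<Rightarrow> 'a list set" where
  "max_chains G S c = {p. length p = Suc (card S) \<and> p ! 0 = \<one>\<^bsub>G\<^esub> \<and> p ! card S = c \<and>
     (\<forall>i < card S. abs_cover G S (p ! i) (p ! Suc i))}"

definition rw :: "('a, 'b) monoid_scheme \<Rightarrow> 'a list \<Rightarrow> 'a list" where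
  "rw G p = map (\<lambda>i. inv\<^bsub>G\<^esub> (p ! i) \<otimes>\<^bsub>G\<^esub> p ! Suc i) [0..<length p - 1]"

inductive comm_step :: "('a, 'b) monoid_scheme \<Rightarrow> 'a list \<Rightarrow> 'a list \<Rightarrow> bool" for G where
  "a \<otimes>\<^bsub>G\<^esub> b = b \<otimes>\<^bsub>G\<^esub> a \<Longrightarrow> comm_step G (xs @ [a, b] @ ys) (xs @ [b, a] @ ys)"

definition comm_equiv :: "('a, 'b) monoid_scheme \<Rightarrow> 'a list \<Rightarrow> 'a list \<Rightarrow> bool" where
  "comm_equiv G = (comm_step G)\<^sup>*\<^sup>*"

definition comm_class :: "('a, 'b) monoid_scheme \<Rightarrow> 'a set \<Rightarrow> 'a \<Rightarrow> 'a list \<Rightarrow> 'a list set" where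
  "comm_class G S c p = {q \<in> max_chains G S c. comm_equiv G (rw G p) (rw G q)}"

definition W_plus :: "('a, 'b) monoid_scheme \<Rightarrow> 'a set \<Rightarrow> 'a \<Rightarrow> 'a set" where
  "W_plus G S c = {u \<in> carrier G. len G S (u \<otimes>\<^bsub>G\<^esub> c) = len G S u + card S}"

definition concordant :: "('a, 'b) monoid_scheme \<Rightarrow> 'a set \<Rightarrow> 'a \<Rightarrow> 'a list \<Rightarrow> bool" where
  "concordant G S u p \<longleftrightarrow>
     (\<forall>i < card S. bruhat_le G S (u \<otimes>\<^bsub>G\<^esub> p ! i) (u \<otimes>\<^bsub>G\<^esub> p ! Suc i))"

definition Class :: "('a, 'b) monoid_scheme \<Rightarrow> 'a set \<Rightarrow> 'a \<Rightarrow> 'a \<Rightarrow> 'a list set set" where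
  "Class G S c u = comm_class G S c ` {p \<in> max_chains G S c. concordant G S u p}"

definition longest_element :: "('a, 'b) monoid_scheme \<Rightarrow> 'a set \<Rightarrow> 'a" where
  "longest_element G S = (THE w. w \<in> carrier G \<and> (\<forall>v \<in> carrier G. len G S v \<le> len G S w))"

text \<open>The letter at position \<open>i\<close> (counted from \<open>0\<close>) of the infinite word \<open>cw cw cw \<dots>\<close>\<close>
definition periodic_letter :: "'a list \<Rightarrow> nat \<Rightarrow> 'a" where
  "periodic_letter cw i = cw ! (i mod length cw)"

definition subword_positions ::
    "('a, 'b) monoid_scheme \<Rightarrow> 'a set \<Rightarrow> 'a list \<Rightarrow> 'a \<Rightarrow> nat list \<Rightarrow> bool" where
  "subword_positions G S cw w ps \<longleftrightarrow>
     sorted_wrt (<) ps \<and> reduced_word G S (map (periodic_letter cw) ps) w"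

definition sorting_positions ::
    "('a, 'b) monoid_scheme \<Rightarrow> 'a set \<Rightarrow> 'a list \<Rightarrow> 'a \<Rightarrow> nat list" where
  "sorting_positions G S cw w = (THE ps. subword_positions G S cw w ps \<and>
     (\<forall>qs. subword_positions G S cw w qs \<longrightarrow> ps = qs \<or> (ps, qs) \<in> lexord less_than))"

definition sorting_word :: "('a, 'b) monoid_scheme \<Rightarrow> 'a set \<Rightarrow> 'a list \<Rightarrow> 'a \<Rightarrow> 'a list" where
  "sorting_word G S cw w = map (periodic_letter cw) (sorting_positions G S cw w)"

definition inv_seq :: "('a, 'b) monoid_scheme \<Rightarrow> 'a list \<Rightarrow> 'a list" where
  "inv_seq G ws = map (\<lambda>i. word_prod G (take i ws @ [ws ! i] @ rev (take i ws))) [0..<length ws]"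

text \<open>
  The partial order \<open>\<preceq>\<^sub>c\<close> on reflections, taken to be reflexive; \<open>cw\<close> is the chosen reduced
  \<open>S\<close>-word for \<open>c\<close>.
\<close>
definition refl_le ::
    "('a, 'b) monoid_scheme \<Rightarrow> 'a set \<Rightarrow> 'a list \<Rightarrow> 'a \<Rightarrow> 'a \<Rightarrow> bool" where
  "refl_le G S cw t t' \<longleftrightarrow>
     (\<forall>ws. comm_equiv G (sorting_word G S cw (longest_element G S)) ws \<longrightarrow>
       (\<exists>i j. i \<le> j \<and> j < length ws \<and> inv_seq G ws ! i = t \<and> inv_seq G ws ! j = t'))"

definition increasing_chain ::
    "('a, 'b) monoid_scheme \<Rightarrow> 'a set \<Rightarrow> 'a list \<Rightarrow> 'a list \<Rightarrow> bool" where
  "increasing_chain G S cw p \<longleftrightarrow>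
     (\<nexists>i j. i < j \<and> j < length (rw G p) \<and> refl_le G S cw (rw G p ! j) (rw G p ! i))"

definition decreasing_chain ::
    "('a, 'b) monoid_scheme \<Rightarrow> 'a set \<Rightarrow> 'a list \<Rightarrow> 'a list \<Rightarrow> bool" where
  "decreasing_chain G S cw p \<longleftrightarrow>
     (\<nexists>i j. i < j \<and> j < length (rw G p) \<and> refl_le G S cw (rw G p ! i) (rw G p ! j))"

text \<open>
  An increasing (decreasing) class is the commutation class of an increasing (decreasing) chain.
  Not every chain in it need satisfy the condition literally: commuting reflections
  that are adjacent in \<open>rw\<close> can be comparable, for instance for decreasing chains in type
  \<open>A\<^sub>4\<close> with \<open>c = s\<^sub>1 s\<^sub>2 s\<^sub>3 s\<^sub>4\<close>.
\<close>
definition is_increasing_class ::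
    "('a, 'b) monoid_scheme \<Rightarrow> 'a set \<Rightarrow> 'a \<Rightarrow> 'a list \<Rightarrow> 'a list set \<Rightarrow> bool" where
  "is_increasing_class G S c cw C \<longleftrightarrow>
     (\<exists>p \<in> max_chains G S c. C = comm_class G S c p \<and> increasing_chain G S cw p)"

definition is_decreasing_class ::
    "('a, 'b) monoid_scheme \<Rightarrow> 'a set \<Rightarrow> 'a \<Rightarrow> 'a list \<Rightarrow> 'a list set \<Rightarrow> bool" where
  "is_decreasing_class G S c cw C \<longleftrightarrow>
     (\<exists>p \<in> max_chains G S c. C = comm_class G S c p \<and> decreasing_chain G S cw p)"

definition increasing_class ::
    "('a, 'b) monoid_scheme \<Rightarrow> 'a set \<Rightarrow> 'a \<Rightarrow> 'a list \<Rightarrow> 'a list set" where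
  "increasing_class G S c cw = (THE C. is_increasing_class G S c cw C)"

end

theory Submission
  imports Defs Complex_Main "Jordan_Normal_Form.Determinant"
begin

text \<open>
  In the geometric representation let \<open>\<beta>\<^sub>t\<close> be the positive root of a reflection \<open>t\<close>, and for a
  reduced \<open>T\<close>-word \<open>c = t\<^sub>1 \<cdots> t\<^sub>r\<close> put \<open>\<gamma>\<^sub>i = t\<^sub>1 \<cdots> t\<^sub>i\<^sub>-\<^sub>1 \<beta>\<^sub>i\<close>. Telescoping gives
  \<open>x - c\<inverse> x = \<Sum>\<^sub>i B(\<gamma>\<^sub>i, x) \<beta>\<^sub>i\<close>, so with \<open>x = u\<inverse>(2\<rho>)\<close> the word is concordant with \<open>u\<close> iff
  \<open>y = x - c\<inverse> x\<close> lies in the open cone spanned by the \<open>\<beta>\<^sub>i\<close>; for the word \<open>c = s\<^sub>1 \<cdots> s\<^sub>r\<close> this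
  says \<open>u \<in> W\<^sub>c\<^sup>+\<close>. The form \<open>E(x, y) = B(x, (1 - c\<inverse>)\<inverse> y)\<close> satisfies \<open>E(\<beta>\<^sub>i, \<beta>\<^sub>j) = 0\<close> for
  \<open>i < j\<close> on every such word, and \<open>E(\<beta>\<^sub>t, \<beta>\<^sub>t\<^sub>') \<ge> 0 \<ge> E(\<beta>\<^sub>t\<^sub>', \<beta>\<^sub>t)\<close> whenever \<open>t\<close> precedes \<open>t'\<close> in
  the inversion sequence of the sorting word of the longest element. Hence, up to commutations,
  the increasing words are those with pairwise obtuse roots, and these are words in \<open>S\<close>; the
  decreasing words are those with pairwise acute roots.

  Two decreasing words whose cones contain \<open>y\<close> agree, because \<open>E(\<beta>, y)\<close> for the latest root
  \<open>\<beta>\<close> involved is its coefficient in an expansion containing \<open>\<beta>\<close> and is nonpositive in any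
  other. A concordant acute word exists by induction: if \<open>s\<close> is initial in \<open>c = s c\<^sub>0\<close>, then either
  \<open>u c s > u c\<close> and one conjugates by \<open>s\<close> a word for \<open>c\<^sub>0 s\<close> and \<open>u s\<close>, or \<open>u c s < u c\<close> and
  one conjugates by \<open>s\<close> a word for \<open>c\<^sub>0\<close> and \<open>u s\<close> in the parabolic subgroup and appends \<open>s\<close>.
\<close>

text \<open>\<open>rho2\<close> pairs positively with positive roots and negatively with negative
  ones, so whether \<open>u\<close> keeps a root positive is the sign of a linear functional; this
  is what makes concordance a cone condition. The form \<open>E\<close> has a model: in simply laced
  types it is the Euler form of a quiver orienting the Coxeter graph, reduced T-words are complete
  exceptional sequences, the inverse of c acts as the Auslander-Reiten translation, and the sorting
  word of the longest element lists the orbits of the projectives. The proofs imitate this by linear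
  algebra, so that noncrystallographic groups are covered as well. The obstacle is the order on T:
  it rests on a lexicographically first subword and on all words commutation equivalent to it. The
  subword is therefore described in closed form, through the signs of roots in c-orbits, and the
  partial order is traded for the total order of one inversion sequence. A chain monotone for the
  partial order need not be sorted for the total one, but its wrongly ordered pairs commute, so the
  trade is harmless for classes.\<close>

lemma square_family_dual:
  fixes e :: "nat \<Rightarrow> nat \<Rightarrow> real"
  assumes "\<And>k l. k < n \<Longrightarrow> l < n \<Longrightarrow> (\<Sum>i<n. e i k * b i l) = (if k = l then 1 else 0)"
    and "i < n" "j < n"
  shows "(\<Sum>k<n. e i k * b j k) = (if i = j then 1 else 0)"
proof -
  define A where "A = mat n n (\<lambda>(l, i). b i l)"
  define C where "C = mat n n (\<lambda>(i, k). e i k)"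
  have A: "A \<in> carrier_mat n n" and C: "C \<in> carrier_mat n n"
    by (auto simp: A_def C_def)
  \<comment> \<open>A one-sided inverse of a square matrix is two-sided: the hypothesis is
    \<open>A * C = 1\<close>, the claim is \<open>C * A = 1\<close>.\<close>
  have "A * C = 1\<^sub>m n"
  proof (rule eq_matI)
    fix l k assume "l < dim_row (1\<^sub>m n)" "k < dim_col (1\<^sub>m n)"
    then have lk: "l < n" "k < n" by auto
    have "(A * C) $$ (l, k) = (\<Sum>i<n. e i k * b i l)"
      using lk by (simp add: A_def C_def scalar_prod_def lessThan_atLeast0 mult.commute)
    with assms(1)[OF lk(2) lk(1)] lk show "(A * C) $$ (l, k) = 1\<^sub>m n $$ (l, k)" by auto
  qed (auto simp: A_def C_def)
  from mat_mult_left_right_inverse[OF A C this] have "C * A = 1\<^sub>m n" .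
  then have "(C * A) $$ (i, j) = 1\<^sub>m n $$ (i, j)" by simp
  moreover have "(C * A) $$ (i, j) = (\<Sum>k<n. e i k * b j k)"
    using assms(2,3) by (simp add: A_def C_def scalar_prod_def lessThan_atLeast0)
  ultimately show ?thesis using assms(2,3) by simp
qed

section \<open>Linear maps on real-valued functions, lengths and alternating words\<close>

definition lin :: "(('a \<Rightarrow> real) \<Rightarrow> ('a \<Rightarrow> real)) \<Rightarrow> bool" where
  "lin f \<longleftrightarrow> (\<forall>x y k. f (\<lambda>a. x a + k * y a) = (\<lambda>a. f x a + k * f y a))"

lemma linD: "lin f \<Longrightarrow> f (\<lambda>a. x a + k * y a) = (\<lambda>a. f x a + k * f y a)"
  by (simp add: lin_def)

lemma lin_zero: "lin f \<Longrightarrow> f (\<lambda>a. 0) = (\<lambda>a. 0)"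
  using linD[of f "\<lambda>a. 0" "-1" "\<lambda>a. 0"] by (simp add: fun_eq_iff)

lemma lin_scale: "lin f \<Longrightarrow> f (\<lambda>a. k * y a) = (\<lambda>a. k * f y a)"
  using linD[of f "\<lambda>a. 0" k y] lin_zero[of f] by simp

lemma lin_uminus: "lin f \<Longrightarrow> f (\<lambda>a. - y a) = (\<lambda>a. - f y a)"
  using lin_scale[of f "-1" y] by simp

lemma lin_diff: "lin f \<Longrightarrow> f (\<lambda>a. x a - k * y a) = (\<lambda>a. f x a - k * f y a)"
  using linD[of f x "-k" y] by simp

lemma lin_sum:
  assumes "lin f"
  shows "f (\<lambda>a. \<Sum>i\<in>I. k i * y i a) = (\<lambda>a. \<Sum>i\<in>I. k i * f (y i) a)"
proof (induction I rule: infinite_finite_induct)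
  case (insert i I)
  have "f (\<lambda>a. (\<Sum>i\<in>I. k i * y i a) + k i * y i a)
      = (\<lambda>a. (\<Sum>i\<in>I. k i * f (y i) a) + k i * f (y i) a)"
    using linD[OF assms] insert.IH by simp
  then show ?case using insert by (simp add: add.commute)
qed (simp_all add: lin_zero[OF assms])

lemma lin_funpow: "lin f \<Longrightarrow> lin (f ^^ n)"
  by (induction n) (auto simp: lin_def)

lemma len_le: "set ws \<subseteq> X \<Longrightarrow> len G X (word_prod G ws) \<le> length ws"
  unfolding len_def by (rule Least_le) blast

lemma len_witness:
  assumes "set ws \<subseteq> X" "word_prod G ws = w"
  obtains vs where "set vs \<subseteq> X" "word_prod G vs = w" "length vs = len G X w"
proof -
  have "\<exists>n vs. set vs \<subseteq> X \<and> length vs = n \<and> word_prod G vs = w" using assms by blast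
  from LeastI_ex[OF this] show ?thesis using that unfolding len_def by blast
qed

definition sroot :: "'a \<Rightarrow> 'a \<Rightarrow> real" where
  "sroot s = (\<lambda>a. if a = s then 1 else 0)"

text \<open>For \<open>n > 0\<close> the last letter is always \<open>t\<close>, and the first one
  depends on the parity of \<open>n\<close>. Growth at the left turns the image of
  \<open>sroot s\<close> into a recursion.\<close>

fun alt :: "nat \<Rightarrow> 'a \<Rightarrow> 'a \<Rightarrow> 'a list" where
  "alt 0 s t = []"
| "alt (Suc n) s t = (if even n then t else s) # alt n s t"

lemma length_alt [simp]: "length (alt n s t) = n" by (induction n) auto

lemma set_alt: "set (alt n s t) \<subseteq> {s, t}" by (induction n) auto

lemma alt_snoc: "alt n s t @ [s] = alt (Suc n) t s"
  by (induction n) auto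

lemma drop_alt: "drop i (alt (i + n) s t) = alt n s t"
  by (induction i) auto

context group
begin

abbreviation wp :: "'a list \<Rightarrow> 'a" where "wp \<equiv> word_prod G"

lemma wp_Nil [simp]: "wp [] = \<one>" by (simp add: word_prod_def)
lemma wp_Cons [simp]: "wp (x # xs) = x \<otimes> wp xs" by (simp add: word_prod_def)

lemma wp_closed [simp, intro]: "set xs \<subseteq> carrier G \<Longrightarrow> wp xs \<in> carrier G"
  by (induction xs) auto

lemma wp_append:
  "set xs \<subseteq> carrier G \<Longrightarrow> set ys \<subseteq> carrier G \<Longrightarrow>
    wp (xs @ ys) = wp xs \<otimes> wp ys"
  by (induction xs) (auto simp: m_assoc)

lemma wp_rev_involutions:
  assumes "\<And>x. x \<in> set xs \<Longrightarrow> x \<in> carrier G \<and> x \<otimes> x = \<one>"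
  shows "wp (rev xs) = inv (wp xs)"
  using assms
proof (induction xs)
  case (Cons x xs)
  have c: "set xs \<subseteq> carrier G" "x \<in> carrier G" using Cons.prems by auto
  have "inv x = x" using Cons.prems[of x] by (simp add: inv_equality)
  then show ?case using Cons c by (simp add: wp_append inv_mult_group)
qed simp

end

section \<open>Commutation equivalence of words\<close>

lemma comm_step_sym: "comm_step G xs ys \<Longrightarrow> comm_step G ys xs"
  by (induction rule: comm_step.induct) (metis comm_step.intros)

lemma comm_step_Cons: "comm_step G xs ys \<Longrightarrow> comm_step G (z # xs) (z # ys)"
  by (induction rule: comm_step.induct) (metis append_Cons comm_step.intros)

lemma comm_equiv_refl [simp]: "comm_equiv G xs xs" by (simp add: comm_equiv_def)

lemma comm_equiv_trans: "comm_equiv G xs ys \<Longrightarrow> comm_equiv G ys zs \<Longrightarrow> comm_equiv G xs zs"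
  by (simp add: comm_equiv_def)

lemma comm_equiv_sym: "comm_equiv G xs ys \<Longrightarrow> comm_equiv G ys xs"
  unfolding comm_equiv_def
  by (induction rule: rtranclp_induct) (auto intro: converse_rtranclp_into_rtranclp comm_step_sym)

lemma comm_equiv_Cons: "comm_equiv G xs ys \<Longrightarrow> comm_equiv G (z # xs) (z # ys)"
  unfolding comm_equiv_def
  by (induction rule: rtranclp_induct) (auto intro: rtranclp.rtrancl_into_rtrancl comm_step_Cons)

lemma comm_step_set: "comm_step G xs ys \<Longrightarrow> set ys = set xs \<and> length ys = length xs"
  by (induction rule: comm_step.induct) auto

lemma comm_equiv_set: "comm_equiv G xs ys \<Longrightarrow> set ys = set xs \<and> length ys = length xs"
  unfolding comm_equiv_def by (induction rule: rtranclp_induct) (auto dest: comm_step_set)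

lemma comm_equiv_move:
  "(\<And>a. a \<in> set xs \<Longrightarrow> t \<otimes>\<^bsub>G\<^esub> a = a \<otimes>\<^bsub>G\<^esub> t) \<Longrightarrow> comm_equiv G (t # xs @ ys) (xs @ t # ys)"
proof (induction xs)
  case (Cons a xs)
  have "comm_step G ([] @ [t, a] @ (xs @ ys)) ([] @ [a, t] @ (xs @ ys))"
    by (rule comm_step.intros) (use Cons.prems in simp)
  then have "comm_equiv G (t # a # xs @ ys) (a # t # xs @ ys)" by (simp add: comm_equiv_def)
  moreover have "comm_equiv G (a # t # xs @ ys) (a # xs @ t # ys)"
    by (rule comm_equiv_Cons) (use Cons in simp)
  ultimately show ?case by (auto intro: comm_equiv_trans)
qed simp

text \<open>Insertion sort: the new letter \<open>t\<close> passes only letters \<open>a\<close>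
  with \<open>f a < f t\<close>, and these stand to the right of \<open>t\<close> in the word, so
  they commute with \<open>t\<close> by hypothesis.\<close>

lemma comm_sort:
  fixes f :: "'a \<Rightarrow> int"
  assumes "sorted_wrt (\<lambda>a b. f b < f a \<longrightarrow> a \<otimes>\<^bsub>G\<^esub> b = b \<otimes>\<^bsub>G\<^esub> a) ts"
  shows "\<exists>ts'. comm_equiv G ts ts' \<and> sorted_wrt (\<lambda>a b. f a \<le> f b) ts'"
  using assms
proof (induction ts)
  case Nil
  then show ?case by (intro exI[of _ "[]"]) simp
next
  case (Cons t ts)
  then obtain ts' where ts': "comm_equiv G ts ts'" "sorted_wrt (\<lambda>a b. f a \<le> f b) ts'" by auto
  define A where "A = takeWhile (\<lambda>a. f a < f t) ts'"
  define B where "B = dropWhile (\<lambda>a. f a < f t) ts'"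
  have AB: "ts' = A @ B" by (simp add: A_def B_def)
  have A: "f a < f t" if "a \<in> set A" for a using that unfolding A_def by (metis set_takeWhileD)
  have B: "f t \<le> f b" if "b \<in> set B" for b
  proof -
    have "B \<noteq> []" using that by auto
    then have "\<not> f (hd B) < f t" unfolding B_def by (rule hd_dropWhile)
    moreover have "f (hd B) \<le> f b"
      using ts'(2) that unfolding AB by (cases B) (auto simp: sorted_wrt_append)
    ultimately show ?thesis by simp
  qed
  have "comm_equiv G (t # A @ B) (A @ t # B)"
  proof (rule comm_equiv_move)
    fix a assume "a \<in> set A"
    then have "a \<in> set ts" "f a < f t" using comm_equiv_set[OF ts'(1)] A AB by auto
    then show "t \<otimes>\<^bsub>G\<^esub> a = a \<otimes>\<^bsub>G\<^esub> t" using Cons.prems by simp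
  qed
  then have "comm_equiv G (t # ts) (A @ t # B)"
    using comm_equiv_Cons[OF ts'(1), of t] AB by (auto intro: comm_equiv_trans)
  moreover have "sorted_wrt (\<lambda>a b. f a \<le> f b) (A @ t # B)"
    using ts'(2) A B unfolding AB by (fastforce simp: sorted_wrt_append less_imp_le)
  ultimately show ?case by blast
qed

text \<open>The increments add up to \<open>n\<close>, so if all are at least one, or all at most
  one, none can deviate. The lower bound serves length-increasing words, the upper bound words in
  simple reflections.\<close>

lemma unit_steps:
  fixes g :: "nat \<Rightarrow> nat"
  assumes "(\<forall>i<n. g i + 1 \<le> g (Suc i)) \<or> (\<forall>i<n. g (Suc i) \<le> g i + 1)" "g n = g 0 + n" "i < n"
  shows "g (Suc i) = g i + 1"
proof -
  define d where "d = (\<lambda>i. int (g (Suc i)) - int (g i) - 1)"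
  have "(\<Sum>i<n. d i) = 0"
    using sum_lessThan_telescope[of "\<lambda>i. int (g i)" n] assms(2) by (simp add: d_def sum_subtractf)
  then have z: "(\<Sum>i<n. d i) = 0" "(\<Sum>i<n. - d i) = 0" by (simp_all add: sum_negf)
  from assms(1) have "d i = 0"
  proof
    assume "\<forall>i<n. g i + 1 \<le> g (Suc i)"
    then have "\<And>j. j \<in> {..<n} \<Longrightarrow> d j \<ge> 0" by (force simp: d_def)
    then have "\<forall>j\<in>{..<n}. d j = 0"
      using sum_nonneg_eq_0_iff[of "{..<n}" d] z(1) finite_lessThan by blast
    then show ?thesis using assms(3) by simp
  next
    assume "\<forall>i<n. g (Suc i) \<le> g i + 1"
    then have "\<And>j. j \<in> {..<n} \<Longrightarrow> - d j \<ge> 0" by (force simp: d_def)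
    then have "\<forall>j\<in>{..<n}. - d j = 0"
      using sum_nonneg_eq_0_iff[of "{..<n}" "\<lambda>j. - d j"] z(2) finite_lessThan by blast
    then show ?thesis using assms(3) by simp
  qed
  then show ?thesis by (simp add: d_def)
qed

lemma strictly_sorted_unique:
  fixes f :: "'a \<Rightarrow> int"
  assumes "sorted_wrt (\<lambda>a b. f a < f b) xs" "sorted_wrt (\<lambda>a b. f a < f b) ys" "set xs = set ys"
  shows "xs = ys"
  using assms
proof (induction xs arbitrary: ys)
  case (Cons x xs)
  then obtain y zs where y: "ys = y # zs" by (cases ys) auto
  have "x = y"
  proof (rule ccontr)
    assume "x \<noteq> y"
    then have "x \<in> set zs" "y \<in> set xs" using Cons.prems(3) y by auto
    then show False using Cons.prems(1,2) y by fastforce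
  qed
  moreover have "x \<notin> set xs" "y \<notin> set zs" using Cons.prems(1,2) y by auto
  ultimately have "set xs = set zs" using Cons.prems(3) y by auto
  then show ?case using Cons y \<open>x = y\<close> by auto
qed auto

section \<open>The geometric representation\<close>

locale finite_coxeter = coxeter_system G S for G (structure) and S +
  assumes finite_carrier: "finite (carrier G)"
begin

lemma S_carrier [simp, intro]: "s \<in> S \<Longrightarrow> s \<in> carrier G"
  using simple_closed by auto

lemma finite_S [simp]: "finite S"
  using simple_closed finite_carrier finite_subset by blast

lemma set_S_carrier: "set ws \<subseteq> S \<Longrightarrow> set ws \<subseteq> carrier G"
  using simple_closed by blast

lemma inv_S [simp]: "s \<in> S \<Longrightarrow> inv s = s"
  using simple_involution by (simp add: inv_equality)

lemma ex_S_word: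
  assumes "w \<in> carrier G"
  obtains ws where "set ws \<subseteq> S" "wp ws = w"
proof -
  have "w \<in> generate G S" using assms simple_generate by simp
  then have "\<exists>ws. set ws \<subseteq> S \<and> wp ws = w"
  proof (induction rule: generate.induct)
    case one
    show ?case by (rule exI[of _ "[]"]) simp
  next
    case (incl h)
    then show ?case by (intro exI[of _ "[h]"]) simp
  next
    case (inv h)
    then show ?case by (intro exI[of _ "[h]"]) simp
  next
    case (eng h1 h2)
    then obtain xs ys where "set xs \<subseteq> S" "wp xs = h1" "set ys \<subseteq> S" "wp ys = h2"
      by blast
    then show ?case
      by (intro exI[of _ "xs @ ys"]) (auto simp: wp_append set_S_carrier)
  qed
  with that show ?thesis by blast
qed

lemma ex_reduced_word:
  assumes "w \<in> carrier G"
  obtains ws where "set ws \<subseteq> S" "wp ws = w" "length ws = len G S w"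
  using ex_S_word[OF assms] len_witness by metis

text \<open>Twice the usual Tits form, so that roots have norm 2 and \<open>vref\<close> carries no
  factor. On the diagonal the order is 1 and \<open>cos pi = -1\<close> gives the value 2.\<close>

definition cox_coeff :: "'a \<Rightarrow> 'a \<Rightarrow> real" where
  "cox_coeff s t = - 2 * cos (pi / real (ord (s \<otimes> t)))"

definition bil :: "('a \<Rightarrow> real) \<Rightarrow> ('a \<Rightarrow> real) \<Rightarrow> real" where
  "bil x y = (\<Sum>s\<in>S. \<Sum>t\<in>S. x s * y t * cox_coeff s t)"

definition vref :: "('a \<Rightarrow> real) \<Rightarrow> ('a \<Rightarrow> real) \<Rightarrow> ('a \<Rightarrow> real)" where
  "vref b x = (\<lambda>a. x a - bil b x * b a)"

lemma ord_pos: "w \<in> carrier G \<Longrightarrow> ord w > 0"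
  using finite_carrier ord_ge_1 by fastforce

lemma ord_mult_commute:
  assumes "s \<in> S" "t \<in> S" shows "ord (t \<otimes> s) = ord (s \<otimes> t)"
proof -
  have "inv (s \<otimes> t) = t \<otimes> s" using assms by (simp add: inv_mult_group)
  then show ?thesis using ord_inv[of "s \<otimes> t"] assms by simp
qed

lemma cox_coeff_sym: "s \<in> S \<Longrightarrow> t \<in> S \<Longrightarrow> cox_coeff s t = cox_coeff t s"
  using ord_mult_commute[of s t] by (simp add: cox_coeff_def)

lemma cox_coeff_self: "s \<in> S \<Longrightarrow> cox_coeff s s = 2"
  by (simp add: cox_coeff_def simple_involution)

lemma ord_ge_2:
  assumes "s \<in> S" "t \<in> S" "s \<noteq> t" shows "ord (s \<otimes> t) \<ge> 2"
proof -
  have "s \<otimes> t \<noteq> \<one>"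
    using assms by (metis S_carrier inv_S inv_equality inv_inv)
  then have "ord (s \<otimes> t) \<noteq> 1" using assms ord_eq_1[of "s \<otimes> t"] by auto
  moreover have "ord (s \<otimes> t) > 0" using assms by (intro ord_pos) auto
  ultimately show ?thesis by simp
qed

lemma cox_coeff_nonpos:
  assumes "s \<in> S" "t \<in> S" "s \<noteq> t" shows "cox_coeff s t \<le> 0"
proof -
  define p where "p = pi / real (ord (s \<otimes> t))"
  have "real (ord (s \<otimes> t)) \<ge> 2" using ord_ge_2[OF assms] by simp
  then have "p \<le> pi / 2" unfolding p_def by (intro divide_left_mono) auto
  moreover have "0 \<le> p" by (simp add: p_def)
  ultimately have "cos (pi / real (ord (s \<otimes> t))) \<ge> 0"
    unfolding p_def[symmetric] using pi_ge_two by (intro cos_ge_zero) linarith+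
  then show ?thesis by (simp add: cox_coeff_def)
qed

lemma bil_sym: "bil x y = bil y x"
proof -
  have "bil x y = (\<Sum>t\<in>S. \<Sum>s\<in>S. x s * y t * cox_coeff s t)"
    unfolding bil_def by (rule sum.swap)
  also have "\<dots> = bil y x" unfolding bil_def
  proof (intro sum.cong HOL.refl)
    fix t s assume "t \<in> S" "s \<in> S"
    then show "x s * y t * cox_coeff s t = y t * x s * cox_coeff t s" by (simp add: cox_coeff_sym[of s t])
  qed
  finally show ?thesis .
qed

lemma bil_add1: "bil (\<lambda>a. x a + k * y a) z = bil x z + k * bil y z"
  unfolding bil_def by (simp add: sum_distrib_left sum.distrib algebra_simps)

lemma bil_add2: "bil z (\<lambda>a. x a + k * y a) = bil z x + k * bil z y"
  using bil_add1[of x k y z] by (simp add: bil_sym)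

lemma bil_diff1: "bil (\<lambda>a. x a - k * y a) z = bil x z - k * bil y z"
  using bil_add1[of x "-k" y z] by simp

lemma bil_diff2: "bil z (\<lambda>a. x a - k * y a) = bil z x - k * bil z y"
  using bil_add2[of z x "-k" y] by simp

lemma bil_zero1 [simp]: "bil (\<lambda>a. 0) z = 0" by (simp add: bil_def)
lemma bil_zero2 [simp]: "bil z (\<lambda>a. 0) = 0" by (simp add: bil_def)

lemma bil_scale1: "bil (\<lambda>a. k * y a) z = k * bil y z"
  using bil_add1[of "\<lambda>a. 0" k y z] by simp

lemma bil_scale2: "bil z (\<lambda>a. k * y a) = k * bil z y"
  using bil_add2[of z "\<lambda>a. 0" k y] by simp

lemma bil_uminus1 [simp]: "bil (\<lambda>a. - y a) z = - bil y z"
  using bil_scale1[of "-1" y z] by simp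

lemma bil_uminus2 [simp]: "bil z (\<lambda>a. - y a) = - bil z y"
  using bil_scale2[of z "-1" y] by simp

lemma bil_minus1: "bil (\<lambda>a. x a - y a) z = bil x z - bil y z"
  using bil_diff1[of x 1 y z] by simp

lemma bil_minus2: "bil z (\<lambda>a. x a - y a) = bil z x - bil z y"
  using bil_diff2[of z x 1 y] by simp

lemma bil_sum1: "bil (\<lambda>a. \<Sum>i\<in>I. k i * y i a) z = (\<Sum>i\<in>I. k i * bil (y i) z)"
proof (induction I rule: infinite_finite_induct)
  case (insert i I)
  then show ?case using bil_add1[of "\<lambda>a. \<Sum>i\<in>I. k i * y i a" "k i" "y i" z]
    by (simp add: add.commute)
qed simp_all

lemma bil_sum2: "bil z (\<lambda>a. \<Sum>i\<in>I. k i * y i a) = (\<Sum>i\<in>I. k i * bil z (y i))"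
  unfolding bil_sym[of z] by (rule bil_sum1)

lemma bil_sroot: "s \<in> S \<Longrightarrow> bil (sroot s) x = (\<Sum>t\<in>S. x t * cox_coeff s t)"
proof -
  assume s: "s \<in> S"
  have "bil (sroot s) x = (\<Sum>s'\<in>S. if s' = s then (\<Sum>t\<in>S. x t * cox_coeff s' t) else 0)"
    unfolding bil_def sroot_def by (intro sum.cong HOL.refl) auto
  then show ?thesis using s by simp
qed

lemma bil_sroot_sroot: "s \<in> S \<Longrightarrow> t \<in> S \<Longrightarrow> bil (sroot s) (sroot t) = cox_coeff s t"
  unfolding bil_sroot by (simp add: sroot_def if_distrib if_distribR cong: if_cong)

lemma bil_sroot_self [simp]: "s \<in> S \<Longrightarrow> bil (sroot s) (sroot s) = 2"
  by (simp add: bil_sroot_sroot cox_coeff_self)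

lemma lin_vref: "lin (vref b)"
  unfolding lin_def vref_def by (simp add: bil_add2 algebra_simps)

lemma vref_isometry:
  "bil b b = 2 \<Longrightarrow> bil (vref b x) (vref b y) = bil x y"
  unfolding vref_def by (simp add: bil_diff1 bil_diff2 bil_sym[of x b])

lemma vref_vref [simp]: "bil b b = 2 \<Longrightarrow> vref b (vref b x) = x"
  unfolding vref_def by (simp add: bil_diff2)

lemma vref_self: "bil b b = 2 \<Longrightarrow> vref b b = (\<lambda>a. - b a)"
  unfolding vref_def by simp

lemma vref_conj:
  assumes "lin f" "\<And>x y. bil (f x) (f y) = bil x y"
  shows "f (vref b x) = vref (f b) (f x)"
  unfolding vref_def using assms by (simp add: lin_diff)

section \<open>The action of words on vectors and its descent to the group\<close>

definition wact :: "'a list \<Rightarrow> ('a \<Rightarrow> real) \<Rightarrow> ('a \<Rightarrow> real)" where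
  "wact ws = foldr (\<lambda>s. vref (sroot s)) ws"

lemma wact_Nil [simp]: "wact [] x = x" by (simp add: wact_def)
lemma wact_Cons [simp]: "wact (s # ws) x = vref (sroot s) (wact ws x)" by (simp add: wact_def)
lemma wact_append: "wact (xs @ ys) x = wact xs (wact ys x)" by (simp add: wact_def)

text \<open>The recursion \<open>sin ((n+2) th) = 2 cos th sin ((n+1) th) - sin (n th)\<close>: each
  reflection replaces one coefficient by \<open>2 cos th\<close> times the other minus itself. The
  parity of \<open>n\<close> tells which simple root carries the later sine.\<close>

lemma wact_alt:
  assumes st: "s \<in> S" "t \<in> S" "s \<noteq> t"
  defines "th \<equiv> pi / real (ord (s \<otimes> t))"
  shows "wact (alt n s t) (sroot s)
    = (\<lambda>a. (if even n then sin (real (n + 1) * th) / sin th else sin (real n * th) / sin th) * sroot s a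
       + (if even n then sin (real n * th) / sin th else sin (real (n + 1) * th) / sin th) * sroot t a)"
proof (induction n)
  case 0
  have "2 \<le> ord (s \<otimes> t)" using ord_ge_2[OF st] .
  then have "0 < th" "th < pi" by (auto simp: th_def divide_less_eq)
  then have "sin th > 0" by (simp add: sin_gt_zero)
  then show ?case by simp
next
  case (Suc n)
  have bst: "bil (sroot s) (sroot t) = - 2 * cos th" "bil (sroot t) (sroot s) = - 2 * cos th"
    using st by (simp_all add: bil_sroot_sroot cox_coeff_sym[of t s] cox_coeff_def[of s t] th_def)
  have sin_rec: "sin (real (n + 2) * th) = 2 * cos th * sin (real (n + 1) * th) - sin (real n * th)"
  proof -
    have "sin (real (n + 2) * th) + sin (real n * th) = 2 * sin (real (n + 1) * th) * cos th"
      using sin_plus_sin[of "real (n + 2) * th" "real n * th"] by (simp add: add_divide_distrib algebra_simps)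
    then show ?thesis by (simp add: algebra_simps)
  qed
  have bs: "bil (sroot s) (\<lambda>a. p * sroot s a + q * sroot t a) = 2 * p - 2 * cos th * q" for p q
    using st bil_add2[of "sroot s" "\<lambda>a. p * sroot s a" q "sroot t"] by (simp add: bil_scale2 bst)
  have bt: "bil (sroot t) (\<lambda>a. p * sroot s a + q * sroot t a) = 2 * q - 2 * cos th * p" for p q
    using st bil_add2[of "sroot t" "\<lambda>a. p * sroot s a" q "sroot t"] by (simp add: bil_scale2 bst)
  have vs: "vref (sroot s) (\<lambda>a. p * sroot s a + q * sroot t a)
      = (\<lambda>a. (2 * cos th * q - p) * sroot s a + q * sroot t a)" for p q
    unfolding vref_def bs by (simp add: fun_eq_iff algebra_simps)
  have vt: "vref (sroot t) (\<lambda>a. p * sroot s a + q * sroot t a)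
      = (\<lambda>a. p * sroot s a + (2 * cos th * p - q) * sroot t a)" for p q
    unfolding vref_def bt by (simp add: fun_eq_iff algebra_simps)
  have n2: "Suc n = n + 1" "n + 1 + 1 = n + 2" by simp_all
  have rec: "sin (real (n + 2) * th) / sin th
      = 2 * cos th * (sin (real (n + 1) * th) / sin th) - sin (real n * th) / sin th"
    unfolding sin_rec by (simp add: diff_divide_distrib)
  show ?case
  proof (cases "even n")
    case True
    then have "wact (alt (Suc n) s t) (sroot s) = vref (sroot t) (wact (alt n s t) (sroot s))" by simp
    then show ?thesis unfolding Suc.IH unfolding n2
      using True by (simp only: vt rec[symmetric] if_True if_False even_add odd_one simp_thms)
  next
    case False
    then have "wact (alt (Suc n) s t) (sroot s) = vref (sroot s) (wact (alt n s t) (sroot s))" by simp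
    then show ?thesis unfolding Suc.IH unfolding n2
      using False by (simp only: vs rec[symmetric] if_True if_False even_add odd_one simp_thms)
  qed
qed

lemma dihedral_fixes_simple:
  assumes st: "s \<in> S" "t \<in> S" "s \<noteq> t"
  shows "((\<lambda>x. vref (sroot s) (vref (sroot t) x)) ^^ ord (s \<otimes> t)) (sroot s) = sroot s"
proof -
  define m where "m = ord (s \<otimes> t)"
  define th where "th = pi / real m"
  have m: "m \<ge> 2" using ord_ge_2[OF st] by (simp add: m_def)
  then have "0 < th" "th < pi" by (auto simp: th_def divide_less_eq)
  then have sth: "sin th > 0" by (simp add: sin_gt_zero)
  have pow: "((\<lambda>x. vref (sroot s) (vref (sroot t) x)) ^^ n) x = wact (alt (2 * n) s t) x" for n x
    by (induction n) simp_all
  have "real (2 * m) * th = 2 * pi" "real (2 * m + 1) * th = th + 2 * pi"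
    using m by (simp_all add: th_def field_simps)
  then have "sin (real (2 * m) * th) = 0" "sin (real (2 * m + 1) * th) = sin th"
    by (simp_all only: sin_two_pi sin_periodic)
  then show ?thesis
    using sth unfolding m_def[symmetric] pow wact_alt[OF st] th_def[symmetric] m_def[symmetric]
    by (simp only:) simp
qed

text \<open>The product of the two reflections fixes the orthogonal complement of their plane, and
  the plane is nondegenerate since \<open>sin th\<close> is nonzero. In the plane its
  \<open>m\<close>-th power fixes \<open>sroot s\<close> by the sine formula, and
  \<open>sroot t\<close> because the product in the other order is its inverse.\<close>

lemma dihedral_action:
  assumes st: "s \<in> S" "t \<in> S"
  shows "((\<lambda>x. vref (sroot s) (vref (sroot t) x)) ^^ ord (s \<otimes> t)) x = x"
proof (cases "s = t")
  case True
  then show ?thesis using st by (simp add: simple_involution)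
next
  case False
  define m where "m = ord (s \<otimes> t)"
  define th where "th = pi / real m"
  have m: "m \<ge> 2" using ord_ge_2[OF st False] by (simp add: m_def)
  then have "0 < th" "th < pi" by (auto simp: th_def divide_less_eq)
  then have sth: "sin th > 0" by (simp add: sin_gt_zero)
  have sc: "sin th * sin th = 1 - cos th * cos th"
    using sin_cos_squared_add[of th] by (simp add: power2_eq_square)
  have cc: "cos th * (cos th * z) = z - sin th * (sin th * z)" for z
    by (simp add: mult.assoc[symmetric] sc left_diff_distrib)
  have bst: "bil (sroot s) (sroot t) = - 2 * cos th" "bil (sroot t) (sroot s) = - 2 * cos th"
    using st by (simp_all add: bil_sroot_sroot cox_coeff_sym[of t s] cox_coeff_def[of s t] th_def m_def)
  define f where "f = (\<lambda>x. vref (sroot s) (vref (sroot t) x))"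
  define g where "g = (\<lambda>x. vref (sroot t) (vref (sroot s) x))"
  have linf: "lin f" using lin_vref[of "sroot s"] lin_vref[of "sroot t"] by (simp add: f_def lin_def)
  have linfm: "lin (f ^^ m)" by (rule lin_funpow[OF linf])
  have fs: "(f ^^ m) (sroot s) = sroot s"
    using dihedral_fixes_simple[OF st False] by (simp add: f_def m_def)
  have gt: "(g ^^ m) (sroot t) = sroot t"
    using dihedral_fixes_simple[OF st(2,1)] False ord_mult_commute[OF st] by (simp add: g_def m_def)
  have fg: "f (g y) = y" for y using st by (simp add: f_def g_def)
  have "(f ^^ n) ((g ^^ n) y) = y" for n y
  proof (induction n)
    case (Suc n)
    have "(f ^^ Suc n) ((g ^^ Suc n) y) = (f ^^ n) (f (g ((g ^^ n) y)))" by (simp add: funpow_swap1)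
    then show ?case using Suc fg by simp
  qed simp
  from this[of m "sroot t"] have ft: "(f ^^ m) (sroot t) = sroot t" by (simp add: gt)
  \<comment> \<open>These are the plane coordinates of \<open>x\<close>, obtained by inverting the
    Gram matrix with diagonal 2 and off-diagonal \<open>- 2 * cos th\<close>, whose determinant is
    \<open>4 sin\<^sup>2 th\<close>.\<close>
  define p where "p = (bil (sroot s) x + cos th * bil (sroot t) x) / (2 * sin th * sin th)"
  define q where "q = (bil (sroot t) x + cos th * bil (sroot s) x) / (2 * sin th * sin th)"
  define z where "z = (\<lambda>a. (x a - p * sroot s a) - q * sroot t a)"
  have x: "x = (\<lambda>a. (z a + p * sroot s a) + q * sroot t a)" by (simp add: z_def)
  have nz: "2 * sin th * sin th \<noteq> 0" using sth by simp
  have pq: "2 * p - 2 * cos th * q = bil (sroot s) x" "2 * q - 2 * cos th * p = bil (sroot t) x"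
  proof -
    have "(2 * sin th * sin th) * (2 * p - 2 * cos th * q) = (2 * sin th * sin th) * bil (sroot s) x"
      "(2 * sin th * sin th) * (2 * q - 2 * cos th * p) = (2 * sin th * sin th) * bil (sroot t) x"
      unfolding p_def q_def using nz
      by (simp_all add: right_diff_distrib' mult.assoc[symmetric])
         (simp_all add: algebra_simps cc)
    then show "2 * p - 2 * cos th * q = bil (sroot s) x" "2 * q - 2 * cos th * p = bil (sroot t) x"
      using nz by simp_all
  qed
  have z0: "bil (sroot s) z = 0" "bil (sroot t) z = 0"
    unfolding z_def bil_diff2 bst bil_sroot_self[OF st(1)] bil_sroot_self[OF st(2)]
    using pq by (simp_all add: algebra_simps)
  have "f z = z" by (simp add: f_def vref_def z0)
  then have fz: "(f ^^ n) z = z" for n by (induction n) simp_all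
  have "(f ^^ m) x = x"
    using linD[OF linfm, of "\<lambda>a. z a + p * sroot s a" q "sroot t"] linD[OF linfm, of z p "sroot s"]
      x fz fs ft by simp
  then show ?thesis by (simp add: f_def m_def)
qed

lemma wact_cong: "coxeter_cong G S xs ys \<Longrightarrow> wact xs = wact ys"
proof (induction rule: coxeter_cong.induct)
  case (relator s t xs ys)
  have "wact (concat (replicate n [s, t])) x
      = ((\<lambda>x. vref (sroot s) (vref (sroot t) x)) ^^ n) x" for n x
    by (induction n) simp_all
  then show ?case using dihedral_action[OF relator] by (auto simp: wact_append)
qed auto

lemma parity_cong: "coxeter_cong G S xs ys \<Longrightarrow> even (length xs) = even (length ys)"
proof (induction rule: coxeter_cong.induct)
  case (relator s t xs ys)
  have "even (length (concat (replicate n [s, t])))" for n by (induction n) simp_all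
  then show ?case by simp
qed auto

text \<open>The choice of the word is immaterial: words with equal product are congruent by the
  Coxeter presentation, and the relators act trivially by \<open>dihedral_action\<close>.\<close>

definition act :: "'a \<Rightarrow> ('a \<Rightarrow> real) \<Rightarrow> ('a \<Rightarrow> real)" where
  "act w = wact (SOME ws. set ws \<subseteq> S \<and> wp ws = w)"

lemma act_wp: "set ws \<subseteq> S \<Longrightarrow> act (wp ws) = wact ws"
  unfolding act_def
  by (rule someI2[of _ ws]) (auto intro: wact_cong presentation)

lemma act_one [simp]: "act \<one> x = x"
  using act_wp[of "[]"] by simp

lemma act_simple: "s \<in> S \<Longrightarrow> act s = vref (sroot s)"
  using act_wp[of "[s]"] by (simp add: fun_eq_iff)

lemma act_mult:
  assumes "w \<in> carrier G" "v \<in> carrier G" shows "act (w \<otimes> v) x = act w (act v x)"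
proof -
  from assms obtain ws vs where *: "set ws \<subseteq> S" "wp ws = w" "set vs \<subseteq> S" "wp vs = v"
    by (metis ex_S_word)
  then have "act (wp (ws @ vs)) x = wact (ws @ vs) x" by (simp add: act_wp)
  then show ?thesis using * by (metis act_wp set_S_carrier wact_append wp_append)
qed

lemma act_inv [simp]: "w \<in> carrier G \<Longrightarrow> act (inv w) (act w x) = x"
  "w \<in> carrier G \<Longrightarrow> act w (act (inv w) x) = x"
  by (simp_all add: act_mult[symmetric])

lemma lin_act: assumes "w \<in> carrier G" shows "lin (act w)"
proof -
  obtain ws where ws: "set ws \<subseteq> S" "wp ws = w" using ex_S_word assms by blast
  have "lin (wact ws)"
    by (induction ws) (use lin_vref in \<open>auto simp: lin_def\<close>)
  with act_wp ws show ?thesis by metis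
qed

lemma bil_act: assumes "w \<in> carrier G" shows "bil (act w x) (act w y) = bil x y"
proof -
  obtain ws where ws: "set ws \<subseteq> S" "wp ws = w" using ex_S_word assms by blast
  have "bil (wact ws x) (wact ws y) = bil x y" using ws(1)
    by (induction ws) (simp_all add: vref_isometry)
  with act_wp ws show ?thesis by metis
qed

lemma bil_act_left: "w \<in> carrier G \<Longrightarrow> bil (act w x) y = bil x (act (inv w) y)"
  using bil_act[of w x "act (inv w) y"] by simp

definition supp :: "'a set \<Rightarrow> ('a \<Rightarrow> real) \<Rightarrow> bool" where
  "supp J x \<longleftrightarrow> (\<forall>a. a \<notin> J \<longrightarrow> x a = 0)"

lemma supp_sroot [simp]: "supp J (sroot s) \<longleftrightarrow> s \<in> J" by (auto simp: supp_def sroot_def)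

lemma supp_vref: "supp J b \<Longrightarrow> supp J x \<Longrightarrow> supp J (vref b x)" by (auto simp: supp_def vref_def)

lemma supp_mono: "supp J x \<Longrightarrow> J \<subseteq> K \<Longrightarrow> supp K x" by (auto simp: supp_def)

lemma supp_wact: "set ws \<subseteq> J \<Longrightarrow> supp J x \<Longrightarrow> supp J (wact ws x)"
  by (induction ws) (auto intro!: supp_vref)

lemma supp_act: "w \<in> carrier G \<Longrightarrow> supp S x \<Longrightarrow> supp S (act w x)"
  by (metis act_wp ex_S_word supp_wact)

section \<open>The length function and the positivity theorem of Tits\<close>

lemma len_one [simp]: "len G S \<one> = 0"
  using len_le[of "[]" S G] by simp

lemma len_mult_le:
  assumes "w \<in> carrier G" "v \<in> carrier G" shows "len G S (w \<otimes> v) \<le> len G S w + len G S v"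
proof -
  obtain ws vs where *: "set ws \<subseteq> S" "wp ws = w" "length ws = len G S w"
    "set vs \<subseteq> S" "wp vs = v" "length vs = len G S v"
    using ex_reduced_word assms by metis
  then show ?thesis using len_le[of "ws @ vs" S G] by (simp add: wp_append set_S_carrier)
qed

lemma len_simple_le: "s \<in> S \<Longrightarrow> len G S s \<le> 1"
  using len_le[of "[s]" S G] by simp

lemma len_mult_simple_le: "w \<in> carrier G \<Longrightarrow> s \<in> S \<Longrightarrow> len G S (w \<otimes> s) \<le> len G S w + 1"
  using len_mult_le[of w s] len_simple_le[of s] by simp

lemma mult_simple_simple [simp]: "w \<in> carrier G \<Longrightarrow> s \<in> S \<Longrightarrow> w \<otimes> s \<otimes> s = w"
  by (simp add: m_assoc simple_involution)

lemma len_parity: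
  assumes "set ws \<subseteq> S" shows "even (len G S (wp ws)) = even (length ws)"
proof -
  have "wp ws \<in> carrier G" using assms set_S_carrier by blast
  from ex_reduced_word[OF this] obtain vs where vs: "set vs \<subseteq> S" "wp vs = wp ws"
    "length vs = len G S (wp ws)" .
  from parity_cong[OF presentation[OF vs(1) assms vs(2)]] vs(3) show ?thesis by simp
qed

lemma len_mult_simple_neq:
  assumes "w \<in> carrier G" "s \<in> S" shows "len G S (w \<otimes> s) \<noteq> len G S w"
proof -
  obtain ws where ws: "set ws \<subseteq> S" "wp ws = w" using ex_S_word assms by blast
  then have "wp (ws @ [s]) = w \<otimes> s" using assms by (simp add: wp_append set_S_carrier)
  then show ?thesis using len_parity[of "ws @ [s]"] len_parity[of ws] ws assms(2) by auto
qed

lemma len_mult_simple_cases: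
  assumes "w \<in> carrier G" "s \<in> S"
  shows "len G S (w \<otimes> s) = len G S w + 1 \<or> len G S w = len G S (w \<otimes> s) + 1"
  using len_mult_simple_le[OF assms] len_mult_simple_le[of "w \<otimes> s" s] len_mult_simple_neq[OF assms] assms
  by fastforce

lemma ex_descent:
  assumes "w \<in> carrier G" "w \<noteq> \<one>"
  obtains s where "s \<in> S" "len G S (w \<otimes> s) < len G S w"
proof -
  obtain ws where ws: "set ws \<subseteq> S" "wp ws = w" "length ws = len G S w"
    using ex_reduced_word assms by blast
  then obtain vs s where vs: "ws = vs @ [s]" using assms(2) by (cases ws rule: rev_cases) auto
  then have "w = wp vs \<otimes> s" "set vs \<subseteq> S" "s \<in> S" using ws by (auto simp: wp_append set_S_carrier)
  then have "w \<otimes> s = wp vs" by (simp add: set_S_carrier wp_closed)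
  with len_le[of vs S G] \<open>set vs \<subseteq> S\<close> vs ws(3) \<open>s \<in> S\<close> that show ?thesis by force
qed

lemma wp_alt_even: "s \<in> S \<Longrightarrow> t \<in> S \<Longrightarrow> wp (alt (2 * k) s t) = (s \<otimes> t) [^] k"
proof (induction k)
  case (Suc k)
  have "wp (alt (2 * Suc k) s t) = s \<otimes> (t \<otimes> (s \<otimes> t) [^] k)" using Suc by simp
  also have "\<dots> = (s \<otimes> t) \<otimes> (s \<otimes> t) [^] k" using Suc.prems by (simp add: m_assoc)
  also have "\<dots> = (s \<otimes> t) [^] Suc k" using Suc.prems nat_pow_Suc2[of "s \<otimes> t" k] by simp
  finally show ?case .
qed simp

lemma len_alt_less:
  assumes st: "s \<in> S" "t \<in> S" and n: "n > ord (s \<otimes> t)"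
  shows "len G S (wp (alt n s t)) < n"
proof -
  define m where "m = ord (s \<otimes> t)"
  have sub: "set (alt k s t) \<subseteq> S" for k using set_alt[of k s t] st by auto
  have one: "wp (alt (2 * m) s t) = \<one>"
    using st by (simp add: wp_alt_even m_def pow_ord_eq_1)
  have inS: "set (take i (alt k s t)) \<subseteq> S" for i k using sub[of k] set_take_subset by fast
  show ?thesis
  proof (cases "n \<le> 2 * m")
    case True
    define X where "X = take (2 * m - n) (alt (2 * m) s t)"
    have "drop (2 * m - n) (alt (2 * m) s t) = alt n s t"
      using drop_alt[of "2 * m - n" n s t] True by simp
    then have "alt (2 * m) s t = X @ alt n s t" by (metis X_def append_take_drop_id)
    with one inS sub have "wp X \<otimes> wp (alt n s t) = \<one>"
      by (metis X_def set_S_carrier wp_append)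
    then have "wp (alt n s t) = inv (wp X)"
      using inS sub by (metis X_def inv_equality inv_inv set_S_carrier wp_closed)
    also have "\<dots> = wp (rev X)"
      using inS[of "2 * m - n" "2 * m"] simple_involution unfolding X_def
      by (intro wp_rev_involutions[symmetric]) blast
    finally have "len G S (wp (alt n s t)) \<le> length X"
      using len_le[of "rev X" S G] inS by (simp add: X_def)
    also have "length X < n" using n True by (simp add: X_def m_def)
    finally show ?thesis .
  next
    case False
    define X where "X = take (n - 2 * m) (alt n s t)"
    have "drop (n - 2 * m) (alt n s t) = alt (2 * m) s t"
      using drop_alt[of "n - 2 * m" "2 * m" s t] False by simp
    then have "alt n s t = X @ alt (2 * m) s t" by (metis X_def append_take_drop_id)
    then have "wp (alt n s t) = wp X"
      using one inS sub by (metis X_def r_one set_S_carrier wp_append wp_closed)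
    then have "len G S (wp (alt n s t)) \<le> length X" using len_le[of X S G] inS by (simp add: X_def)
    moreover have "m > 0" using st by (auto simp: m_def intro: ord_pos)
    ultimately show ?thesis using False by (simp add: X_def)
  qed
qed

text \<open>Tits' argument: \<open>w\<close> is split into the shortest element \<open>v\<close> of
  its coset modulo the dihedral group of \<open>s\<close> and a descent \<open>t\<close>, times a
  dihedral element. The latter sends \<open>sroot s\<close> to a nonnegative combination of
  \<open>sroot s\<close> and \<open>sroot t\<close>, and the induction applies to \<open>v\<close>
  on both.\<close>

lemma tits_nonneg:
  "w \<in> carrier G \<Longrightarrow> s \<in> S \<Longrightarrow> len G S (w \<otimes> s) > len G S w \<Longrightarrow> act w (sroot s) a \<ge> 0"
proof (induction "len G S w" arbitrary: w s a rule: less_induct)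
  case less
  note w = less.prems(1) and s = less.prems(2) and ws = less.prems(3)
  show ?case
  proof (cases "w = \<one>")
    case True
    then show ?thesis by (simp add: sroot_def)
  next
    case False
    then obtain t where t: "t \<in> S" "len G S (w \<otimes> t) < len G S w" using ex_descent w by blast
    have st: "s \<noteq> t" using ws t by auto
    \<comment> \<open>A maximal dihedral right factor with additive lengths is what makes
      \<open>v\<close> minimal in its coset.\<close>
    define Q where "Q = (\<lambda>n. \<exists>v\<in>carrier G. w = v \<otimes> wp (alt n s t) \<and> len G S w = len G S v + n)"
    have "Q 1" unfolding Q_def
      using w t len_mult_simple_cases[OF w t(1)] by (intro bexI[of _ "w \<otimes> t"]) auto
    moreover have "\<forall>n. Q n \<longrightarrow> n \<le> len G S w" by (auto simp: Q_def)
    ultimately obtain n where n: "Q n" "\<And>k. Q k \<Longrightarrow> k \<le> n"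
      by (metis Greatest_le_nat GreatestI_nat)
    have n1: "n \<ge> 1" using n(2)[OF \<open>Q 1\<close>] .
    from n(1) obtain v where v: "v \<in> carrier G" "w = v \<otimes> wp (alt n s t)"
      "len G S w = len G S v + n" by (auto simp: Q_def)
    have sub: "set (alt k s t) \<subseteq> S" "set (alt k t s) \<subseteq> S" for k
      using set_alt[of k s t] set_alt[of k t s] s t by auto
    have up: "len G S (v \<otimes> x) > len G S v" if "x \<in> {s, t}" for x
    proof (rule ccontr)
      assume neg: "\<not> len G S (v \<otimes> x) > len G S v"
      have x: "x \<in> S" using that s t by auto
      have lx: "len G S v = len G S (v \<otimes> x) + 1" using neg len_mult_simple_cases[OF v(1) x] by auto
      have vx: "v = (v \<otimes> x) \<otimes> x" using v x by simp
      show False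
      \<comment> \<open>Either \<open>x\<close> could be prepended to the alternating word, against
        the maximality of \<open>n\<close>, or \<open>x\<close> is already its first letter and
        cancels, so that \<open>w\<close> would be too short.\<close>
      proof (cases "x = (if even n then t else s)")
        case True
        have "w = (v \<otimes> x) \<otimes> (x \<otimes> wp (alt n s t))"
          using v x sub by (simp add: m_assoc[symmetric] set_S_carrier wp_closed)
        then have "Q (Suc n)" unfolding Q_def using True v x lx
          by (intro bexI[of _ "v \<otimes> x"]) auto
        then show False using n(2) by fastforce
      next
        case False
        obtain k where k: "n = Suc k" using n1 by (cases n) auto
        with False that have "alt n s t = x # alt k s t" by auto
        then have "w = v \<otimes> x \<otimes> wp (alt k s t)"
          using v x sub by (simp add: m_assoc set_S_carrier wp_closed)
        then have "len G S w \<le> len G S (v \<otimes> x) + k"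
          using len_mult_le[of "v \<otimes> x" "wp (alt k s t)"] len_le[OF sub(1), of G k] v x sub
          by (simp add: set_S_carrier wp_closed)
        then show False using lx v(3) k by simp
      qed
    qed
    have IH: "act v (sroot x) a \<ge> 0" if "x \<in> {s, t}" for x
      using less.hyps[of v x a] v n1 up[OF that] that s t by auto
    \<comment> \<open>Otherwise the alternating word for \<open>w \<otimes> s\<close> would exceed
      the order and be shortened by \<open>len_alt_less\<close>. The bound keeps the angles
      \<open>k * th\<close> within the interval from 0 to pi, where the sine is nonnegative.\<close>
    have "n + 1 \<le> ord (s \<otimes> t)"
    proof (rule ccontr)
      assume "\<not> n + 1 \<le> ord (s \<otimes> t)"
      then have "len G S (wp (alt (Suc n) t s)) < Suc n"
        using len_alt_less[of t s "Suc n"] ord_mult_commute[of s t] s t by simp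
      moreover have "w \<otimes> s = v \<otimes> wp (alt (Suc n) t s)"
        using v s sub unfolding alt_snoc[symmetric]
        by (simp add: wp_append set_S_carrier wp_closed m_assoc)
      ultimately have "len G S (w \<otimes> s) < len G S v + Suc n"
        using len_mult_le[of v "wp (alt (Suc n) t s)"] v sub
        by (metis le_less_trans nat_add_left_cancel_less set_S_carrier wp_closed)
      then show False using ws v(3) by simp
    qed
    define th where "th = pi / real (ord (s \<otimes> t))"
    have sinnn: "sin (real k * th) / sin th \<ge> 0" if "k \<le> n + 1" for k
    proof -
      have o: "real (ord (s \<otimes> t)) > 0" using \<open>n + 1 \<le> ord (s \<otimes> t)\<close> by simp
      have "real k * th \<le> pi" using that \<open>n + 1 \<le> ord (s \<otimes> t)\<close> o by (simp add: th_def divide_le_eq)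
      moreover have "th \<le> pi" using o by (simp add: th_def divide_le_eq)
      moreover have "th \<ge> 0" by (simp add: th_def)
      ultimately show ?thesis by (intro divide_nonneg_nonneg sin_ge_zero) auto
    qed
    have "\<exists>p q. p \<ge> 0 \<and> q \<ge> 0 \<and> wact (alt n s t) (sroot s) = (\<lambda>a. p * sroot s a + q * sroot t a)"
      unfolding wact_alt[OF s t(1) st] th_def[symmetric]
      using sinnn[of n] sinnn[of "n + 1"]
      by (intro exI conjI, rule_tac [3] HOL.refl) simp_all
    then obtain p q where pq: "p \<ge> 0" "q \<ge> 0"
      "wact (alt n s t) (sroot s) = (\<lambda>a. p * sroot s a + q * sroot t a)" by blast
    have "act w (sroot s) = act v (wact (alt n s t) (sroot s))"
      using v act_mult[of v "wp (alt n s t)"] act_wp[OF sub(1)] sub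
      by (simp add: set_S_carrier wp_closed)
    also have "\<dots> = (\<lambda>a. p * act v (sroot s) a + q * act v (sroot t) a)"
      unfolding pq(3)
      using linD[OF lin_act[OF v(1)], of "\<lambda>a. p * sroot s a" q "sroot t"] lin_scale[OF lin_act[OF v(1)], of p "sroot s"]
      by simp
    finally show ?thesis using pq IH by simp
  qed
qed

subsection \<open>Roots and reflections\<close>

definition Phi :: "('a \<Rightarrow> real) set" where
  "Phi = {act w (sroot s) | w s. w \<in> carrier G \<and> s \<in> S}"

definition pos :: "('a \<Rightarrow> real) \<Rightarrow> bool" where
  "pos x \<longleftrightarrow> (\<forall>a. x a \<ge> 0)"

abbreviation T :: "'a set" where "T \<equiv> reflections G S"

lemma finite_Phi: "finite Phi"
proof -
  have "Phi = (\<lambda>(w, s). act w (sroot s)) ` (carrier G \<times> S)" by (auto simp: Phi_def)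
  then show ?thesis using finite_carrier by simp
qed

lemma sroot_Phi [simp, intro]: "s \<in> S \<Longrightarrow> sroot s \<in> Phi"
  unfolding Phi_def by (rule CollectI, rule exI[of _ \<one>], rule exI[of _ s]) (simp add: fun_eq_iff)

lemma pos_sroot [simp]: "pos (sroot s)" by (simp add: pos_def sroot_def)

lemma Phi_norm [simp]: "b \<in> Phi \<Longrightarrow> bil b b = 2"
  by (auto simp: Phi_def bil_act)

lemma Phi_supp: "b \<in> Phi \<Longrightarrow> supp S b"
  by (auto simp: Phi_def intro!: supp_act)

lemma Phi_act [intro]: "w \<in> carrier G \<Longrightarrow> b \<in> Phi \<Longrightarrow> act w b \<in> Phi"
  unfolding Phi_def by (clarsimp simp: act_mult[symmetric]) (rule exI, rule exI, intro conjI, rule HOL.refl, auto)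

lemma act_simple_self: "s \<in> S \<Longrightarrow> act s (sroot s) = (\<lambda>a. - sroot s a)"
  by (simp add: act_simple vref_self)

lemma Phi_uminus [intro]: assumes "b \<in> Phi" shows "(\<lambda>a. - b a) \<in> Phi"
proof -
  from assms obtain w s where w: "w \<in> carrier G" "s \<in> S" "b = act w (sroot s)" by (auto simp: Phi_def)
  have "act (w \<otimes> s) (sroot s) = (\<lambda>a. - b a)"
    using w by (simp add: act_mult act_simple_self lin_uminus lin_act)
  then show ?thesis using w unfolding Phi_def
    by (intro CollectI exI[of _ "w \<otimes> s"] exI[of _ s]) auto
qed

lemma tits_neg:
  assumes "w \<in> carrier G" "s \<in> S" "len G S (w \<otimes> s) < len G S w"
  shows "pos (\<lambda>a. - act w (sroot s) a)"
proof -
  have "act (w \<otimes> s) (sroot s) = (\<lambda>a. - act w (sroot s) a)"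
    using assms by (simp add: act_mult act_simple_self lin_uminus lin_act)
  then show ?thesis using tits_nonneg[of "w \<otimes> s" s] assms by (simp add: pos_def)
qed

lemma Phi_cases: assumes "b \<in> Phi" shows "pos b \<or> pos (\<lambda>a. - b a)"
proof -
  from assms obtain w s where w: "w \<in> carrier G" "s \<in> S" "b = act w (sroot s)" by (auto simp: Phi_def)
  show ?thesis
    using len_mult_simple_neq[OF w(1,2)] tits_nonneg[OF w(1,2)] tits_neg[OF w(1,2)] w(3)
    by (auto simp: pos_def linorder_neq_iff)
qed

lemma Phi_nonzero: assumes "b \<in> Phi" shows "\<exists>a\<in>S. b a \<noteq> 0"
proof (rule ccontr)
  assume "\<not> ?thesis"
  then have "b = (\<lambda>a. 0)" using Phi_supp[OF assms] by (auto simp: supp_def fun_eq_iff)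
  then show False using Phi_norm[OF assms] by simp
qed

lemma pos_asym: assumes "b \<in> Phi" "pos b" shows "\<not> pos (\<lambda>a. - b a)"
proof
  assume "pos (\<lambda>a. - b a)"
  then have "b a = 0" for a using assms(2) unfolding pos_def by (metis neg_0_le_iff_le order_antisym)
  then show False using Phi_nonzero[OF assms(1)] by auto
qed

lemma pos_coeff: assumes "b \<in> Phi" "b a > 0" shows "pos b"
  using Phi_cases[OF assms(1)] assms(2) unfolding pos_def by (metis neg_0_le_iff_le not_le)

lemma tits_iff: assumes "w \<in> carrier G" "s \<in> S"
  shows "len G S w < len G S (w \<otimes> s) \<longleftrightarrow> pos (act w (sroot s))"
proof
  assume "len G S w < len G S (w \<otimes> s)"
  then show "pos (act w (sroot s))" using tits_nonneg[OF assms] by (simp add: pos_def)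
next
  assume p: "pos (act w (sroot s))"
  have "act w (sroot s) \<in> Phi" using assms by auto
  from pos_asym[OF this p] tits_neg[OF assms] len_mult_simple_neq[OF assms]
  show "len G S w < len G S (w \<otimes> s)" by (meson linorder_neqE_nat)
qed

lemma vref_sroot_other: "a \<noteq> s \<Longrightarrow> vref (sroot s) x a = x a"
  by (simp add: vref_def sroot_def)

text \<open>Equal norms force \<open>k * k = 4\<close>, and \<open>k = -2\<close> contradicts
  positivity. The factor 2 is there because proportionality of roots arises in the form
  \<open>2 b = B(b', b) b'\<close>.\<close>

lemma root_parallel:
  assumes "b \<in> Phi" "b' \<in> Phi" "pos b" "pos b'" "\<And>a. 2 * b a = k * b' a"
  shows "b = b'"
proof -
  have e: "(\<lambda>a. 2 * b a) = (\<lambda>a. k * b' a)" using assms(5) by (simp add: fun_eq_iff)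
  have "2 * bil b b = k * bil b' b" using e by (metis bil_scale1)
  moreover have "2 * bil b b' = k * bil b' b'" using e by (metis bil_scale1)
  ultimately have "k * k = 4" using assms(1,2) by (simp add: bil_sym[of b' b])
  then have "(k - 2) * (k + 2) = 0" by (simp add: algebra_simps)
  then have "k = 2 \<or> k = - 2" by auto
  then show ?thesis
  proof
    assume "k = 2"
    then show ?thesis using assms(5) by (auto simp: fun_eq_iff)
  next
    assume "k = - 2"
    then have "b a = - b' a" for a using assms(5)[of a] by simp
    then have "b = (\<lambda>a. - b' a)" by (simp add: fun_eq_iff)
    then show ?thesis using pos_asym[OF assms(2,4)] assms(3) by simp
  qed
qed

text \<open>A positive root other than \<open>sroot s\<close> has a positive coordinate away from
  \<open>s\<close>, which the reflection leaves unchanged; one positive coordinate makes a root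
  positive.\<close>

lemma act_simple_pos:
  assumes "b \<in> Phi" "pos b" "s \<in> S" "b \<noteq> sroot s" shows "pos (act s b)"
proof -
  have "\<exists>a. a \<noteq> s \<and> b a > 0"
  proof (rule ccontr)
    assume "\<not> ?thesis"
    then have "b a = 0" if "a \<noteq> s" for a using assms(2) that unfolding pos_def by (metis order_le_less)
    then have "2 * b a = (2 * b s) * sroot s a" for a by (simp add: sroot_def)
    from root_parallel[OF assms(1) sroot_Phi[OF assms(3)] assms(2) pos_sroot this] assms(4)
    show False by simp
  qed
  then obtain a where "a \<noteq> s" "b a > 0" by blast
  then have "act s b a > 0" using assms(3) by (simp add: act_simple vref_sroot_other)
  moreover have "act s b \<in> Phi" using assms by auto
  ultimately show ?thesis by (rule pos_coeff[rotated])
qed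

lemma act_pos_imp_one:
  assumes "w \<in> carrier G" "\<And>s. s \<in> S \<Longrightarrow> pos (act w (sroot s))" shows "w = \<one>"
  using assms by (metis ex_descent less_asym tits_iff)

lemma act_faithful:
  assumes "w \<in> carrier G" "v \<in> carrier G" "act w = act v" shows "w = v"
proof -
  have "inv w \<otimes> v = \<one>"
  proof (rule act_pos_imp_one)
    fix s
    have "act (inv w \<otimes> v) (sroot s) = act (inv w) (act w (sroot s))"
      using assms by (simp add: act_mult)
    also have "\<dots> = sroot s" using assms(1) by (rule act_inv)
    finally show "pos (act (inv w \<otimes> v) (sroot s))" by simp
  qed (use assms in auto)
  then show ?thesis using assms by (metis inv_closed inv_equality inv_inv)
qed

lemma T_iff: "t \<in> T \<longleftrightarrow> (\<exists>w\<in>carrier G. \<exists>s\<in>S. t = w \<otimes> s \<otimes> inv w)"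
  by (auto simp: reflections_def)

lemma T_carrier [simp, intro]: "t \<in> T \<Longrightarrow> t \<in> carrier G"
  by (auto simp: T_iff)

lemma S_T [simp, intro]: "s \<in> S \<Longrightarrow> s \<in> T"
  unfolding T_iff by (rule bexI[of _ \<one>], rule bexI[of _ s]) auto

lemma T_conj [intro]: assumes "t \<in> T" "w \<in> carrier G" shows "w \<otimes> t \<otimes> inv w \<in> T"
proof -
  from assms(1) obtain v s where v: "v \<in> carrier G" "s \<in> S" "t = v \<otimes> s \<otimes> inv v" by (auto simp: T_iff)
  then have "w \<otimes> t \<otimes> inv w = (w \<otimes> v) \<otimes> s \<otimes> inv (w \<otimes> v)"
    using assms(2) by (simp add: m_assoc inv_mult_group)
  then show ?thesis unfolding T_iff using v assms(2) by (intro bexI[of _ "w \<otimes> v"] bexI[of _ s]) auto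
qed

lemma act_conj:
  assumes "t \<in> carrier G" "w \<in> carrier G" "act t = vref b"
  shows "act (w \<otimes> t \<otimes> inv w) = vref (act w b)"
proof
  fix x
  have "act (w \<otimes> t \<otimes> inv w) x = act w (vref b (act (inv w) x))" using assms by (simp add: act_mult)
  also have "\<dots> = vref (act w b) (act w (act (inv w) x))"
    using assms(2) by (intro vref_conj lin_act bil_act)
  finally show "act (w \<otimes> t \<otimes> inv w) x = vref (act w b) x" using assms by simp
qed

lemma vref_uminus: "vref (\<lambda>a. - b a) = vref b"
  by (simp add: vref_def fun_eq_iff)

lemma vref_inj:
  assumes "b \<in> Phi" "b' \<in> Phi" "pos b" "pos b'" "vref b = vref b'" shows "b = b'"
proof (rule root_parallel[OF assms(1-4)])
  fix a
  have "vref b' b = (\<lambda>a. - b a)" using assms(1,5) vref_self[of b] by simp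
  then have "b a - bil b' b * b' a = - b a" by (simp add: vref_def fun_eq_iff)
  then show "2 * b a = bil b' b * b' a" by simp
qed

definition proot :: "'a \<Rightarrow> 'a \<Rightarrow> real" where
  "proot t = (THE b. b \<in> Phi \<and> pos b \<and> act t = vref b)"

lemma proot_eqI: "b \<in> Phi \<Longrightarrow> pos b \<Longrightarrow> act t = vref b \<Longrightarrow> proot t = b"
  unfolding proot_def by (rule the_equality) (auto intro: vref_inj)

lemma ex_proot: assumes "t \<in> T" shows "\<exists>b. b \<in> Phi \<and> pos b \<and> act t = vref b"
proof -
  from assms obtain w s where w: "w \<in> carrier G" "s \<in> S" "t = w \<otimes> s \<otimes> inv w" by (auto simp: T_iff)
  define b where "b = act w (sroot s)"
  have b: "b \<in> Phi" "act t = vref b" using w by (auto simp: b_def act_conj act_simple)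
  then show ?thesis using Phi_cases[OF b(1)] Phi_uminus[OF b(1)] vref_uminus[of b] by metis
qed

lemma proot:
  assumes "t \<in> T"
  shows proot_Phi [simp, intro]: "proot t \<in> Phi" and pos_proot [simp, intro]: "pos (proot t)"
    and act_refl: "act t = vref (proot t)"
  using ex_proot[OF assms] proot_eqI by metis+

lemma proot_simple [simp]: "s \<in> S \<Longrightarrow> proot s = sroot s"
  by (rule proot_eqI) (auto simp: act_simple)

lemma proot_inj: "t \<in> T \<Longrightarrow> t' \<in> T \<Longrightarrow> proot t = proot t' \<Longrightarrow> t = t'"
  by (metis T_carrier act_faithful act_refl)

lemma proot_conj:
  assumes "t \<in> T" "w \<in> carrier G" "pos (act w (proot t))"
  shows "proot (w \<otimes> t \<otimes> inv w) = act w (proot t)"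
  using assms by (intro proot_eqI) (auto simp: act_conj act_refl)

lemma T_invol [simp]: assumes "t \<in> T" shows "t \<otimes> t = \<one>"
proof (rule act_faithful)
  show "act (t \<otimes> t) = act \<one>" using assms by (intro ext) (simp add: act_mult act_refl)
qed (use assms in auto)

lemma inv_T [simp]: "t \<in> T \<Longrightarrow> inv t = t"
  by (simp add: inv_equality)

lemma act_T_self: "t \<in> T \<Longrightarrow> act t (proot t) = (\<lambda>a. - proot t a)"
  by (simp add: act_refl vref_self)

text \<open>Strong exchange: at the letter \<open>s\<close> where the root of \<open>t\<close> turns
  negative, the current root must be \<open>sroot s\<close>. Hence \<open>t\<close> is conjugate to
  \<open>s\<close> by the rest of the word, and right multiplication by \<open>t\<close> deletes
  that letter.\<close>

lemma exchange:
  assumes "t \<in> T" "set ws \<subseteq> S" "\<not> pos (wact ws (proot t))"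
  shows "\<exists>vs. set vs \<subseteq> S \<and> length vs < length ws \<and> wp vs = wp ws \<otimes> t"
  using assms(2,3)
proof (induction ws)
  case Nil
  then show ?case using assms(1) by simp
next
  case (Cons s ws)
  have s: "s \<in> S" and ws: "set ws \<subseteq> S" using Cons.prems by auto
  define w where "w = wp ws"
  have w: "w \<in> carrier G" using ws by (auto simp: w_def set_S_carrier)
  have aw: "act w = wact ws" using act_wp[OF ws] by (simp add: w_def)
  show ?case
  proof (cases "pos (wact ws (proot t))")
    case False
    from Cons.IH[OF ws False] obtain vs where
      "set vs \<subseteq> S" "length vs < length ws" "wp vs = wp ws \<otimes> t" by blast
    then show ?thesis using s w assms(1) by (intro exI[of _ "s # vs"]) (auto simp: m_assoc w_def)
  next
    case True
    have b: "act w (proot t) \<in> Phi" using w assms(1) by auto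
    have "act w (proot t) = sroot s"
      using act_simple_pos[OF b _ s] True Cons.prems(2) s by (auto simp: aw act_simple)
    then have "act (w \<otimes> t \<otimes> inv w) = act s"
      using assms(1) w s by (simp add: act_conj act_refl act_simple)
    then have "w \<otimes> t \<otimes> inv w = s" using w assms(1) s by (intro act_faithful) auto
    then have "w \<otimes> t = s \<otimes> w" using w assms(1) s by (metis T_carrier inv_solve_right' m_closed S_carrier)
    then have "s \<otimes> w \<otimes> t = w" using w s assms(1)
      by (simp add: m_assoc) (simp add: m_assoc[symmetric] simple_involution)
    then show ?thesis using ws by (intro exI[of _ ws]) (simp add: w_def)
  qed
qed

lemma len_refl_less:
  assumes "w \<in> carrier G" "t \<in> T" "\<not> pos (act w (proot t))"
  shows "len G S (w \<otimes> t) < len G S w"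
proof -
  obtain ws where ws: "set ws \<subseteq> S" "wp ws = w" "length ws = len G S w"
    using ex_reduced_word assms(1) by blast
  from exchange[OF assms(2) ws(1)] assms(3) obtain vs where
    "set vs \<subseteq> S" "length vs < length ws" "wp vs = w \<otimes> t"
    using ws act_wp[OF ws(1)] by auto
  then show ?thesis using len_le[of vs S G] ws by simp
qed

lemma len_refl_iff:
  assumes "w \<in> carrier G" "t \<in> T"
  shows "len G S w < len G S (w \<otimes> t) \<longleftrightarrow> pos (act w (proot t))"
proof
  assume "len G S w < len G S (w \<otimes> t)"
  then show "pos (act w (proot t))" using len_refl_less[OF assms] by auto
next
  assume p: "pos (act w (proot t))"
  have "act (w \<otimes> t) (proot t) = (\<lambda>a. - act w (proot t) a)"
    using assms by (simp add: act_mult act_T_self lin_uminus lin_act)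
  moreover have "act w (proot t) \<in> Phi" using assms by auto
  ultimately have "\<not> pos (act (w \<otimes> t) (proot t))" using p pos_asym by simp
  from len_refl_less[OF _ assms(2) this] assms show "len G S w < len G S (w \<otimes> t)"
    by (simp add: m_assoc)
qed

text \<open>If \<open>t\<close> and \<open>t'\<close> commute, \<open>t\<close> preserves the
  reflection \<open>t'\<close>, hence its root up to sign. The minus sign would make the two roots
  proportional, so the root is fixed and the pairing vanishes.\<close>

lemma commute_iff:
  assumes "t \<in> T" "t' \<in> T" "t \<noteq> t'"
  shows "t \<otimes> t' = t' \<otimes> t \<longleftrightarrow> bil (proot t) (proot t') = 0"
proof
  assume "bil (proot t) (proot t') = 0"
  then have "act (t \<otimes> t') = act (t' \<otimes> t)" using assms
    by (intro ext) (simp add: act_mult act_refl vref_def bil_diff2 bil_sym[of "proot t'" "proot t"])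
  then show "t \<otimes> t' = t' \<otimes> t" using assms by (intro act_faithful) auto
next
  assume "t \<otimes> t' = t' \<otimes> t"
  then have tt: "t \<otimes> t' \<otimes> inv t = t'" using assms by (simp add: m_assoc)
  have b: "act t (proot t') \<in> Phi" using assms by auto
  have a: "act t (proot t') = (\<lambda>a. proot t' a - bil (proot t) (proot t') * proot t a)"
    using assms by (simp add: act_refl vref_def)
  show "bil (proot t) (proot t') = 0"
  proof (cases "pos (act t (proot t'))")
    case True
    with proot_conj[of t' t] assms tt have "act t (proot t') = proot t'" by simp
    then have "bil (proot t) (proot t') * proot t x = 0" for x unfolding a by (auto simp: fun_eq_iff)
    then show ?thesis using Phi_nonzero[OF proot_Phi[OF assms(1)]] by auto
  next
    case False
    then have p: "pos (\<lambda>a. - act t (proot t') a)" using Phi_cases[OF b] by simp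
    have "act t' = vref (act t (proot t'))"
      using act_conj[of t' t "proot t'"] assms tt by (simp add: act_refl)
    then have "proot t' = (\<lambda>a. - act t (proot t') a)"
      by (intro proot_eqI Phi_uminus b p) (simp add: vref_uminus)
    then have "proot t' x = - act t (proot t') x" for x by metis
    then have "2 * proot t' x = bil (proot t) (proot t') * proot t x" for x
      unfolding a by (metis add_diff_cancel_right' diff_add_cancel minus_diff_eq mult_2)
    then have "proot t' = proot t" using assms by (intro root_parallel) auto
    then show ?thesis using proot_inj assms by metis
  qed
qed

lemma expand_sroot: "supp J x \<Longrightarrow> finite J \<Longrightarrow> x = (\<lambda>a. \<Sum>s\<in>J. x s * sroot s a)"
  by (auto simp: supp_def sroot_def fun_eq_iff if_distrib[of "(*) _"] cong: if_cong)

section \<open>The sum of the positive roots as a linear test for positivity\<close>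

definition rho2 :: "'a \<Rightarrow> real" where
  "rho2 = (\<lambda>a. \<Sum>b\<in>{b \<in> Phi. pos b}. b a)"

text \<open>The reflection \<open>s\<close> permutes the positive roots other than
  \<open>sroot s\<close> and negates that one, so \<open>rho2\<close> loses
  \<open>2 * sroot s\<close>; the value is read off the coordinate at \<open>s\<close>.\<close>

lemma bil_sroot_rho2: assumes s: "s \<in> S" shows "bil (sroot s) rho2 = 2"
proof -
  define P where "P = {b \<in> Phi. pos b}"
  have fin: "finite P" using finite_Phi by (simp add: P_def)
  have sP: "sroot s \<in> P" using s by (simp add: P_def)
  have inv2: "act s (act s b) = b" for b using s by (simp add: act_simple)
  have stays: "act s b \<in> P - {sroot s}" if "b \<in> P - {sroot s}" for b
  proof -
    have "act s b \<noteq> sroot s"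
    proof
      assume "act s b = sroot s"
      then have "b = (\<lambda>a. - sroot s a)" using inv2[of b] act_simple_self[OF s] by simp
      then show False using that pos_asym[OF sroot_Phi[OF s]] by (simp add: P_def)
    qed
    then show ?thesis using that act_simple_pos[of b s] s by (auto simp: P_def)
  qed
  have bij: "(\<Sum>b\<in>P - {sroot s}. act s b a) = (\<Sum>b\<in>P - {sroot s}. b a)" for a
    by (rule sum.reindex_bij_witness[of _ "act s" "act s"]) (use stays inv2 in auto)
  have "act s rho2 = (\<lambda>a. \<Sum>b\<in>P. 1 * act s b a)"
    using lin_sum[OF lin_act[of s], of "\<lambda>_. 1" "\<lambda>b. b" P] s by (simp add: rho2_def P_def)
  then have "act s rho2 s = (\<Sum>b\<in>P. act s b s)" by simp
  also have "\<dots> = (\<Sum>b\<in>P - {sroot s}. b s) - 1"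
    using sum.remove[OF fin sP, of "\<lambda>b. act s b s"] s bij[of s]
    by (simp add: act_simple_self) (simp add: sroot_def)
  also have "(\<Sum>b\<in>P - {sroot s}. b s) = rho2 s - 1"
    using sum.remove[OF fin sP, of "\<lambda>b. b s"] by (simp add: rho2_def P_def[symmetric]) (simp add: sroot_def)
  finally have "act s rho2 s = rho2 s - 2" by simp
  moreover have "act s rho2 s = rho2 s - bil (sroot s) rho2"
    using s by (simp add: act_simple vref_def) (simp add: sroot_def)
  ultimately show ?thesis by simp
qed

lemma bil_rho2_pos: assumes "b \<in> Phi" "pos b" shows "bil b rho2 > 0"
proof -
  have "bil b rho2 = (\<Sum>s\<in>S. b s * bil (sroot s) rho2)"
    using expand_sroot[OF Phi_supp[OF assms(1)] finite_S] bil_sum1[of b sroot S rho2] by simp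
  also have "\<dots> = (\<Sum>s\<in>S. b s * 2)" by (intro sum.cong HOL.refl) (simp add: bil_sroot_rho2)
  also have "\<dots> > 0"
    using Phi_nonzero[OF assms(1)] assms(2)
    by (metis (no_types, lifting) finite_S mult_pos_pos order_le_less pos_def sum_pos2 zero_le_mult_iff zero_less_numeral)
  finally show ?thesis .
qed

lemma pos_iff_bil_rho2: assumes "b \<in> Phi" shows "pos b \<longleftrightarrow> bil b rho2 > 0"
  using bil_rho2_pos[OF assms] bil_rho2_pos[OF Phi_uminus[OF assms]] Phi_cases[OF assms]
  by auto

text \<open>Positivity after applying \<open>u\<close> becomes a linear inequality against one
  vector that depends on \<open>u\<close> alone.\<close>

lemma pos_act_iff:
  assumes "b \<in> Phi" "u \<in> carrier G" shows "pos (act u b) \<longleftrightarrow> bil b (act (inv u) rho2) > 0"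
  using pos_iff_bil_rho2[of "act u b"] assms by (simp add: Phi_act bil_act_left)

subsection \<open>Products of vector reflections\<close>

definition R :: "('a \<Rightarrow> real) list \<Rightarrow> ('a \<Rightarrow> real) \<Rightarrow> ('a \<Rightarrow> real)" where
  "R bs = foldr vref bs"

definition gam :: "('a \<Rightarrow> real) list \<Rightarrow> nat \<Rightarrow> ('a \<Rightarrow> real)" where
  "gam bs i = R (take i bs) (bs ! i)"

lemma R_Nil [simp]: "R [] x = x" by (simp add: R_def)
lemma R_Cons [simp]: "R (b # bs) x = vref b (R bs x)" by (simp add: R_def)
lemma R_append: "R (xs @ ys) x = R xs (R ys x)" by (simp add: R_def)

lemma lin_R: "lin (R bs)"
  by (induction bs) (use lin_vref in \<open>auto simp: lin_def\<close>)

lemma R_rev_R: "\<forall>b\<in>set bs. bil b b = 2 \<Longrightarrow> R (rev bs) (R bs x) = x"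
  by (induction bs arbitrary: x) (simp_all add: R_append)

lemma bil_R: "\<forall>b\<in>set bs. bil b b = 2 \<Longrightarrow> bil (R bs x) (R bs y) = bil x y"
  by (induction bs) (simp_all add: vref_isometry)

lemma bil_R_adjoint:
  assumes "\<forall>b\<in>set bs. bil b b = 2" shows "bil (R bs x) y = bil x (R (rev bs) y)"
  using bil_R[of "rev bs" "R bs x" y] R_rev_R[OF assms, of x] assms by simp

lemma R_telescope:
  "\<forall>b\<in>set bs. bil b b = 2 \<Longrightarrow>
    x a - R (rev bs) x a = (\<Sum>i<length bs. bil (gam bs i) x * (bs ! i) a)"
proof (induction bs rule: rev_induct)
  case (snoc b bs)
  have "(\<Sum>i<length (bs @ [b]). bil (gam (bs @ [b]) i) x * ((bs @ [b]) ! i) a)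
      = (\<Sum>i<length bs. bil (gam bs i) x * (bs ! i) a) + bil (R bs b) x * b a"
    by (simp add: gam_def nth_append)
  also have "bil (R bs b) x = bil b (R (rev bs) x)" using snoc.prems by (intro bil_R_adjoint) simp
  finally show ?case using snoc by (simp add: vref_def)
qed simp

lemma R_take_expand:
  "j \<le> length bs \<Longrightarrow> R (take j bs) v a = v a - (\<Sum>k<j. bil (bs ! k) v * gam bs k a)"
proof (induction j arbitrary: a)
  case (Suc j)
  then have "R (take (Suc j) bs) v = R (take j bs) (\<lambda>a. v a - bil (bs ! j) v * (bs ! j) a)"
    by (simp add: take_Suc_conv_app_nth R_append vref_def)
  also have "\<dots> = (\<lambda>a. R (take j bs) v a - bil (bs ! j) v * gam bs j a)"
    using lin_diff[OF lin_R] by (simp add: gam_def)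
  finally show ?case using Suc by simp
qed simp

text \<open>A unitriangular change between the list and its \<open>gam\<close>; it transfers
  pairings with all \<open>gam bs k\<close> to pairings with the vectors of the list
  themselves.\<close>

lemma gam_expand:
  "i < length bs \<Longrightarrow> (bs ! i) a = gam bs i a + (\<Sum>k<i. bil (bs ! k) (bs ! i) * gam bs k a)"
  using R_take_expand[of i bs "bs ! i" a] by (simp add: gam_def)

lemma act_wp_T: "set ts \<subseteq> T \<Longrightarrow> act (wp ts) x = R (map proot ts) x"
proof (induction ts)
  case (Cons t ts)
  then have "set ts \<subseteq> carrier G" "t \<in> T" by auto
  then show ?case using Cons by (simp add: act_mult act_refl wp_closed)
qed simp

lemma wact_eq_R: "wact ws x = R (map sroot ws) x"
  by (induction ws) auto

lemma act_pow: "w \<in> carrier G \<Longrightarrow> act (w [^] (n::nat)) x = (act w ^^ n) x"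
  by (induction n arbitrary: x) (auto simp: act_mult simp flip: funpow_swap1)

lemma supp_lincomb: "(\<And>i. i \<in> I \<Longrightarrow> supp J (y i)) \<Longrightarrow> supp J (\<lambda>a. \<Sum>i\<in>I. k i * y i a)"
  by (simp add: supp_def)

end

section \<open>The bilinear form attached to a Coxeter element\<close>

text \<open>The word may use only part of \<open>S\<close>, since the construction of acute words
  descends to standard parabolic subgroups; their vectors are those supported on
  \<open>J\<close>.\<close>

locale cox_word = finite_coxeter G S for G (structure) and S +
  fixes cs :: "'a list"
  assumes distinct_cs: "distinct cs" and set_cs: "set cs \<subseteq> S"
begin

abbreviation J :: "'a set" where "J \<equiv> set cs"
abbreviation r :: nat where "r \<equiv> length cs"
definition c :: 'a where "c = wp cs"
definition q :: "('a \<Rightarrow> real) \<Rightarrow> ('a \<Rightarrow> real)" where "q = act (inv c)"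

text \<open>The roots of the inversion sequence of \<open>cs\<close>: the positive roots made negative by \<open>c\<inverse>\<close>.\<close>

definition PP :: "nat \<Rightarrow> 'a \<Rightarrow> real" where "PP i = wact (take i cs) (sroot (cs ! i))"
definition h :: nat where "h = ord (inv c)"

lemma c_carrier [simp, intro]: "c \<in> carrier G"
  using set_cs by (auto simp: c_def set_S_carrier)

lemma cs_S [simp, intro]: "i < r \<Longrightarrow> cs ! i \<in> S" using set_cs by auto

lemma act_c: "act c = wact cs" using act_wp[OF set_cs] by (simp add: c_def)

lemma q_wact: "q = wact (rev cs)"
proof -
  have "inv c = wp (rev cs)"
    unfolding c_def using set_cs simple_involution by (intro wp_rev_involutions[symmetric]) auto
  then show ?thesis using act_wp[of "rev cs"] set_cs by (simp add: q_def)
qed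

lemma q_R: "q x = R (rev (map sroot cs)) x"
  by (simp add: q_wact wact_eq_R rev_map)

lemma lin_q: "lin q" by (simp add: q_def lin_act)

lemma supp_q: "supp J x \<Longrightarrow> supp J (q x)" by (simp add: q_wact supp_wact)

lemma supp_q_pow: "supp J x \<Longrightarrow> supp J ((q ^^ n) x)" by (induction n) (auto intro: supp_q)

lemma bil_q: "bil (q x) (q y) = bil x y" by (simp add: q_def bil_act)

lemma act_c_q [simp]: "act c (q x) = x" "q (act c x) = x" by (simp_all add: q_def)

lemma PP_gam: "i < r \<Longrightarrow> PP i = gam (map sroot cs) i"
  by (simp add: PP_def gam_def wact_eq_R take_map)

lemma simple_norm: "\<forall>b\<in>set (map sroot cs). bil b b = 2" using set_cs by auto

lemma q_telescope: "x a - q x a = (\<Sum>i<r. bil (PP i) x * sroot (cs ! i) a)"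
  using R_telescope[OF simple_norm, of x a] by (simp add: q_R PP_gam)

text \<open>For the word \<open>cs\<close> the roots in the telescoping sum are distinct simple
  roots, so its coefficients are simply coordinates.\<close>

lemma q_coord: assumes "i < r" shows "x (cs ! i) - q x (cs ! i) = bil (PP i) x"
proof -
  have "(\<Sum>j<r. bil (PP j) x * sroot (cs ! j) (cs ! i)) = (\<Sum>j<r. if j = i then bil (PP j) x else 0)"
    using assms distinct_cs by (intro sum.cong HOL.refl) (auto simp: sroot_def nth_eq_iff_index_eq)
  then show ?thesis using assms by (simp add: q_telescope)
qed

lemma sum_cs: "(\<Sum>s\<in>J. f s) = (\<Sum>i<r. f (cs ! i))"
  using sum.reindex_bij_betw[OF bij_betw_nth[OF distinct_cs HOL.refl HOL.refl], of f]
  by (simp add: lessThan_def)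

lemma expand_cs: "supp J x \<Longrightarrow> x = (\<lambda>a. \<Sum>i<r. x (cs ! i) * sroot (cs ! i) a)"
  using expand_sroot[of J x] by (simp add: sum_cs)

text \<open>By \<open>q_coord\<close> a fixed vector is orthogonal to every \<open>PP i\<close>, and
  by \<open>gam_expand\<close> the simple roots of \<open>J\<close> are combinations of
  these.\<close>

lemma q_fixed_orth:
  assumes "q x = x" "s \<in> J" shows "bil (sroot s) x = 0"
proof -
  have P0: "bil (PP i) x = 0" if "i < r" for i using q_coord[OF that, of x] assms by simp
  from assms(2) obtain i where i: "i < r" "s = cs ! i" by (auto simp: in_set_conv_nth)
  have "sroot s = (\<lambda>a. PP i a + 1 * (\<Sum>k<i. bil (sroot (cs ! k)) (sroot s) * PP k a))"
    using gam_expand[of i "map sroot cs"] i by (simp add: fun_eq_iff PP_gam)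
  from arg_cong[where f = "\<lambda>v. bil v x", OF this] have "bil (sroot s) x
      = bil (PP i) x + 1 * bil (\<lambda>a. \<Sum>k<i. bil (sroot (cs ! k)) (sroot s) * PP k a) x"
    unfolding bil_add1 .
  also have "\<dots> = 0" using P0 i by (simp add: bil_sum1)
  finally show ?thesis .
qed

text \<open>
  Averaging over the stabiliser of \<open>x\<close> multiplies \<open>x\<close> by its order but kills every simple root of
  \<open>J\<close>, since \<open>s\<close> lies in the stabiliser and negates its root.
\<close>

lemma q_fixed_zero:
  assumes x: "supp J x" "q x = x" shows "x = (\<lambda>a. 0)"
proof -
  define H where "H = {w \<in> carrier G. act w x = x}"
  have fin: "finite H" using finite_carrier by (simp add: H_def)
  have "\<one> \<in> H" by (simp add: H_def)
  have HsH: "w \<otimes> s \<in> H" if "w \<in> H" "s \<in> J" for w s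
    using that q_fixed_orth[OF x(2) that(2)] set_cs by (auto simp: H_def act_mult act_simple vref_def)
  have avg: "(\<Sum>w\<in>H. act w (sroot s) a) = 0" if s: "s \<in> J" for s a
  proof -
    have sS: "s \<in> S" using s set_cs by auto
    have "(\<Sum>w\<in>H. act w (sroot s) a) = (\<Sum>w\<in>H. act (w \<otimes> s) (sroot s) a)"
      by (rule sum.reindex_bij_witness[of _ "\<lambda>w. w \<otimes> s" "\<lambda>w. w \<otimes> s"])
        (use HsH s sS in \<open>auto simp: H_def\<close>)
    also have "\<dots> = (\<Sum>w\<in>H. - act w (sroot s) a)"
      using sS by (intro sum.cong HOL.refl) (simp add: H_def act_mult act_simple_self lin_uminus lin_act)
    also have "\<dots> = - (\<Sum>w\<in>H. act w (sroot s) a)" by (simp add: sum_negf)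
    finally show ?thesis by simp
  qed
  have "x a = 0" for a
  proof -
    have "real (card H) * x a = (\<Sum>w\<in>H. act w x a)" by (simp add: H_def)
    also have "\<dots> = (\<Sum>w\<in>H. \<Sum>s\<in>J. x s * act w (sroot s) a)"
    proof (intro sum.cong HOL.refl)
      fix w assume "w \<in> H"
      then have "lin (act w)" by (simp add: H_def lin_act)
      from lin_sum[OF this, of x sroot J] expand_sroot[OF x(1)] show
        "act w x a = (\<Sum>s\<in>J. x s * act w (sroot s) a)" by simp
    qed
    also have "\<dots> = (\<Sum>s\<in>J. x s * (\<Sum>w\<in>H. act w (sroot s) a))"
      by (subst sum.swap) (simp add: sum_distrib_left)
    also have "\<dots> = 0" using avg by simp
    finally show ?thesis using fin \<open>\<one> \<in> H\<close> by auto
  qed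
  then show ?thesis by (simp add: fun_eq_iff)
qed

lemma h_pos: "h > 0" unfolding h_def by (intro ord_pos) simp

lemma q_pow_h: "(q ^^ h) x = x"
proof -
  have "(act (inv c) ^^ h) x = act (inv c [^] h) x" by (rule act_pow[symmetric]) simp
  also have "inv c [^] h = \<one>" unfolding h_def by (rule pow_ord_eq_1) simp
  finally show ?thesis by (simp add: q_def)
qed

text \<open>The sum over a full period is fixed by \<open>q\<close> and supported on
  \<open>J\<close>, so \<open>q_fixed_zero\<close> applies.\<close>

lemma orbit_sum_zero: assumes "supp J x" shows "(\<Sum>k<h. (q ^^ k) x a) = 0"
proof -
  define z where "z = (\<lambda>a. \<Sum>k<h. 1 * (q ^^ k) x a)"
  have "supp J z" unfolding z_def by (intro supp_lincomb supp_q_pow assms)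
  moreover have "q z = z"
  proof
    fix a
    have "q z a = (\<Sum>k<h. (q ^^ Suc k) x a)" unfolding z_def lin_sum[OF lin_q] by simp
    also have "\<dots> = (\<Sum>k<Suc h. (q ^^ k) x a) - x a" by (subst sum.lessThan_Suc_shift) simp
    also have "\<dots> = z a" by (simp add: z_def q_pow_h)
    finally show "q z a = z a" .
  qed
  ultimately have "z = (\<lambda>a. 0)" by (rule q_fixed_zero)
  then show ?thesis by (simp add: z_def fun_eq_iff)
qed

text \<open>
  The inverse of \<open>1 - q\<close> on vectors supported on \<open>J\<close>: as \<open>1 + q + \<cdots> + q\<^bsup>h-1\<^esup> = 0\<close> there, one has
  \<open>(1 - q) \<Sum>\<^sub>k k q\<^sup>k = - h\<close>.
\<close>

definition K :: "('a \<Rightarrow> real) \<Rightarrow> ('a \<Rightarrow> real)" where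
  "K x = (\<lambda>a. \<Sum>k<h. (- (real k / real h)) * (q ^^ k) x a)"

lemma lin_K: "lin K"
  unfolding lin_def
proof (intro allI)
  fix x y :: "'a \<Rightarrow> real" and k
  have "(q ^^ n) (\<lambda>a. x a + k * y a) = (\<lambda>a. (q ^^ n) x a + k * (q ^^ n) y a)" for n
    by (rule linD[OF lin_funpow[OF lin_q]])
  then show "K (\<lambda>a. x a + k * y a) = (\<lambda>a. K x a + k * K y a)"
    unfolding K_def by (simp only: distrib_left sum.distrib sum_distrib_left mult.left_commute mult.assoc)
qed

lemma q_K: "q (K x) = (\<lambda>a. \<Sum>k<h. (- (real k / real h)) * (q ^^ Suc k) x a)"
  unfolding K_def lin_sum[OF lin_q] by simp

lemma K_q: "K (q x) = q (K x)"
  unfolding q_K unfolding K_def by (simp only: funpow_Suc_right o_apply)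

lemma abel_sum:
  fixes f :: "nat \<Rightarrow> real"
  shows "(\<Sum>k<n. real k * f k) - (\<Sum>k<n. real k * f (Suc k))
    = (\<Sum>k<n. f k) - f 0 + f n - real n * f n"
  by (induction n) (simp_all add: algebra_simps)

lemma K_right: assumes "supp J x" shows "K x a - q (K x) a = x a"
proof -
  have 1: "K x a = - (1 / real h) * (\<Sum>k<h. real k * (q ^^ k) x a)"
    unfolding K_def by (simp add: sum_distrib_left)
  have 2: "q (K x) a = - (1 / real h) * (\<Sum>k<h. real k * (q ^^ Suc k) x a)"
    unfolding q_K by (simp add: sum_distrib_left)
  have "K x a - q (K x) a = - (1 / real h) * ((\<Sum>k<h. real k * (q ^^ k) x a) - (\<Sum>k<h. real k * (q ^^ Suc k) x a))"
    unfolding 1 2 by (simp only: right_diff_distrib)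
  also have "\<dots> = - (1 / real h) * (- real h * x a)"
    using abel_sum[of "\<lambda>k. (q ^^ k) x a" h] q_pow_h[of x] orbit_sum_zero[OF assms, of a]
    by (simp only:) simp
  also have "\<dots> = x a" using h_pos by simp
  finally show ?thesis .
qed

text \<open>\<open>K\<close> inverts \<open>1 - q\<close> on vectors supported on \<open>J\<close>.
  On simple roots this form is triangular with diagonal 1, and its symmetrisation is
  \<open>bil\<close>.\<close>

definition E :: "('a \<Rightarrow> real) \<Rightarrow> ('a \<Rightarrow> real) \<Rightarrow> real" where
  "E x y = bil x (K y)"

lemma E_add1: "E (\<lambda>a. x a + k * y a) z = E x z + k * E y z" by (simp add: E_def bil_add1)
lemma E_sum1: "E (\<lambda>a. \<Sum>i\<in>I. k i * y i a) z = (\<Sum>i\<in>I. k i * E (y i) z)" by (simp add: E_def bil_sum1)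
lemma E_sum2: "E z (\<lambda>a. \<Sum>i\<in>I. k i * y i a) = (\<Sum>i\<in>I. k i * E z (y i))"
  by (simp add: E_def lin_sum[OF lin_K] bil_sum2)
lemma E_uminus1 [simp]: "E (\<lambda>a. - x a) z = - E x z" by (simp add: E_def)
lemma E_uminus2 [simp]: "E z (\<lambda>a. - x a) = - E z x" by (simp add: E_def lin_uminus[OF lin_K])

lemma E_q: "E (q x) (q y) = E x y" by (simp add: E_def K_q bil_q)

lemma E_c: "E (act c x) (act c y) = E x y" using E_q[of "act c x" "act c y"] by simp

lemma E_c_pow: "E ((act c ^^ n) x) ((act c ^^ n) y) = E x y"
  by (induction n) (simp_all add: E_c)

text \<open>Here \<open>x\<close> need not be supported on \<open>J\<close>, as happens for images
  of \<open>rho2\<close> in the parabolic case. The error \<open>K (x - q x) - x\<close> is fixed by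
  \<open>q\<close>, hence orthogonal to the simple roots of \<open>J\<close> and invisible to
  \<open>z\<close>.\<close>

lemma E_telescope:
  assumes "supp J z" shows "E z (\<lambda>a. x a - q x a) = bil z x"
proof -
  define w where "w = (\<lambda>a. x a - q x a)"
  have sw: "supp J w" unfolding w_def q_telescope by (intro supp_lincomb) auto
  define d where "d = (\<lambda>a. K w a - 1 * x a)"
  have "q d = (\<lambda>a. q (K w) a - 1 * q x a)" unfolding d_def by (rule lin_diff[OF lin_q])
  then have "q d a = d a" for a using K_right[OF sw, of a] by (simp add: d_def w_def algebra_simps)
  then have "q d = d" by (simp add: fun_eq_iff)
  then have "bil (sroot s) d = 0" if "s \<in> J" for s using q_fixed_orth that by blast
  then have "bil z d = 0"
    using expand_sroot[OF assms] bil_sum1[of z sroot J d] by simp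
  then have "bil z (K w) = bil z x" unfolding d_def bil_diff2 by simp
  then show ?thesis by (simp add: E_def w_def)
qed

lemma K_right_fun: "supp J x \<Longrightarrow> x = (\<lambda>a. K x a - q (K x) a)"
  using K_right by (simp add: fun_eq_iff)

lemma E_left: assumes "supp J x" shows "E x y = bil (K x) (K y) - bil (q (K x)) (K y)"
proof -
  have "E x y = bil (\<lambda>a. K x a - q (K x) a) (K y)" unfolding E_def using K_right_fun[OF assms] by simp
  then show ?thesis by (simp add: bil_minus1)
qed

text \<open>Both arguments are written as \<open>(1 - q) K\<close> of themselves; in the expanded
  product \<open>q\<close> is an isometry, and the four remaining terms pair up.\<close>

lemma E_sym: assumes "supp J x" "supp J y" shows "E x y + E y x = bil x y"
proof -
  have "bil x y = bil (\<lambda>a. K x a - q (K x) a) (\<lambda>a. K y a - q (K y) a)"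
    using K_right_fun[OF assms(1)] K_right_fun[OF assms(2)] by simp
  also have "\<dots> = bil (K x) (K y) - bil (K x) (q (K y)) - bil (q (K x)) (K y) + bil (K x) (K y)"
    by (simp add: bil_minus1 bil_minus2 bil_q)
  finally show ?thesis using E_left[OF assms(1), of y] E_left[OF assms(2), of x]
    by (simp add: bil_sym[of "K y" "K x"] bil_sym[of "q (K y)" "K x"])
qed

text \<open>The analogue of Serre duality: in terms of \<open>K x\<close> and \<open>K y\<close>,
  both sides consist of the same two pairings, up to the isometry \<open>q\<close>.\<close>

lemma E_serre: assumes "supp J x" "supp J y" shows "E x y = - E y (q x)"
proof -
  have "E y (q x) = bil (K y) (q (K x)) - bil (q (K y)) (q (K x))"
    using E_left[OF assms(2), of "q x"] by (simp add: K_q)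
  also have "\<dots> = bil (q (K x)) (K y) - bil (K x) (K y)"
    by (simp add: bil_q bil_sym[of "K y"])
  finally show ?thesis using E_left[OF assms(1), of y] by simp
qed

text \<open>As with projective modules, pairing with \<open>PP i\<close> on the left extracts a
  coordinate: this is \<open>q_coord\<close> at \<open>K v\<close>.\<close>

lemma E_PP: assumes "supp J v" "i < r" shows "E (PP i) v = v (cs ! i)"
proof -
  have "v (cs ! i) = K v (cs ! i) - q (K v) (cs ! i)" using K_right[OF assms(1)] by simp
  also have "\<dots> = bil (PP i) (K v)" by (rule q_coord[OF assms(2)])
  finally show ?thesis by (simp add: E_def)
qed

section \<open>Factorizations of c into reflections and their dual bases\<close>

definition factors :: "('a \<Rightarrow> real) list \<Rightarrow> bool" where
  "factors bs \<longleftrightarrow> (\<forall>b\<in>set bs. bil b b = 2 \<and> supp J b) \<and> (\<forall>x. R (rev bs) x = q x)"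

text \<open>The telescoping identity at \<open>K v\<close>, where the difference
  \<open>K v - q (K v)\<close> is \<open>v\<close> itself.\<close>

lemma factors_expand:
  assumes "factors bs" "supp J v"
  shows "v a = (\<Sum>i<length bs. E (gam bs i) v * (bs ! i) a)"
proof -
  have "v a = K v a - R (rev bs) (K v) a" using K_right[OF assms(2)] assms(1) by (simp add: factors_def)
  also have "\<dots> = (\<Sum>i<length bs. bil (gam bs i) (K v) * (bs ! i) a)"
    using assms(1) by (intro R_telescope) (simp add: factors_def)
  finally show ?thesis by (simp add: E_def)
qed

text \<open>Padding with zeros makes the coefficient matrices square of size \<open>r\<close>. A
  list with fewer than \<open>r\<close> entries then has a zero row in an invertible matrix, which
  bounds the reflection length of c from below.\<close>

lemma factors_matrix:
  assumes "factors bs" "length bs \<le> r" "k < r" "l < r"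
  shows "(\<Sum>i<r. (if i < length bs then E (gam bs i) (sroot (cs ! k)) else 0)
      * (if i < length bs then (bs ! i) (cs ! l) else 0)) = (if k = l then 1 else 0)"
proof -
  have "(\<Sum>i<r. (if i < length bs then E (gam bs i) (sroot (cs ! k)) else 0)
      * (if i < length bs then (bs ! i) (cs ! l) else 0))
    = (\<Sum>i<length bs. E (gam bs i) (sroot (cs ! k)) * (bs ! i) (cs ! l))"
    using assms(2) by (intro sum.mono_neutral_cong_right) auto
  also have "\<dots> = sroot (cs ! k) (cs ! l)"
    using factors_expand[OF assms(1), of "sroot (cs ! k)" "cs ! l"] assms(3) by simp
  also have "\<dots> = (if k = l then 1 else 0)"
    using assms(3,4) distinct_cs by (auto simp: sroot_def nth_eq_iff_index_eq)
  finally show ?thesis .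
qed

lemma factors_length: assumes "factors bs" shows "r \<le> length bs"
proof (rule ccontr)
  assume "\<not> r \<le> length bs"
  then have n: "length bs < r" by simp
  have "(\<Sum>k<r. (if length bs < length bs then E (gam bs (length bs)) (sroot (cs ! k)) else 0)
      * (if length bs < length bs then (bs ! length bs) (cs ! k) else 0))
      = (if length bs = length bs then 1 else 0)"
    by (rule square_family_dual[OF factors_matrix[OF assms]]) (use n in auto)
  then show False by simp
qed

lemma factors_dual:
  assumes "factors bs" "length bs = r" "i < r" "j < r"
  shows "E (gam bs i) (bs ! j) = (if i = j then 1 else 0)"
proof -
  have "(\<Sum>k<r. (if i < length bs then E (gam bs i) (sroot (cs ! k)) else 0)
      * (if j < length bs then (bs ! j) (cs ! k) else 0)) = (if i = j then 1 else 0)"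
    by (rule square_family_dual[OF factors_matrix[OF assms(1)]]) (use assms in auto)
  then have *: "(\<Sum>k<r. (bs ! j) (cs ! k) * E (gam bs i) (sroot (cs ! k))) = (if i = j then 1 else 0)"
    using assms by (simp add: mult.commute)
  have "supp J (bs ! j)" using assms by (auto simp: factors_def)
  from expand_cs[OF this] E_sum2[of "gam bs i" "\<lambda>k. (bs ! j) (cs ! k)" "\<lambda>k. sroot (cs ! k)" "{..<r}"] *
  show ?thesis by simp
qed

text \<open>The vanishing in an exceptional sequence: the vector at \<open>i\<close> is
  \<open>gam bs i\<close> plus a combination of earlier \<open>gam bs k\<close>, and these are dual
  to the list under \<open>E\<close>.\<close>

lemma factors_E:
  assumes "factors bs" "length bs = r" "i \<le> j" "j < r"
  shows "E (bs ! i) (bs ! j) = (if i = j then 1 else 0)"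
proof -
  have "bs ! i = (\<lambda>a. gam bs i a + 1 * (\<Sum>k<i. bil (bs ! k) (bs ! i) * gam bs k a))"
    using gam_expand[of i bs] assms by (simp add: fun_eq_iff)
  from arg_cong[where f = "\<lambda>v. E v (bs ! j)", OF this] have "E (bs ! i) (bs ! j) = E (gam bs i) (bs ! j)
      + 1 * E (\<lambda>a. \<Sum>k<i. bil (bs ! k) (bs ! i) * gam bs k a) (bs ! j)"
    unfolding E_add1 .
  also have "\<dots> = E (gam bs i) (bs ! j)"
    using factors_dual[OF assms(1,2)] assms(3,4) by (simp add: E_sum1)
  finally show ?thesis using factors_dual[OF assms(1,2)] assms(3,4) by simp
qed

lemma factors_T_word:
  assumes "set ts \<subseteq> T" "wp ts = c" "\<And>t. t \<in> set ts \<Longrightarrow> supp J (proot t)"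
  shows "factors (map proot ts)"
proof -
  have "R (rev (map proot ts)) x = q x" for x
  proof -
    have "wp (rev ts) = inv (wp ts)"
      using assms(1) by (intro wp_rev_involutions) auto
    then have "act (inv c) x = R (map proot (rev ts)) x"
      using act_wp_T[of "rev ts" x] assms by simp
    then show ?thesis by (simp add: q_def rev_map)
  qed
  then show ?thesis using assms by (auto simp: factors_def)
qed

lemma q_telescope_T_word:
  assumes "set ts \<subseteq> T" "wp ts = c"
  shows "x a - q x a = (\<Sum>i<length ts. bil (gam (map proot ts) i) x * proot (ts ! i) a)"
proof -
  have "wp (rev ts) = inv (wp ts)"
    using assms(1) by (intro wp_rev_involutions) auto
  then have "q x = R (rev (map proot ts)) x"
    using act_wp_T[of "rev ts" x] assms by (simp add: q_def rev_map)
  moreover have "\<forall>b\<in>set (map proot ts). bil b b = 2" using assms by auto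
  ultimately show ?thesis using R_telescope[of "map proot ts" x a] by simp
qed

end

section \<open>The reflection order of the sorting word\<close>

context finite_coxeter
begin

lemma wact_outside: "a \<notin> set ws \<Longrightarrow> wact ws x a = x a"
  by (induction ws) (auto simp: vref_sroot_other)

lemma wact_rev: "set ws \<subseteq> S \<Longrightarrow> wact (rev ws) (wact ws x) = x"
  by (induction ws arbitrary: x) (auto simp: wact_append)

lemma wact_Phi: "set ws \<subseteq> S \<Longrightarrow> b \<in> Phi \<Longrightarrow> wact ws b \<in> Phi"
  by (metis Phi_act act_wp set_S_carrier wp_closed)

lemma bil_wact: "set ws \<subseteq> S \<Longrightarrow> bil (wact ws x) (wact ws y) = bil x y"
  by (induction ws) (auto simp: vref_isometry)

lemma wact_uminus: "wact ws (\<lambda>a. - x a) = (\<lambda>a. - wact ws x a)"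
  using lin_uminus[OF lin_R, of "map sroot ws"] by (simp add: wact_eq_R)

lemma neg_under_rev_word:
  assumes "b \<in> Phi" "pos b"
  shows "set ws \<subseteq> S \<Longrightarrow> \<not> pos (wact (rev ws) b) \<Longrightarrow>
    \<exists>i<length ws. b = wact (take i ws) (sroot (ws ! i))"
proof (induction ws rule: rev_induct)
  case Nil
  then show ?case using assms by simp
next
  case (snoc s ws)
  have s: "s \<in> S" "set ws \<subseteq> S" using snoc.prems by auto
  show ?case
  proof (cases "pos (wact (rev ws) b)")
    case False
    from snoc.IH[OF s(2) False] obtain i where "i < length ws" "b = wact (take i ws) (sroot (ws ! i))"
      by blast
    then show ?thesis by (intro exI[of _ i]) (auto simp: nth_append)
  next
    case True
    have "wact (rev ws) b \<in> Phi" using s assms by (intro wact_Phi) auto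
    with act_simple_pos[OF this True s(1)] snoc.prems(2) s have "wact (rev ws) b = sroot s"
      by (auto simp: act_simple)
    then have "b = wact ws (sroot s)" using wact_rev[of "rev ws" b] s by simp
    then show ?thesis by (intro exI[of _ "length ws"]) simp
  qed
qed

lemma neg_if_all_simple_neg:
  assumes "w \<in> carrier G" "\<And>s. s \<in> S \<Longrightarrow> \<not> pos (act w (sroot s))" "b \<in> Phi" "pos b"
  shows "\<not> pos (act w b)"
proof -
  have "act w b = (\<lambda>a. \<Sum>s\<in>S. b s * act w (sroot s) a)"
    using lin_sum[OF lin_act[OF assms(1)], of b sroot S] expand_sroot[OF Phi_supp[OF assms(3)]] by simp
  moreover have "act w (sroot s) a \<le> 0" if "s \<in> S" for s a
    using assms(1,2) that Phi_cases[of "act w (sroot s)"] by (force simp: pos_def)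
  ultimately have "act w b a \<le> 0" for a
    using assms(4) by (auto simp: pos_def intro!: sum_nonpos mult_nonneg_nonpos)
  then have "pos (\<lambda>a. - act w b a)" by (simp add: pos_def)
  moreover have "act w b \<in> Phi" using assms by auto
  ultimately show ?thesis using pos_asym by blast
qed

text \<open>An element that makes the simple roots negative does so with all positive roots, and so
  does its inverse. Hence \<open>inv v \<otimes> w\<close> keeps simple roots positive and is
  trivial.\<close>

lemma all_simple_neg_unique:
  assumes "w \<in> carrier G" "\<And>s. s \<in> S \<Longrightarrow> \<not> pos (act w (sroot s))"
    and "v \<in> carrier G" "\<And>s. s \<in> S \<Longrightarrow> \<not> pos (act v (sroot s))"
  shows "w = v"
proof -
  have "inv v \<otimes> w = \<one>"
  proof (rule act_pos_imp_one)
    fix s assume s: "s \<in> S"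
    define d where "d = (\<lambda>a. - act w (sroot s) a)"
    have wP: "act w (sroot s) \<in> Phi" using s assms by auto
    have d: "d \<in> Phi" "pos d" unfolding d_def using Phi_cases[OF wP] assms(2)[OF s] wP by auto
    have vd: "act (inv v) d \<in> Phi" using d assms by auto
    have "\<not> pos (act (inv v) d)"
    proof
      assume "pos (act (inv v) d)"
      from neg_if_all_simple_neg[OF assms(3,4) vd this] d(2) assms(3) show False by simp
    qed
    then have "pos (\<lambda>a. - act (inv v) d a)" using Phi_cases[OF vd] by auto
    also have "(\<lambda>a. - act (inv v) d a) = act (inv v \<otimes> w) (sroot s)"
      using assms(1,3) by (simp add: d_def act_mult lin_uminus lin_act)
    finally show "pos (act (inv v \<otimes> w) (sroot s))" .
  qed (use assms in auto)
  then show ?thesis using assms by (metis inv_closed inv_equality inv_inv)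
qed

text \<open>Maximal length means no ascents, that is, every simple root becomes negative; at most
  one element has that property, which resolves the definite description.\<close>

lemma longest_element_eq:
  assumes v: "v \<in> carrier G" "\<And>s. s \<in> S \<Longrightarrow> \<not> pos (act v (sroot s))"
  shows "longest_element G S = v"
proof -
  have neg: "\<not> pos (act w (sroot s))" if "w \<in> carrier G" "\<forall>x\<in>carrier G. len G S x \<le> len G S w" "s \<in> S" for w s
    using that tits_iff[OF that(1,3)] by (meson S_carrier leD m_closed)
  have "carrier G \<noteq> {}" using one_closed by blast
  then have "Max (len G S ` carrier G) \<in> len G S ` carrier G"
    using finite_carrier by (intro Max_in) auto
  then obtain w where w: "w \<in> carrier G" "Max (len G S ` carrier G) = len G S w" by blast
  then have w: "w \<in> carrier G" "\<forall>x\<in>carrier G. len G S x \<le> len G S w"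
    using finite_carrier Max_ge[of "len G S ` carrier G"] by auto
  then have "w = v" using neg v by (intro all_simple_neg_unique) auto
  show ?thesis unfolding longest_element_def
  proof (rule the_equality)
    show "v \<in> carrier G \<and> (\<forall>x\<in>carrier G. len G S x \<le> len G S v)" using w \<open>w = v\<close> by simp
  next
    fix x assume "x \<in> carrier G \<and> (\<forall>y\<in>carrier G. len G S y \<le> len G S x)"
    then show "x = v" using neg v by (intro all_simple_neg_unique) auto
  qed
qed

lemma inv_seq_nth:
  "i < length ws \<Longrightarrow> inv_seq G ws ! i = wp (take i ws @ [ws ! i] @ rev (take i ws))"
  by (simp add: inv_seq_def)

lemma length_inv_seq [simp]: "length (inv_seq G ws) = length ws"
  by (simp add: inv_seq_def)

lemma inv_seq_nth_conj:
  assumes "set ws \<subseteq> S" "i < length ws"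
  shows "inv_seq G ws ! i = wp (take i ws) \<otimes> ws ! i \<otimes> inv (wp (take i ws))"
proof -
  have c: "set (take i ws) \<subseteq> S" using assms(1) set_take_subset by fastforce
  have "wp (rev (take i ws)) = inv (wp (take i ws))"
    using c simple_involution by (intro wp_rev_involutions) auto
  moreover have "ws ! i \<in> S" using assms by auto
  ultimately show ?thesis using c set_S_carrier[OF c]
    by (simp add: inv_seq_nth[OF assms(2)] wp_append m_assoc wp_closed)
qed

lemma inv_seq_T: "set ws \<subseteq> S \<Longrightarrow> set (inv_seq G ws) \<subseteq> T"
proof
  fix t assume ws: "set ws \<subseteq> S" and "t \<in> set (inv_seq G ws)"
  then obtain i where i: "i < length ws" "t = inv_seq G ws ! i" by (auto simp: in_set_conv_nth)
  have "set (take i ws) \<subseteq> carrier G" using ws set_take_subset[of i ws] by blast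
  moreover have "ws ! i \<in> T" using nth_mem[OF i(1)] ws by blast
  ultimately show "t \<in> T" unfolding i(2) inv_seq_nth_conj[OF ws i(1)] by (intro T_conj wp_closed)
qed

lemma proot_inv_seq:
  assumes "set ws \<subseteq> S" "i < length ws" "pos (wact (take i ws) (sroot (ws ! i)))"
  shows "proot (inv_seq G ws ! i) = wact (take i ws) (sroot (ws ! i))"
proof -
  have c: "set (take i ws) \<subseteq> S" using assms(1) set_take_subset by fastforce
  have "ws ! i \<in> S" using assms by auto
  then show ?thesis
    using proot_conj[of "ws ! i" "wp (take i ws)"] assms c inv_seq_nth_conj[OF assms(1,2)]
    by (auto simp: act_wp[OF c] set_S_carrier)
qed

end

locale cox_elt = cox_word +
  assumes full: "set cs = S"
begin

lemma take_S: "set (take i cs) \<subseteq> S" using set_cs set_take_subset by fastforce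

lemma PP_Phi [simp, intro]: "i < r \<Longrightarrow> PP i \<in> Phi"
  unfolding PP_def by (intro wact_Phi take_S) auto

lemma PP_coord: assumes "i \<le> n" "n < r" shows "PP i (cs ! n) = (if i = n then 1 else 0)"
proof -
  have "cs ! n \<notin> set (take i cs)"
    using assms distinct_cs by (auto simp: in_set_conv_nth nth_eq_iff_index_eq)
  then have "PP i (cs ! n) = sroot (cs ! i) (cs ! n)" by (simp add: PP_def wact_outside)
  then show ?thesis using assms distinct_cs by (auto simp: sroot_def nth_eq_iff_index_eq)
qed

lemma PP_pos [simp, intro]: "i < r \<Longrightarrow> pos (PP i)"
  using pos_coeff[of "PP i" "cs ! i"] PP_coord[of i i] by simp

text \<open>After the prefix cancels, the \<open>i\<close>-th reflection turns the coordinate at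
  \<open>cs ! i\<close> into -1, and no later letter touches it because letters do not
  repeat.\<close>

lemma q_PP_neg: assumes "i < r" shows "\<not> pos (q (PP i))"
proof -
  have "cs = take i cs @ [cs ! i] @ drop (Suc i) cs" using assms by (simp add: id_take_nth_drop[symmetric])
  then have "rev cs = rev (drop (Suc i) cs) @ [cs ! i] @ rev (take i cs)"
    by (metis append_assoc rev_append rev_singleton_conv)
  then have "q (PP i) = wact (rev (drop (Suc i) cs)) (vref (sroot (cs ! i)) (sroot (cs ! i)))"
    using wact_rev[OF take_S] by (simp add: q_wact PP_def wact_append)
  moreover have "cs ! i \<notin> set (rev (drop (Suc i) cs))"
    using assms distinct_cs by (auto simp: in_set_conv_nth nth_eq_iff_index_eq)
  ultimately have "q (PP i) (cs ! i) = - 1"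
    using assms by (simp add: wact_outside vref_self) (simp add: sroot_def)
  then show ?thesis by (auto simp: pos_def intro!: exI[of _ "cs ! i"])
qed

lemma q_neg_PP: "b \<in> Phi \<Longrightarrow> pos b \<Longrightarrow> \<not> pos (q b) \<Longrightarrow> \<exists>i<r. b = PP i"
  using neg_under_rev_word[of b cs] set_cs by (auto simp: q_wact PP_def)

lemma q_Phi: "b \<in> Phi \<Longrightarrow> q b \<in> Phi" by (auto simp: q_def)
lemma q_pow_Phi: "b \<in> Phi \<Longrightarrow> (q ^^ n) b \<in> Phi" by (induction n) (auto intro: q_Phi)

text \<open>The orbit sums to zero, which is impossible for positive roots only.\<close>

lemma q_orbit_neg: assumes "b \<in> Phi" shows "\<exists>j. \<not> pos ((q ^^ j) b)"
proof (rule ccontr)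
  assume "\<not> ?thesis"
  then have p: "(q ^^ j) b a \<ge> 0" for j a by (simp add: pos_def)
  have "supp J b" using Phi_supp[OF assms] full by simp
  then have "(\<Sum>k<h. (q ^^ k) b a) = 0" for a by (rule orbit_sum_zero)
  then have "(q ^^ 0) b a = 0" for a
    using p h_pos sum_nonneg_eq_0_iff[of "{..<h}" "\<lambda>k. (q ^^ k) b a"] by blast
  then show False using Phi_nonzero[OF assms] by simp
qed

text \<open>
  \<open>rr a i\<close> is the root inserted at position \<open>a r + i\<close> of \<open>cs cs cs \<dots>\<close> when no letter is skipped. The
  greedy reading of the sorting word uses exactly the live positions, those before the first negative
  root in the \<open>c\<close>-orbit of \<open>PP i\<close>; dead roots are orthogonal to all later live ones, so skipping
  them does not affect the later roots.
\<close>

definition rr :: "nat \<Rightarrow> nat \<Rightarrow> 'a \<Rightarrow> real" where "rr a i = (act c ^^ a) (PP i)"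

definition lv :: "nat \<Rightarrow> nat \<Rightarrow> bool" where "lv b n \<longleftrightarrow> (\<forall>b'\<le>b. pos (rr b' n))"

lemma rr_Suc: "rr (Suc a) i = act c (rr a i)" by (simp add: rr_def)
lemma rr_0 [simp]: "rr 0 i = PP i" by (simp add: rr_def)
lemma q_rr: "q (rr (Suc a) i) = rr a i" by (simp add: rr_Suc)
lemma rr_Phi [simp, intro]: "i < r \<Longrightarrow> rr a i \<in> Phi" by (induction a) (auto simp: rr_Suc)
lemma rr_supp: "i < r \<Longrightarrow> supp J (rr a i)" using Phi_supp full by auto
lemma lv_pos: "lv b n \<Longrightarrow> b' \<le> b \<Longrightarrow> pos (rr b' n)" by (simp add: lv_def)

lemma E_rr_shift: assumes "a \<le> b" shows "E (rr a i) (rr b n) = E (PP i) (rr (b - a) n)"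
proof -
  have "rr b n = (act c ^^ a) (rr (b - a) n)" using assms unfolding rr_def
    by (metis comp_apply funpow_add le_add_diff_inverse)
  then show ?thesis by (simp add: rr_def E_c_pow)
qed

lemma E_rr_coord: "a \<le> b \<Longrightarrow> i < r \<Longrightarrow> n < r \<Longrightarrow> E (rr a i) (rr b n) = rr (b - a) n (cs ! i)"
  by (simp add: E_rr_shift E_PP rr_supp)

text \<open>By c-invariance and \<open>E_PP\<close> the value is a coordinate of
  \<open>rr (b - a) n\<close>, a positive root because \<open>n\<close> is still live at
  \<open>b\<close>. Liveness of the first argument plays no part, which is what
  \<open>dead_E\<close> exploits.\<close>

lemma E_rr_nonneg: "a \<le> b \<Longrightarrow> lv b n \<Longrightarrow> i < r \<Longrightarrow> n < r \<Longrightarrow> E (rr a i) (rr b n) \<ge> 0"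
  using lv_pos[of b n "b - a"] by (simp add: E_rr_coord pos_def)

lemma E_rr_same: "i < n \<Longrightarrow> n < r \<Longrightarrow> E (rr a n) (rr a i) = 0"
  by (simp add: E_rr_coord PP_coord)

text \<open>Duality exchanges the arguments at the cost of a sign and one step back in the orbit,
  which reduces the claim to \<open>E_rr_nonneg\<close>.\<close>

lemma E_rr_nonpos:
  assumes "lv b n" "i < r" "n < r" "a < b \<or> a = b \<and> i < n" shows "E (rr b n) (rr a i) \<le> 0"
  using assms(4)
proof
  assume "a < b"
  then obtain d where d: "b = Suc d" "a \<le> d" by (cases b) auto
  have "E (rr b n) (rr a i) = - E (rr a i) (rr d n)"
    using E_serre[OF rr_supp rr_supp, of n i b a] assms d by (simp add: q_rr)
  moreover have "lv d n" using assms(1) d by (simp add: lv_def)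
  ultimately show ?thesis using E_rr_nonneg[OF d(2) _ assms(2,3)] by simp
qed (use assms E_rr_same in auto)

text \<open>The first negative root of the orbit is sent to a positive one by \<open>c\<inverse>\<close>, so it is some \<open>- PP i\<close>.\<close>

lemma dead_neg:
  assumes "\<not> lv a i" "i < r" shows "\<exists>d\<le>a. \<exists>i'<r. rr a i = (\<lambda>x. - rr d i' x)"
proof -
  define m where "m = (LEAST m. \<not> pos (rr m i))"
  from assms(1) obtain m' where m': "m' \<le> a" "\<not> pos (rr m' i)" by (auto simp: lv_def)
  have m: "\<not> pos (rr m i)" "m \<le> a"
    using LeastI[of "\<lambda>m. \<not> pos (rr m i)", OF m'(2)] Least_le[of "\<lambda>m. \<not> pos (rr m i)", OF m'(2)] m'(1)
    by (simp_all add: m_def)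
  have less: "pos (rr k i)" if "k < m" for k using that not_less_Least unfolding m_def by blast
  have "m \<noteq> 0" using m assms(2) by (metis rr_0 PP_pos)
  then obtain k where k: "m = Suc k" by (cases m) auto
  define d where "d = (\<lambda>x. - rr m i x)"
  have d: "d \<in> Phi" "pos d"
    unfolding d_def using m Phi_cases[of "rr m i"] assms(2) by auto
  have "q d = (\<lambda>x. - rr k i x)" unfolding d_def using lin_uminus[OF lin_q] by (simp add: k q_rr)
  then have "\<not> pos (q d)" using pos_asym[of "rr k i"] less[of k] k assms(2) by simp
  from q_neg_PP[OF d this] obtain i' where i': "i' < r" "d = PP i'" by blast
  then have rm: "rr m i = (\<lambda>x. - PP i' x)" unfolding d_def by (metis minus_equation_iff)
  have "rr (m + n) i = (\<lambda>x. - rr n i' x)" for n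
  proof (induction n)
    case (Suc n)
    then show ?case by (simp add: rr_Suc lin_uminus[OF lin_act])
  qed (simp add: rm)
  from this[of "a - m"] m(2) show ?thesis using i'(1) by (intro exI[of _ "a - m"] conjI exI[of _ i']) auto
qed

text \<open>A dead root is the negative of a root \<open>rr d i'\<close> with
  \<open>d \<le> a\<close>, so \<open>E_rr_nonneg\<close> applies to the root and to its
  negative.\<close>

lemma dead_E:
  assumes "\<not> lv a i" "lv b n" "a \<le> b" "i < r" "n < r" shows "E (rr a i) (rr b n) = 0"
proof -
  from dead_neg[OF assms(1,4)] obtain d i' where d: "d \<le> a" "i' < r" "rr a i = (\<lambda>x. - rr d i' x)" by blast
  have "E (rr a i) (rr b n) = - E (rr d i') (rr b n)" by (simp add: d(3))
  moreover have "E (rr d i') (rr b n) \<ge> 0" using E_rr_nonneg[of d b n i'] d assms by simp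
  moreover have "E (rr a i) (rr b n) \<ge> 0" using E_rr_nonneg assms by simp
  ultimately show ?thesis by simp
qed

lemma dead_bil:
  assumes "\<not> lv a i" "lv b n" "i < r" "n < r" "a < b \<or> a = b \<and> i < n"
  shows "bil (rr a i) (rr b n) = 0"
proof -
  have "E (rr b n) (rr a i) = 0" using assms(5)
  proof
    assume "a < b"
    then obtain d where d: "b = Suc d" "a \<le> d" by (cases b) auto
    have "E (rr b n) (rr a i) = - E (rr a i) (rr d n)"
      using E_serre[OF rr_supp rr_supp, of n i b a] assms d by (simp add: q_rr)
    moreover have "lv d n" using assms(2) d by (simp add: lv_def)
    ultimately show ?thesis using dead_E[OF assms(1) _ d(2) assms(3,4)] by simp
  qed (use assms E_rr_same in auto)
  moreover have "E (rr a i) (rr b n) = 0" using dead_E assms by auto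
  ultimately show ?thesis using E_sym[OF rr_supp rr_supp, of i n a b] assms by simp
qed

section \<open>Positions of the periodic word: prefixes with and without the dead letters\<close>

abbreviation pl :: "nat \<Rightarrow> 'a" where "pl \<equiv> periodic_letter cs"
definition rho :: "nat \<Rightarrow> 'a \<Rightarrow> real" where "rho k = rr (k div r) (k mod r)"
text \<open>In rank 0 there are no letters, and the conjunct \<open>r > 0\<close> declares every
  position dead.\<close>

definition live :: "nat \<Rightarrow> bool" where "live k \<longleftrightarrow> r > 0 \<and> lv (k div r) (k mod r)"

lemma pl_S: "r > 0 \<Longrightarrow> pl k \<in> S" by (simp add: periodic_letter_def)

lemma pos_less_cases: "r > 0 \<Longrightarrow> k < l \<Longrightarrow> k div r < l div r \<or> k div r = l div r \<and> k mod r < l mod r"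
  by (metis div_le_mono div_mult_mod_eq le_less less_imp_le nat_add_left_cancel_less)

lemma live_r: "live k \<Longrightarrow> r > 0" by (simp add: live_def)

lemma rho_Phi: "r > 0 \<Longrightarrow> rho k \<in> Phi" by (simp add: rho_def)
lemma rho_pos: "live k \<Longrightarrow> pos (rho k)" by (simp add: rho_def live_def lv_def)

lemma dead_bil_rho: "\<not> live p \<Longrightarrow> live k \<Longrightarrow> p < k \<Longrightarrow> bil (rho p) (rho k) = 0"
  using pos_less_cases[of p k] unfolding rho_def live_def by (intro dead_bil) auto

lemma E_rho_nonneg: "live l \<Longrightarrow> k < l \<Longrightarrow> E (rho k) (rho l) \<ge> 0"
  using pos_less_cases[of k l] unfolding rho_def live_def by (intro E_rr_nonneg) auto

lemma E_rho_nonpos: "live l \<Longrightarrow> k < l \<Longrightarrow> E (rho l) (rho k) \<le> 0"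
  using pos_less_cases[of k l] unfolding rho_def live_def by (intro E_rr_nonpos) auto

text \<open>Just before the \<open>q\<close>-orbit of \<open>b\<close> first turns negative it
  passes through some \<open>PP i\<close>. Reading the orbit backwards writes \<open>b\<close> as
  \<open>rr m i\<close>, with all intermediate roots positive.\<close>

lemma ex_live: assumes "b \<in> Phi" "pos b" shows "\<exists>k. live k \<and> rho k = b"
proof -
  define j where "j = (LEAST j. \<not> pos ((q ^^ j) b))"
  have j: "\<not> pos ((q ^^ j) b)" unfolding j_def by (rule LeastI_ex[OF q_orbit_neg[OF assms(1)]])
  have less: "pos ((q ^^ k) b)" if "k < j" for k using that not_less_Least unfolding j_def by blast
  have "j \<noteq> 0" using j assms(2) by (metis funpow_0)
  then obtain m where m: "j = Suc m" by (cases j) auto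
  have "\<not> pos (q ((q ^^ m) b))" using j m by simp
  from q_neg_PP[OF q_pow_Phi[OF assms(1)] less this] m obtain i where i: "i < r" "(q ^^ m) b = PP i"
    by auto
  have "rr n i = (q ^^ (m - n)) b" if "n \<le> m" for n using that
  proof (induction n)
    case 0
    then show ?case using i by simp
  next
    case (Suc n)
    then have "m - n = Suc (m - Suc n)" by simp
    then show ?case using Suc by (simp add: rr_Suc)
  qed
  then have rrn: "rr m i = b" "lv m i" using less m by (auto simp: lv_def)
  have "(m * r + i) div r = m" by (rule div_nat_eqI) (use i in auto)
  moreover have "(m * r + i) mod r = i" using i by simp
  ultimately have "(m * r + i) div r = m" "(m * r + i) mod r = i" by blast+
  then show ?thesis using rrn i by (intro exI[of _ "m * r + i"]) (auto simp: live_def rho_def)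
qed

text \<open>If \<open>a < b\<close>, pulling back by \<open>a\<close> steps gives
  \<open>PP i = rr (b - a) n\<close>. Applying \<open>q\<close> once more makes the left side
  negative, while the right side is still a root of a live stretch.\<close>

lemma rr_inj_aux: assumes "lv a i" "lv b n" "rr a i = rr b n" "i < r" "n < r" shows "\<not> a < b"
proof
  assume "a < b"
  have "(q ^^ m) (rr (m + d) k) = rr d k" for m d k
    by (induction m) (simp_all add: q_rr funpow_swap1)
  from this[of a 0 i] this[of a "b - a" n] \<open>a < b\<close> assms(3) have e: "PP i = rr (b - a) n" by simp
  have "b - a = Suc (b - a - 1)" using \<open>a < b\<close> by simp
  then have "q (rr (b - a) n) = rr (b - a - 1) n" using q_rr[of "b - a - 1" n] by metis
  moreover have "pos (rr (b - a - 1) n)" using assms(2) by (intro lv_pos) auto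
  ultimately show False using q_PP_neg[OF assms(4)] e by simp
qed

lemma live_inj: assumes "live k" "live l" "rho k = rho l" shows "k = l"
proof -
  have r: "r > 0" using assms by (simp add: live_def)
  define a i b n where d: "a = k div r" "i = k mod r" "b = l div r" "n = l mod r"
  have in_r: "i < r" "n < r" using r by (simp_all add: d)
  have lv: "lv a i" "lv b n" "rr a i = rr b n" using assms by (simp_all add: d live_def rho_def)
  have "a = b" using rr_inj_aux[OF lv in_r] rr_inj_aux[OF lv(2,1) lv(3)[symmetric] in_r(2,1)] by simp
  have "(q ^^ m) (rr m k) = PP k" for m k
    by (induction m) (simp_all add: q_rr funpow_swap1)
  then have PPe: "PP i = PP n" using lv(3) \<open>a = b\<close> by metis
  have "i = n"
  proof (rule ccontr)
    assume "i \<noteq> n"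
    then consider "i < n" | "n < i" by linarith
    then show False
    proof cases
      case 1
      then show False using PP_coord[of i n] PP_coord[of n n] PPe in_r by simp
    next
      case 2
      then show False using PP_coord[of n i] PP_coord[of i i] PPe in_r by simp
    qed
  qed
  then show ?thesis using \<open>a = b\<close> unfolding d by (metis div_mult_mod_eq)
qed

lemma finite_live: "finite {k. live k}"
proof (rule finite_imageD)
  show "finite (rho ` {k. live k})"
    by (rule finite_subset[OF _ finite_Phi]) (auto simp: live_def intro: rho_Phi)
  show "inj_on rho {k. live k}" using live_inj by (auto simp: inj_on_def)
qed

definition full_word :: "nat \<Rightarrow> nat \<Rightarrow> 'a list" where "full_word j k = map pl [j..<k]"
definition live_word :: "nat \<Rightarrow> nat \<Rightarrow> 'a list" where "live_word j k = map pl (filter live [j..<k])"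

lemma full_word_S: "r > 0 \<Longrightarrow> set (full_word j k) \<subseteq> S" by (auto simp: full_word_def pl_S)
lemma live_word_S: "set (live_word j k) \<subseteq> S" using pl_S[OF live_r] by (auto simp: live_word_def)

lemma full_word_shift: "full_word r (r + k) = full_word 0 k"
  by (rule nth_equalityI) (auto simp: full_word_def periodic_letter_def)

lemma full_word_take: "k \<le> r \<Longrightarrow> full_word 0 k = take k cs"
  by (rule nth_equalityI) (auto simp: full_word_def periodic_letter_def)

lemma wact_full_word: assumes "r > 0" shows "wact (full_word 0 k) (sroot (pl k)) = rho k"
proof (induction k rule: less_induct)
  case (less k)
  show ?case
  proof (cases "k < r")
    case True
    then show ?thesis by (simp add: full_word_take rho_def PP_def periodic_letter_def)
  next
    case False
    define m where "m = k - r"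
    have m: "k = r + m" using False by (simp add: m_def)
    have "[0..<r + m] = [0..<r] @ [r..<r + m]" by (rule upt_add_eq_append) simp
    then have "full_word 0 k = full_word 0 r @ full_word r (r + m)" unfolding m full_word_def by (simp only: map_append)
    then have "full_word 0 k = cs @ full_word 0 m" by (simp add: full_word_shift full_word_take)
    moreover have "pl k = pl m" by (simp add: m periodic_letter_def)
    ultimately have "wact (full_word 0 k) (sroot (pl k)) = act c (rho m)"
      using less[of m] m assms by (simp add: wact_append act_c)
    also have "\<dots> = rho k" using assms by (simp add: rho_def m rr_Suc)
    finally show ?thesis .
  qed
qed

text \<open>The isometry given by the prefix up to \<open>p\<close> carries the orthogonality of
  \<open>rho p\<close> and \<open>rho k\<close> back to the simple root at \<open>p\<close>.\<close>

lemma dead_bil_suffix: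
  assumes "\<not> live p" "live k" "p < k"
  shows "bil (sroot (pl p)) (wact (full_word (Suc p) k) (sroot (pl k))) = 0"
proof -
  have r: "r > 0" using assms by (simp add: live_def)
  define z where "z = wact (full_word (Suc p) k) (sroot (pl k))"
  have "full_word 0 k = full_word 0 p @ pl p # full_word (Suc p) k"
    unfolding full_word_def using assms(3) upt_add_eq_append[of 0 p "k - p"] by (simp add: upt_conv_Cons)
  then have "rho k = wact (full_word 0 p) (vref (sroot (pl p)) z)"
    using wact_full_word[OF r, of k] by (simp add: wact_append z_def)
  then have "bil (rho p) (rho k) = bil (sroot (pl p)) (vref (sroot (pl p)) z)"
    using wact_full_word[OF r, of p] bil_wact[OF full_word_S[OF r, of 0 p]] by metis
  also have "\<dots> = - bil (sroot (pl p)) z" using pl_S[OF r] by (simp add: vref_def bil_diff2)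
  finally show ?thesis using dead_bil_rho[OF assms] by (simp add: z_def)
qed

lemma wact_live_eq_full: assumes "live k" "j \<le> k"
  shows "wact (live_word j k) (sroot (pl k)) = wact (full_word j k) (sroot (pl k))"
  using assms(2)
proof (induction j rule: inc_induct)
  case base
  then show ?case by (simp add: live_word_def full_word_def)
next
  case (step p)
  have a: "full_word p k = pl p # full_word (Suc p) k" using step by (simp add: full_word_def upt_conv_Cons)
  show ?case
  proof (cases "live p")
    case True
    then have "live_word p k = pl p # live_word (Suc p) k" using step by (simp add: live_word_def upt_conv_Cons)
    then show ?thesis using step a by simp
  next
    case False
    then have "live_word p k = live_word (Suc p) k" using step by (simp add: live_word_def upt_conv_Cons)
    then show ?thesis using step a dead_bil_suffix[OF False assms(1)] by (simp add: vref_def)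
  qed
qed

lemma wact_live_word: "live k \<Longrightarrow> wact (live_word 0 k) (sroot (pl k)) = rho k"
  using wact_live_eq_full[of k 0] wact_full_word[OF live_r] by simp

lemma live_word_Suc: "live_word 0 (Suc p) = (if live p then live_word 0 p @ [pl p] else live_word 0 p)"
  by (simp add: live_word_def)

text \<open>The root turns negative at its own position and stays so: a later live letter
  \<open>p\<close> could only flip it back if \<open>rho p = - rho k\<close>, but both are
  positive.\<close>

lemma live_word_inverts:
  assumes "live k" "k < p" shows "pos (\<lambda>a. - wact (rev (live_word 0 p)) (rho k) a)"
  using assms(2)
proof (induction p)
  case (Suc p)
  have r: "r > 0" using assms by (simp add: live_def)
  show ?case
  proof (cases "k = p")
    case True
    have "wact (rev (live_word 0 p)) (rho k) = sroot (pl p)"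
      using wact_live_word[OF assms(1)] wact_rev[OF live_word_S] True by metis
    then show ?thesis using assms True pl_S[OF r] by (simp add: live_word_Suc vref_self)
  next
    case False
    then have IH: "pos (\<lambda>a. - wact (rev (live_word 0 p)) (rho k) a)" using Suc by simp
    show ?thesis
    proof (cases "live p")
      case True
      define d where "d = (\<lambda>a. - wact (rev (live_word 0 p)) (rho k) a)"
      have "wact (rev (live_word 0 p)) (rho k) \<in> Phi" using live_word_S rho_Phi[OF r] by (intro wact_Phi) auto
      then have d: "d \<in> Phi" "pos d" using IH by (auto simp: d_def)
      have "d \<noteq> sroot (pl p)"
      proof
        assume "d = sroot (pl p)"
        then have "wact (live_word 0 p) d = rho p" using wact_live_word[OF True] by simp
        moreover have "wact (live_word 0 p) d = (\<lambda>a. - rho k a)"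
          unfolding d_def wact_uminus using wact_rev[of "rev (live_word 0 p)"] live_word_S by simp
        ultimately show False using rho_pos[OF True] pos_asym[OF rho_Phi[OF r] rho_pos[OF assms(1)]] by simp
      qed
      from act_simple_pos[OF d pl_S[OF r] this] have "pos (vref (sroot (pl p)) d)"
        using pl_S[OF r] by (simp add: act_simple)
      also have "vref (sroot (pl p)) d = (\<lambda>a. - wact (rev (live_word 0 (Suc p))) (rho k) a)"
        unfolding d_def using lin_uminus[OF lin_vref] True by (simp add: live_word_Suc)
      finally show ?thesis .
    qed (use IH in \<open>simp add: live_word_Suc\<close>)
  qed
qed simp

text \<open>
  Otherwise the root would be that of a live position \<open>k > p\<close>; but transported back to position \<open>p\<close>
  that root is orthogonal to the simple root at \<open>p\<close>, not equal to it.
\<close>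

lemma dead_descent:
  assumes "\<not> live p" "r > 0" shows "\<not> pos (wact (live_word 0 p) (sroot (pl p)))"
proof
  assume p: "pos (wact (live_word 0 p) (sroot (pl p)))"
  have "wact (live_word 0 p) (sroot (pl p)) \<in> Phi" using live_word_S pl_S[OF assms(2)] by (intro wact_Phi) auto
  from ex_live[OF this p] obtain k where k: "live k" "rho k = wact (live_word 0 p) (sroot (pl p))" by blast
  have e: "wact (rev (live_word 0 p)) (rho k) = sroot (pl p)" using k wact_rev[OF live_word_S] by simp
  have "k \<noteq> p" using k assms by auto
  then consider "k < p" | "p < k" by linarith
  then show False
  proof cases
    case 1
    from live_word_inverts[OF k(1) this] e show False
      using pos_asym[OF sroot_Phi[OF pl_S[OF assms(2)]] pos_sroot, of p] by simp
  next
    case 2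
    have "filter live [0..<k] = filter live [0..<p] @ filter live [Suc p..<k]"
      using 2 assms(1) upt_add_eq_append[of 0 p "k - p"] by (simp add: upt_conv_Cons)
    then have "live_word 0 k = live_word 0 p @ live_word (Suc p) k" by (simp add: live_word_def)
    then have "rho k = wact (live_word 0 p) (wact (live_word (Suc p) k) (sroot (pl k)))"
      using wact_live_word[OF k(1)] by (simp add: wact_append)
    then have "wact (live_word (Suc p) k) (sroot (pl k)) = sroot (pl p)" using e wact_rev[OF live_word_S] by metis
    then have "wact (full_word (Suc p) k) (sroot (pl k)) = sroot (pl p)" using wact_live_eq_full[OF k(1)] 2 by simp
    then show False using dead_bil_suffix[OF assms(1) k(1) 2] pl_S[OF assms(2)] by simp
  qed
qed

lemma len_live_word: "len G S (wp (live_word 0 p)) = length (live_word 0 p)"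
proof (induction p)
  case (Suc p)
  show ?case
  proof (cases "live p")
    case True
    have r: "r > 0" using True by (simp add: live_def)
    have c: "wp (live_word 0 p) \<in> carrier G" using live_word_S set_S_carrier by blast
    have "pos (act (wp (live_word 0 p)) (sroot (pl p)))"
      using wact_live_word[OF True] rho_pos[OF True] by (simp add: act_wp[OF live_word_S])
    then have "len G S (wp (live_word 0 p) \<otimes> pl p) = len G S (wp (live_word 0 p)) + 1"
      using tits_iff[OF c pl_S[OF r], of p] len_mult_simple_cases[OF c pl_S[OF r], of p] by simp
    then show ?thesis using Suc True live_word_S[of 0 p] pl_S[OF r] by (simp add: live_word_Suc wp_append set_S_carrier)
  qed (use Suc in \<open>simp add: live_word_Suc\<close>)
qed (simp add: live_word_def)

text \<open>\<open>insert 0\<close> keeps the maximum defined in rank 0, where no position is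
  live.\<close>

definition live_bound :: nat where "live_bound = Suc (Max (insert 0 {k. live k}))"

lemma live_less_bound: "live k \<Longrightarrow> k < live_bound"
  unfolding live_bound_def using finite_live by (simp add: le_imp_less_Suc)

lemma longest_live_word: "longest_element G S = wp (live_word 0 live_bound)"
proof (rule longest_element_eq)
  show "wp (live_word 0 live_bound) \<in> carrier G" using live_word_S set_S_carrier by blast
next
  fix s assume s: "s \<in> S"
  show "\<not> pos (act (wp (live_word 0 live_bound)) (sroot s))"
  proof
    assume p: "pos (act (wp (live_word 0 live_bound)) (sroot s))"
    have "act (wp (live_word 0 live_bound)) (sroot s) \<in> Phi" using s live_word_S set_S_carrier by blast
    from ex_live[OF this p] obtain k where k: "live k" "rho k = wact (live_word 0 live_bound) (sroot s)"
      by (auto simp: act_wp[OF live_word_S])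
    then have "wact (rev (live_word 0 live_bound)) (rho k) = sroot s" using wact_rev[OF live_word_S] by simp
    with live_word_inverts[OF k(1) live_less_bound[OF k(1)]] show False
      using pos_asym[OF sroot_Phi[OF s] pos_sroot] by simp
  qed
qed

definition live_pos :: "nat list" where "live_pos = filter live [0..<live_bound]"

lemma live_word_eq: "live_word 0 live_bound = map pl live_pos" by (simp add: live_word_def live_pos_def)

lemma sorted_live_pos: "sorted_wrt (<) live_pos" unfolding live_pos_def by (rule sorted_wrt_filter) (rule sorted_wrt_upt)

lemma set_live_pos: "set live_pos = {k. live k}" using live_less_bound by (auto simp: live_pos_def)

lemma subword_live_pos: "subword_positions G S cs (longest_element G S) live_pos"
  unfolding subword_positions_def reduced_word_def longest_live_word live_word_eq[symmetric]
  using sorted_live_pos live_word_S len_live_word by auto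

lemma take_live_pos: "i < length live_pos \<Longrightarrow> take i live_pos = filter live [0..<live_pos ! i]"
proof -
  assume i: "i < length live_pos"
  have "sorted_wrt (<) (take i live_pos)" using sorted_live_pos by (rule sorted_wrt_take)
  moreover have "sorted_wrt (<) (filter live [0..<live_pos ! i])" by (rule sorted_wrt_filter) (rule sorted_wrt_upt)
  moreover have "set (take i live_pos) = set (filter live [0..<live_pos ! i])"
  proof
    show "set (take i live_pos) \<subseteq> set (filter live [0..<live_pos ! i])"
    proof
      fix k assume "k \<in> set (take i live_pos)"
      then obtain j where j: "j < i" "k = live_pos ! j" by (auto simp: in_set_conv_nth)
      then have "k < live_pos ! i" using sorted_wrt_nth_less[OF sorted_live_pos, of j i] i by simp
      moreover have "live k" using j i set_live_pos nth_mem[of j live_pos] by auto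
      ultimately show "k \<in> set (filter live [0..<live_pos ! i])" by auto
    qed
    show "set (filter live [0..<live_pos ! i]) \<subseteq> set (take i live_pos)"
    proof
      fix k assume "k \<in> set (filter live [0..<live_pos ! i])"
      then have k: "k < live_pos ! i" "k \<in> set live_pos" using set_live_pos by auto
      then obtain j where j: "j < length live_pos" "k = live_pos ! j" by (auto simp: in_set_conv_nth)
      have "j < i"
        using sorted_wrt_nth_less[OF sorted_live_pos, of i j] j k(1) by (metis less_asym linorder_neqE_nat)
      then show "k \<in> set (take i live_pos)" using j i by (auto simp: in_set_conv_nth)
    qed
  qed
  ultimately show ?thesis by (intro strict_sorted_equal) simp_all
qed

text \<open>If \<open>qs\<close> took an earlier position \<open>p\<close> at the first difference,
  then \<open>p\<close> would be dead and the common prefix would spell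
  \<open>live_word 0 p\<close>. By \<open>dead_descent\<close> the letter at \<open>p\<close>
  shortens that prefix, so \<open>qs\<close> would not be reduced.\<close>

lemma lex_first_live_pos:
  assumes q: "subword_positions G S cs (longest_element G S) qs"
  shows "live_pos = qs \<or> (live_pos, qs) \<in> lexord less_than"
proof (cases "live_pos = qs")
  case False
  have len: "length qs = length live_pos"
    using q subword_live_pos by (simp add: subword_positions_def reduced_word_def)
  define i where "i = (LEAST i. i < length live_pos \<and> live_pos ! i \<noteq> qs ! i)"
  have ex: "\<exists>i. i < length live_pos \<and> live_pos ! i \<noteq> qs ! i" using False len by (metis nth_equalityI)
  have i: "i < length live_pos" "live_pos ! i \<noteq> qs ! i" using LeastI_ex[OF ex] by (simp_all add: i_def)
  have below: "live_pos ! j = qs ! j" if "j < i" for j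
    using not_less_Least[of j "\<lambda>i. i < length live_pos \<and> live_pos ! i \<noteq> qs ! i"] that i by (auto simp: i_def)
  have tk: "take i live_pos = take i qs" using i len below by (intro nth_equalityI) auto
  have "\<not> qs ! i < live_pos ! i"
  proof
    assume lt: "qs ! i < live_pos ! i"
    define p where "p = qs ! i"
    have r: "r > 0" using i set_live_pos live_r nth_mem by blast
    have sq: "sorted_wrt (<) qs" and rq: "reduced_word G S (map pl qs) (longest_element G S)"
      using q by (simp_all add: subword_positions_def)
    have dead: "\<not> live p"
    proof
      assume "live p"
      then have "p \<in> set (take i live_pos)" using lt take_live_pos[OF i(1)] by (simp add: p_def)
      then obtain j where "j < i" "p = qs ! j" using tk i len by (auto simp: in_set_conv_nth)
      then show False using sorted_wrt_nth_less[OF sq, of j i] i len by (simp add: p_def)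
    qed
    \<comment> \<open>Every live position below \<open>live_pos ! i\<close> belongs to the common
      prefix and thus lies below \<open>p\<close>.\<close>
    have "filter live [0..<live_pos ! i] = filter live [0..<p]"
    proof (rule strict_sorted_equal)
      show "set (filter live [0..<live_pos ! i]) = set (filter live [0..<p])"
      proof
        show "set (filter live [0..<p]) \<subseteq> set (filter live [0..<live_pos ! i])" using lt by (auto simp: p_def)
        show "set (filter live [0..<live_pos ! i]) \<subseteq> set (filter live [0..<p])"
        proof
          fix k assume k: "k \<in> set (filter live [0..<live_pos ! i])"
          then have "k \<in> set (take i qs)" using take_live_pos[OF i(1)] tk by simp
          then obtain j where "j < i" "k = qs ! j" by (auto simp: in_set_conv_nth)
          then have "k < p" using sorted_wrt_nth_less[OF sq, of j i] i len by (simp add: p_def)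
          then show "k \<in> set (filter live [0..<p])" using k by auto
        qed
      qed
    qed (rule sorted_wrt_filter, rule sorted_wrt_upt)+
    then have pre: "map pl (take i qs) = live_word 0 p" using take_live_pos[OF i(1)] tk by (simp add: live_word_def)
    define W where "W = wp (live_word 0 p)"
    have "W \<in> carrier G" using live_word_S[of 0 p] set_S_carrier unfolding W_def by blast
    moreover have "len G S W = i"
      using len_live_word[of p] i len unfolding W_def pre[symmetric] by simp
    ultimately have W: "W \<in> carrier G" "len G S W = i" by blast+
    have "\<not> pos (act W (sroot (pl p)))" using dead_descent[OF dead r] by (simp add: W_def act_wp[OF live_word_S])
    then have less: "len G S (W \<otimes> pl p) < i"
      using tits_iff[OF W(1) pl_S[OF r], of p] len_mult_simple_cases[OF W(1) pl_S[OF r], of p] W(2) by linarith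
    define rest where "rest = map pl (drop (Suc i) qs)"
    have split: "map pl qs = live_word 0 p @ pl p # rest"
      using id_take_nth_drop[of i qs] i len pre unfolding rest_def p_def
      by (metis list.simps(9) map_append)
    have rS: "set rest \<subseteq> S" using pl_S[OF r] by (auto simp: rest_def)
    have "longest_element G S = W \<otimes> pl p \<otimes> wp rest"
      using rq split live_word_S[of 0 p] rS pl_S[OF r] W
      by (simp add: reduced_word_def wp_append set_S_carrier W_def m_assoc wp_closed)
    then have "len G S (longest_element G S) \<le> len G S (W \<otimes> pl p) + length rest"
      using len_mult_le[of "W \<otimes> pl p" "wp rest"] len_le[OF rS, of G] W pl_S[OF r] rS
      by (simp add: set_S_carrier wp_closed)
    moreover have "len G S (longest_element G S) = length qs" using rq by (simp add: reduced_word_def)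
    ultimately show False using less i len by (simp add: rest_def)
  qed
  then have "live_pos ! i < qs ! i" using i by simp
  then show ?thesis using i len tk by (auto simp: lexord_take_index_conv)
qed simp

lemma sorting_word_eq: "sorting_word G S cs (longest_element G S) = map pl live_pos"
proof -
  have "sorting_positions G S cs (longest_element G S) = live_pos"
    unfolding sorting_positions_def
  proof (rule the_equality)
    show "subword_positions G S cs (longest_element G S) live_pos \<and>
      (\<forall>qs. subword_positions G S cs (longest_element G S) qs \<longrightarrow> live_pos = qs \<or> (live_pos, qs) \<in> lexord less_than)"
      using subword_live_pos lex_first_live_pos by blast
  next
    fix xs assume xs: "subword_positions G S cs (longest_element G S) xs \<and>
      (\<forall>qs. subword_positions G S cs (longest_element G S) qs \<longrightarrow> xs = qs \<or> (xs, qs) \<in> lexord less_than)"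
    have "asym (lexord less_than)" by (intro lexord_asym) (simp add: asym_on_def)
    then show "xs = live_pos" using xs subword_live_pos lex_first_live_pos by (metis asymD)
  qed
  then show ?thesis by (simp add: sorting_word_def)
qed

text \<open>The inversion sequence of the sorting word alone, without its commutation class: a
  linear extension of the partial order on reflections.\<close>

definition refl_seq :: "'a list" where "refl_seq = inv_seq G (map pl live_pos)"

lemma live_pos_word_S: "set (map pl live_pos) \<subseteq> S" using live_word_S[of 0 live_bound] by (simp add: live_word_eq)

lemma length_refl_seq: "length refl_seq = length live_pos" by (simp add: refl_seq_def)

lemma proot_refl_seq: assumes "i < length live_pos" shows "proot (refl_seq ! i) = rho (live_pos ! i)"
proof -
  have lv: "live (live_pos ! i)" using assms set_live_pos nth_mem by blast
  have "take i (map pl live_pos) = live_word 0 (live_pos ! i)" using take_live_pos[OF assms] by (simp add: live_word_def take_map)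
  then show ?thesis unfolding refl_seq_def
    using proot_inv_seq[OF live_pos_word_S, of i] assms wact_live_word[OF lv] rho_pos[OF lv] by simp
qed

lemma refl_seq_T: "set refl_seq \<subseteq> T" unfolding refl_seq_def by (rule inv_seq_T[OF live_pos_word_S])

lemma distinct_refl_seq: "distinct refl_seq"
proof -
  have "distinct (map proot refl_seq)"
  proof -
    have "map proot refl_seq = map rho live_pos" by (rule nth_equalityI) (auto simp: length_refl_seq proot_refl_seq)
    moreover have "distinct live_pos" using sorted_live_pos strict_sorted_iff by blast
    moreover have "inj_on rho (set live_pos)" using live_inj by (auto simp: inj_on_def set_live_pos)
    ultimately show ?thesis by (simp add: distinct_map)
  qed
  then show ?thesis by (simp add: distinct_map)
qed

lemma set_refl_seq: "set refl_seq = T"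
proof
  show "T \<subseteq> set refl_seq"
  proof
    fix t assume t: "t \<in> T"
    from ex_live[of "proot t"] t obtain k where k: "live k" "rho k = proot t" by auto
    then have "k \<in> set live_pos" by (simp add: set_live_pos)
    then obtain i where i: "i < length live_pos" "live_pos ! i = k" by (auto simp: in_set_conv_nth)
    then have "proot (refl_seq ! i) = proot t" using proot_refl_seq k by simp
    moreover have "refl_seq ! i \<in> T" using i refl_seq_T length_refl_seq nth_mem by (metis subsetD)
    ultimately have "refl_seq ! i = t" using proot_inj t by blast
    then show "t \<in> set refl_seq" using i length_refl_seq nth_mem by metis
  qed
qed (rule refl_seq_T)

lemma E_refl_seq:
  assumes "i < j" "j < length refl_seq"
  shows "E (proot (refl_seq ! i)) (proot (refl_seq ! j)) \<ge> 0" "E (proot (refl_seq ! j)) (proot (refl_seq ! i)) \<le> 0"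
proof -
  have "live (live_pos ! j)" "live_pos ! i < live_pos ! j"
    using assms set_live_pos nth_mem[of j live_pos] sorted_wrt_nth_less[OF sorted_live_pos] by (auto simp: length_refl_seq)
  then show "E (proot (refl_seq ! i)) (proot (refl_seq ! j)) \<ge> 0" "E (proot (refl_seq ! j)) (proot (refl_seq ! i)) \<le> 0"
    using E_rho_nonneg E_rho_nonpos assms by (auto simp: length_refl_seq proot_refl_seq)
qed

end

section \<open>Concordant words with acute roots\<close>

context finite_coxeter
begin

text \<open>Concordance as a property of words: every letter raises the length, by whatever amount.
  The recursive form lets words be conjugated and extended; for \<open>u\<close> in
  \<open>W_plus\<close> it agrees with concordance by \<open>concordant_iff\<close>.\<close>

fun conc_word :: "'a \<Rightarrow> 'a list \<Rightarrow> bool" where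
  "conc_word u [] \<longleftrightarrow> True"
| "conc_word u (t # ts) \<longleftrightarrow> pos (act u (proot t)) \<and> conc_word (u \<otimes> t) ts"

lemma conc_word_append:
  "u \<in> carrier G \<Longrightarrow> set xs \<subseteq> T \<Longrightarrow> conc_word u (xs @ ys) \<longleftrightarrow> conc_word u xs \<and> conc_word (u \<otimes> wp xs) ys"
proof (induction xs arbitrary: u)
  case (Cons x xs)
  then have "x \<in> carrier G" "set xs \<subseteq> T" "set xs \<subseteq> carrier G" by auto
  then show ?case using Cons by (simp add: m_assoc wp_closed)
qed simp

lemma conc_word_iff:
  "u \<in> carrier G \<Longrightarrow> set ts \<subseteq> T \<Longrightarrow>
    conc_word u ts \<longleftrightarrow> (\<forall>i<length ts. pos (act (u \<otimes> wp (take i ts)) (proot (ts ! i))))"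
proof (induction ts arbitrary: u)
  case (Cons t ts)
  have t: "t \<in> carrier G" "set ts \<subseteq> T" using Cons.prems by auto
  have tk: "wp (take i ts) \<in> carrier G" for i
    using t(2) set_take_subset[of i ts] by (intro wp_closed) blast
  have "(\<forall>i<length (t # ts). pos (act (u \<otimes> wp (take i (t # ts))) (proot ((t # ts) ! i))))
    \<longleftrightarrow> pos (act u (proot t)) \<and>
      (\<forall>i<length ts. pos (act (u \<otimes> (t \<otimes> wp (take i ts))) (proot (ts ! i))))"
    using Cons.prems by (simp add: All_less_Suc2)
  then show ?case using Cons.IH[of "u \<otimes> t"] Cons.prems(1) t tk by (simp add: m_assoc)
qed simp

lemma gam_act:
  assumes "set ts \<subseteq> T" "i < length ts"
  shows "gam (map proot ts) i = act (wp (take i ts)) (proot (ts ! i))"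
proof -
  have "set (take i ts) \<subseteq> T" using assms(1) set_take_subset by fastforce
  then show ?thesis using assms by (simp add: gam_def take_map act_wp_T)
qed

lemma gam_Phi:
  assumes "set ts \<subseteq> T" "i < length ts" shows "gam (map proot ts) i \<in> Phi"
proof -
  have "set (take i ts) \<subseteq> carrier G" using assms(1) set_take_subset[of i ts] by blast
  moreover have "ts ! i \<in> T" using assms nth_mem by blast
  ultimately show ?thesis unfolding gam_act[OF assms] by (intro Phi_act wp_closed proot_Phi)
qed

text \<open>These pairings are the coefficients of \<open>q_telescope_T_word\<close> at
  \<open>act (inv u) rho2\<close>, so concordance places that difference in the open cone of the
  word.\<close>

lemma conc_word_bil:
  assumes "u \<in> carrier G" "set ts \<subseteq> T" "conc_word u ts" "i < length ts"
  shows "bil (gam (map proot ts) i) (act (inv u) rho2) > 0"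
proof -
  have "set (take i ts) \<subseteq> carrier G" using assms(2) set_take_subset[of i ts] by blast
  then have "act u (gam (map proot ts) i) = act (u \<otimes> wp (take i ts)) (proot (ts ! i))"
    using assms by (simp add: gam_act act_mult wp_closed)
  then have "pos (act u (gam (map proot ts) i))" using conc_word_iff[OF assms(1,2)] assms(3,4) by simp
  then show ?thesis using pos_act_iff[OF gam_Phi[OF assms(2,4)] assms(1)] by simp
qed

lemma proot_simple_conj:
  assumes "t \<in> T" "s \<in> S" "t \<noteq> s" shows "proot (s \<otimes> t \<otimes> s) = act s (proot t)" "s \<otimes> t \<otimes> s \<in> T"
proof -
  have "proot t \<noteq> sroot s" using proot_inj[of t s] assms by auto
  then have "pos (act s (proot t))" using assms by (intro act_simple_pos) auto
  then show "proot (s \<otimes> t \<otimes> s) = act s (proot t)" using proot_conj[of t s] assms by simp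
  show "s \<otimes> t \<otimes> s \<in> T" using T_conj[of t s] assms by simp
qed

text \<open>As \<open>s\<close> does not occur, \<open>act s\<close> keeps the root of each letter
  positive, so the positivity tests of both words are the same, letter by letter.\<close>

lemma conc_word_conj:
  assumes s: "s \<in> S"
  shows "u \<in> carrier G \<Longrightarrow> set ts \<subseteq> T \<Longrightarrow> s \<notin> set ts \<Longrightarrow>
    conc_word u (map (\<lambda>t. s \<otimes> t \<otimes> s) ts) \<longleftrightarrow> conc_word (u \<otimes> s) ts"
proof (induction ts arbitrary: u)
  case (Cons t ts)
  have t: "t \<in> T" "set ts \<subseteq> T" "t \<noteq> s" using Cons.prems by auto
  have pr: "proot (s \<otimes> t \<otimes> s) = act s (proot t)" using proot_simple_conj(1)[OF t(1) s t(3)] .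
  have "u \<otimes> (s \<otimes> t \<otimes> s) \<otimes> s = u \<otimes> s \<otimes> t" using Cons.prems(1) t s by (simp add: m_assoc simple_involution)
  moreover have "conc_word (u \<otimes> (s \<otimes> t \<otimes> s)) (map (\<lambda>t. s \<otimes> t \<otimes> s) ts)
      \<longleftrightarrow> conc_word (u \<otimes> (s \<otimes> t \<otimes> s) \<otimes> s) ts"
    using Cons.prems t s by (intro Cons.IH) auto
  moreover have "act u (act s (proot t)) = act (u \<otimes> s) (proot t)" using Cons.prems(1) s by (simp add: act_mult)
  ultimately show ?case by (simp add: pr)
qed simp

lemma wp_conj:
  "s \<in> S \<Longrightarrow> set ts \<subseteq> carrier G \<Longrightarrow> wp (map (\<lambda>t. s \<otimes> t \<otimes> s) ts) = s \<otimes> wp ts \<otimes> s"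
proof (induction ts)
  case (Cons t ts)
  define w where "w = wp ts"
  have w: "w \<in> carrier G" using Cons.prems by (auto simp: w_def)
  have "s \<otimes> (s \<otimes> (w \<otimes> s)) = w \<otimes> s" using Cons.prems(1) w by (simp add: m_assoc[symmetric] simple_involution)
  then show ?case using Cons w by (simp add: m_assoc flip: w_def)
qed (simp add: simple_involution)

definition acute :: "'a list \<Rightarrow> bool" where
  "acute ts \<longleftrightarrow> (\<forall>t\<in>set ts. \<forall>t'\<in>set ts. bil (proot t) (proot t') \<ge> 0)"

text \<open>
  If \<open>s\<close> occurred, all summands of \<open>E(\<alpha>\<^sub>s, x - q x) = \<Sum> a\<^sub>i E(\<alpha>\<^sub>s, \<beta>\<^sub>i)\<close> would be nonnegative and one
  positive, while the left-hand side is \<open>B(\<alpha>\<^sub>s, x) < 0\<close>.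
\<close>

lemma simple_not_in_acute_final:
  assumes cs: "distinct (cs @ [s])" "set (cs @ [s]) \<subseteq> S"
    and ts: "set ts \<subseteq> T" "wp ts = wp (cs @ [s])" "length ts = length (cs @ [s])"
      "\<And>t. t \<in> set ts \<Longrightarrow> supp (set (cs @ [s])) (proot t)"
    and ac: "acute ts" and u: "u \<in> carrier G" and co: "conc_word u ts"
    and desc: "len G S (u \<otimes> s) < len G S u"
  shows "s \<notin> set ts"
proof
  assume "s \<in> set ts"
  interpret c': cox_word G S "cs @ [s]" by unfold_locales (use cs in auto)
  have s: "s \<in> S" using cs by auto
  from \<open>s \<in> set ts\<close> obtain k where k: "k < length ts" "ts ! k = s" by (auto simp: in_set_conv_nth)
  have wpc: "wp ts = c'.c" using ts by (simp add: c'.c_def)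
  have fac: "c'.factors (map proot ts)" by (rule c'.factors_T_word[OF ts(1) wpc ts(4)])
  define x where "x = act (inv u) rho2"
  define a where "a = (\<lambda>i. bil (gam (map proot ts) i) x)"
  have apos: "a i > 0" if "i < length ts" for i
    unfolding a_def x_def by (rule conc_word_bil[OF u ts(1) co that])
  have T: "ts ! i \<in> T" if "i < length ts" for i using that ts(1) by auto
  \<comment> \<open>Letters after position \<open>k\<close> contribute 0 and \<open>k\<close> itself
    contributes 1. For an earlier letter the reversed value of \<open>E\<close> vanishes, so what
    remains is \<open>bil\<close>, which is nonnegative by acuteness.\<close>
  have nn: "c'.E (sroot s) (proot (ts ! i)) \<ge> 0" if i: "i < length ts" for i
  proof (cases "k < i")
    case True
    then show ?thesis using c'.factors_E[OF fac, of k i] ts(3) i k s by simp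
  next
    case False
    show ?thesis
    proof (cases "i = k")
      case True
      then show ?thesis using c'.factors_E[OF fac, of k k] ts(3) k s by simp
    next
      case ne: False
      have "c'.E (proot (ts ! i)) (sroot s) = 0"
        using c'.factors_E[OF fac, of i k] ts(3) k s False ne by simp
      moreover have "c'.E (sroot s) (proot (ts ! i)) + c'.E (proot (ts ! i)) (sroot s)
          = bil (sroot s) (proot (ts ! i))"
        using ts(4) i by (intro c'.E_sym) auto
      moreover have "bil (sroot s) (proot (ts ! i)) \<ge> 0"
        using ac \<open>s \<in> set ts\<close> i s unfolding acute_def by (metis nth_mem proot_simple)
      ultimately show ?thesis by simp
    qed
  qed
  have "c'.E (sroot s) (proot (ts ! k)) = 1"
    using c'.factors_E[OF fac, of k k] ts(3) k s by simp
  then have "(\<Sum>i<length ts. a i * c'.E (sroot s) (proot (ts ! i))) > 0"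
    using apos nn k by (intro sum_pos2[of _ k]) (auto intro: mult_nonneg_nonneg less_imp_le)
  also have "(\<Sum>i<length ts. a i * c'.E (sroot s) (proot (ts ! i)))
      = c'.E (sroot s) (\<lambda>b. \<Sum>i<length ts. a i * proot (ts ! i) b)" by (simp add: c'.E_sum2)
  also have "(\<lambda>b. \<Sum>i<length ts. a i * proot (ts ! i) b) = (\<lambda>b. x b - c'.q x b)"
    unfolding c'.q_telescope_T_word[OF ts(1) wpc] a_def ..
  also have "c'.E (sroot s) \<dots> = bil (sroot s) x" by (intro c'.E_telescope) simp
  finally have "pos (act u (sroot s))" using pos_act_iff[OF sroot_Phi[OF s] u] by (simp add: x_def)
  then show False using tits_iff[OF u s] desc by simp
qed

lemma len_bound: "w \<in> carrier G \<Longrightarrow> len G S w \<le> Max (len G S ` carrier G)"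
  using finite_carrier by simp

text \<open>The induction is lexicographic, packed into one number: either the rank drops, or it
  stays and \<open>u\<close> gets longer, with \<open>Max\<close> as the bound. Rotating the initial
  letter \<open>s\<close> to the end of \<open>cs\<close> replaces \<open>u\<close> by the longer
  \<open>u \<otimes> s\<close>; deleting it passes to a parabolic subgroup. The support clause keeps
  \<open>s\<close> out of the word found there.\<close>

theorem acute_concordant_exists:
  assumes "distinct cs" "set cs \<subseteq> S" "u \<in> carrier G"
    and "len G S (u \<otimes> wp cs) = len G S u + length cs"
  shows "\<exists>ts. length ts = length cs \<and> set ts \<subseteq> T \<and> wp ts = wp cs \<and>
    (\<forall>t\<in>set ts. supp (set cs) (proot t)) \<and> acute ts \<and> conc_word u ts"
  using assms
proof (induction "length cs * (Max (len G S ` carrier G) + 1) + (Max (len G S ` carrier G) - len G S u)"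
    arbitrary: cs u rule: less_induct)
  case less
  define N where "N = Max (len G S ` carrier G)"
  note u = less.prems(3)
  show ?case
  proof (cases cs)
    case Nil
    then show ?thesis by (intro exI[of _ "[]"]) (simp add: acute_def)
  next
    case (Cons s cs0)
    have s: "s \<in> S" and cs0: "set cs0 \<subseteq> S" "distinct cs0" "s \<notin> set cs0"
      using less.prems Cons by auto
    define d where "d = wp cs0"
    have d: "d \<in> carrier G" using cs0 by (auto simp: d_def set_S_carrier)
    have wpc: "wp cs = s \<otimes> d" using Cons by (simp add: d_def)
    have usd: "u \<otimes> wp cs = u \<otimes> s \<otimes> d" using u s d by (simp add: wpc m_assoc)
    have lenc: "len G S (u \<otimes> s \<otimes> d) = len G S u + length cs0 + 1" using less.prems(4) Cons usd by simp
    have "len G S (u \<otimes> s \<otimes> d) \<le> len G S (u \<otimes> s) + length cs0"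
      using len_mult_le[of "u \<otimes> s" d] len_le[OF cs0(1), of G] u s d by (simp add: d_def)
    then have lus: "len G S (u \<otimes> s) = len G S u + 1"
      using len_mult_simple_le[OF u s] lenc by simp
    have lusN: "len G S (u \<otimes> s) \<le> N" using u s len_bound[of "u \<otimes> s"] by (simp add: N_def)
    show ?thesis
    proof (cases "len G S (u \<otimes> s \<otimes> d) < len G S (u \<otimes> s \<otimes> d \<otimes> s)")
      case True
      define cs' where "cs' = cs0 @ [s]"
      have cs': "distinct cs'" "set cs' = set cs" "length cs' = length cs" "set cs' \<subseteq> S"
        using cs0 s Cons by (auto simp: cs'_def)
      have wpc': "wp cs' = d \<otimes> s" using cs0 s by (simp add: cs'_def d_def wp_append set_S_carrier)
      have "len G S (u \<otimes> s \<otimes> d \<otimes> s) = len G S (u \<otimes> s \<otimes> d) + 1"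
        using True len_mult_simple_cases[of "u \<otimes> s \<otimes> d" s] u s d by auto
      then have l': "len G S ((u \<otimes> s) \<otimes> wp cs') = len G S (u \<otimes> s) + length cs'"
        using u s d lenc lus Cons cs'(3) by (simp add: wpc' m_assoc)
      have dec: "length cs' * (N + 1) + (N - len G S (u \<otimes> s)) < length cs * (N + 1) + (N - len G S u)"
        using lus lusN cs'(3) by simp
      have "u \<otimes> s \<in> carrier G" using u s by simp
      from less.hyps[OF dec[unfolded N_def] cs'(1,4) this l'] obtain ts where ts:
        "length ts = length cs'" "set ts \<subseteq> T" "wp ts = wp cs'"
        "\<forall>t\<in>set ts. supp (set cs') (proot t)" "acute ts" "conc_word (u \<otimes> s) ts" by blast
      \<comment> \<open>\<open>u \<otimes> s\<close> has \<open>s\<close> as a descent. Excluding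
        \<open>s\<close> from \<open>ts\<close> keeps every root positive under
        \<open>act s\<close>, as the conjugation requires.\<close>
      have sn: "s \<notin> set ts"
        by (rule simple_not_in_acute_final[of cs0 s ts "u \<otimes> s"])
          (use ts cs' u s lus in \<open>auto simp: cs'_def\<close>)
      define ts' where "ts' = map (\<lambda>t. s \<otimes> t \<otimes> s) ts"
      have pr: "proot (s \<otimes> t \<otimes> s) = act s (proot t)" "s \<otimes> t \<otimes> s \<in> T" if "t \<in> set ts" for t
        using proot_simple_conj[of t s] that ts(2) s sn by auto
      have "length ts' = length cs" using ts cs' by (simp add: ts'_def)
      moreover have "set ts' \<subseteq> T" using pr by (auto simp: ts'_def)
      moreover have "wp ts' = wp cs"
      proof -
        have "set ts \<subseteq> carrier G" using ts(2) by auto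
        then have "wp ts' = s \<otimes> (d \<otimes> s) \<otimes> s" using wp_conj[OF s] ts(3) wpc' by (simp add: ts'_def)
        then show ?thesis using s d wpc by (simp add: m_assoc simple_involution)
      qed
      moreover have "\<forall>t\<in>set ts'. supp (set cs) (proot t)"
        using pr ts(4) cs'(2) s Cons by (auto simp: ts'_def act_simple intro!: supp_vref)
      moreover have "acute ts'" using ts(5) pr s by (auto simp: acute_def ts'_def bil_act)
      moreover have "conc_word u ts'" unfolding ts'_def using conc_word_conj[OF s u ts(2) sn] ts(6) by simp
      ultimately show ?thesis by blast
    next
      case False
      have l0: "len G S ((u \<otimes> s) \<otimes> wp cs0) = len G S (u \<otimes> s) + length cs0"
        using lenc lus by (simp add: d_def)
      have dec: "length cs0 * (N + 1) + (N - len G S (u \<otimes> s)) < length cs * (N + 1) + (N - len G S u)"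
        using Cons by simp
      have us: "u \<otimes> s \<in> carrier G" using u s by simp
      from less.hyps[OF dec[unfolded N_def] cs0(2,1) us l0] obtain ts where ts:
        "length ts = length cs0" "set ts \<subseteq> T" "wp ts = wp cs0"
        "\<forall>t\<in>set ts. supp (set cs0) (proot t)" "acute ts" "conc_word (u \<otimes> s) ts" by blast
      have sn: "s \<notin> set ts" using ts(4) s cs0(3) by (metis proot_simple supp_sroot)
      define ts' where "ts' = map (\<lambda>t. s \<otimes> t \<otimes> s) ts"
      have pr: "proot (s \<otimes> t \<otimes> s) = act s (proot t)" "s \<otimes> t \<otimes> s \<in> T" if "t \<in> set ts" for t
        using proot_simple_conj[of t s] that ts(2) s sn by auto
      have tsc: "set ts \<subseteq> carrier G" using ts(2) by auto
      have wpt': "wp ts' = s \<otimes> d \<otimes> s" using wp_conj[OF s tsc] ts(3) by (simp add: ts'_def d_def)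
      have tT: "set ts' \<subseteq> T" using pr by (auto simp: ts'_def)
      then have tC: "set ts' \<subseteq> carrier G" by auto
      have "length (ts' @ [s]) = length cs" using ts Cons by (simp add: ts'_def)
      moreover have "set (ts' @ [s]) \<subseteq> T" using tT s by auto
      moreover have "wp (ts' @ [s]) = wp cs"
        using tC s d wpc by (simp add: wp_append wpt' m_assoc simple_involution)
      moreover have "\<forall>t\<in>set (ts' @ [s]). supp (set cs) (proot t)"
        using pr ts(4) s Cons by (auto simp: ts'_def act_simple intro!: supp_vref elim: supp_mono)
      moreover have "acute (ts' @ [s])"
      proof -
        \<comment> \<open>The reflection flips the sign of the pairing with \<open>sroot s\<close>,
          which was nonpositive: the old root is positive, has no coordinate at \<open>s\<close>,
          and distinct simple roots are obtuse.\<close>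
        have low: "bil (sroot s) (act s (proot t)) \<ge> 0" if t: "t \<in> set ts" for t
        proof -
          have "bil (sroot s) (act s (proot t)) = - bil (sroot s) (proot t)"
            using s by (simp add: act_simple vref_def bil_diff2)
          moreover have "bil (sroot s) (proot t) \<le> 0"
            unfolding bil_sroot[OF s]
          proof (rule sum_nonpos)
            fix a assume a: "a \<in> S"
            have "proot t \<in> Phi \<and> pos (proot t)" using t ts(2) by blast
            then show "proot t a * cox_coeff s a \<le> 0"
              using ts(4) t cs0(3) cox_coeff_nonpos[OF s a]
              by (cases "a = s") (auto simp: supp_def pos_def mult_nonneg_nonpos)
          qed
          ultimately show ?thesis by simp
        qed
        then have "bil (act s (proot t)) (sroot s) \<ge> 0" if "t \<in> set ts" for t
          using that by (simp add: bil_sym[of "act s (proot t)"])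
        with low show ?thesis using ts(5) pr s by (auto simp: acute_def ts'_def bil_act)
      qed
      moreover have "conc_word u (ts' @ [s])"
      proof -
        have w: "u \<otimes> s \<otimes> d \<in> carrier G" using u s d by simp
        have usds: "u \<otimes> (s \<otimes> d \<otimes> s) = u \<otimes> s \<otimes> d \<otimes> s" using u s d by (simp add: m_assoc)
        \<comment> \<open>The conjugated word leads from \<open>u\<close> to
          \<open>u \<otimes> s \<otimes> d \<otimes> s\<close>. In this case that element is shorter
          than \<open>u \<otimes> s \<otimes> d\<close>, so the appended \<open>s\<close> goes
          up.\<close>
        have "len G S (u \<otimes> s \<otimes> d \<otimes> s) < len G S (u \<otimes> s \<otimes> d)"
          using False len_mult_simple_neq[OF w s] by simp
        then have "pos (act (u \<otimes> s \<otimes> d \<otimes> s) (sroot s))"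
          using tits_iff[of "u \<otimes> s \<otimes> d \<otimes> s" s] w s by simp
        then have "pos (act (u \<otimes> wp ts') (proot s))" using s by (simp add: wpt' usds)
        moreover have "conc_word u ts'" unfolding ts'_def using conc_word_conj[OF s u ts(2) sn] ts(6) by simp
        ultimately show ?thesis using conc_word_append[OF u tT] by simp
      qed
      ultimately show ?thesis by blast
    qed
  qed
qed

end

section \<open>Maximal chains and commutation classes\<close>

context finite_coxeter
begin

lemma comm_step_wp:
  "comm_step G xs ys \<Longrightarrow> set xs \<subseteq> carrier G \<Longrightarrow> wp ys = wp xs"
proof (induction rule: comm_step.induct)
  case (1 a b xs ys)
  then have "a \<otimes> (b \<otimes> w) = b \<otimes> (a \<otimes> w)" if "w \<in> carrier G" for w
    using that by (simp add: m_assoc[symmetric])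
  with 1 show ?case by (simp add: wp_append wp_closed)
qed

lemma comm_equiv_wp:
  "comm_equiv G xs ys \<Longrightarrow> set xs \<subseteq> carrier G \<Longrightarrow> wp ys = wp xs"
  unfolding comm_equiv_def
proof (induction rule: rtranclp_induct)
  case (step ys zs)
  have "set ys \<subseteq> carrier G"
    using step comm_equiv_set[of G xs ys] by (simp add: comm_equiv_def)
  with step comm_step_wp show ?case by metis
qed simp

text \<open>Distinct commuting reflections fix each other's root, so swapping them leaves both tests
  unchanged.\<close>

lemma conc_word_comm_step:
  "comm_step G xs ys \<Longrightarrow> u \<in> carrier G \<Longrightarrow> set xs \<subseteq> T \<Longrightarrow> conc_word u xs \<Longrightarrow> conc_word u ys"
proof (induction rule: comm_step.induct)
  case (1 a b xs ys)
  have T: "a \<in> T" "b \<in> T" "set xs \<subseteq> T" using 1 by auto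
  then have xc: "wp xs \<in> carrier G" by (intro wp_closed) auto
  show ?case
  proof (cases "a = b")
    case True
    then show ?thesis using 1 by simp
  next
    case False
    define w where "w = u \<otimes> wp xs"
    have w: "w \<in> carrier G" using xc 1 by (simp add: w_def)
    have bil: "bil (proot a) (proot b) = 0" using commute_iff[OF T(1,2) False] 1(1) by simp
    have "act a (proot b) = proot b" "act b (proot a) = proot a"
      using T bil by (simp_all add: act_refl vref_def bil_sym[of "proot b"])
    moreover have "w \<otimes> a \<otimes> b = w \<otimes> b \<otimes> a" using 1(1) w T by (simp add: m_assoc)
    ultimately show ?thesis
      using 1(4) conc_word_append[OF 1(2) T(3)] w T by (auto simp: w_def[symmetric] act_mult)
  qed
qed

lemma conc_word_comm_equiv:
  "comm_equiv G xs ys \<Longrightarrow> u \<in> carrier G \<Longrightarrow> set xs \<subseteq> T \<Longrightarrow> conc_word u xs \<Longrightarrow> conc_word u ys"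
  unfolding comm_equiv_def
proof (induction rule: rtranclp_induct)
  case (step ys zs)
  have "set ys \<subseteq> T"
    using step comm_equiv_set[of G xs ys] by (simp add: comm_equiv_def)
  with step conc_word_comm_step show ?case by metis
qed simp

lemma inv_seq_append:
  assumes "set xs \<subseteq> S" "set ys \<subseteq> S"
  shows "inv_seq G (xs @ ys) = inv_seq G xs @ map (\<lambda>t. wp xs \<otimes> t \<otimes> inv (wp xs)) (inv_seq G ys)"
proof (rule nth_equalityI)
  fix i assume "i < length (inv_seq G (xs @ ys))"
  then have i: "i < length xs + length ys" by simp
  show "inv_seq G (xs @ ys) ! i = (inv_seq G xs @ map (\<lambda>t. wp xs \<otimes> t \<otimes> inv (wp xs)) (inv_seq G ys)) ! i"
  proof (cases "i < length xs")
    case True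
    then show ?thesis using i by (simp add: nth_append inv_seq_nth)
  next
    case False
    define j where "j = i - length xs"
    have j: "j < length ys" "i = length xs + j" using False i by (simp_all add: j_def)
    have c: "set (take j ys) \<subseteq> carrier G" "set xs \<subseteq> carrier G" "ys ! j \<in> carrier G"
      using assms set_take_subset[of j ys] j nth_mem[of j ys] simple_closed by blast+
    have "inv_seq G (xs @ ys) ! i
        = (wp xs \<otimes> wp (take j ys)) \<otimes> ys ! j \<otimes> inv (wp xs \<otimes> wp (take j ys))"
      using inv_seq_nth_conj[of "xs @ ys" i] assms j c by (simp add: nth_append wp_append)
    then show ?thesis
      using inv_seq_nth_conj[OF assms(2) j(1)] j c
      by (simp add: nth_append inv_mult_group m_assoc wp_closed)
  qed
qed simp

lemma inv_seq_pair:
  "a \<in> S \<Longrightarrow> b \<in> S \<Longrightarrow> a \<otimes> b = b \<otimes> a \<Longrightarrow> inv_seq G [a, b] = [a, b]"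
  by (simp add: inv_seq_def m_assoc) (simp add: m_assoc[symmetric] simple_involution)

text \<open>Swapping commuting letters swaps the two corresponding entries of the inversion
  sequence. All later entries are conjugated by the same product, since
  \<open>a \<otimes> b = b \<otimes> a\<close>.\<close>

lemma comm_step_inv_seq:
  "comm_step G ws ws' \<Longrightarrow> set ws \<subseteq> S \<Longrightarrow> comm_step G (inv_seq G ws) (inv_seq G ws')"
proof (induction rule: comm_step.induct)
  case (1 a b xs ys)
  have S: "a \<in> S" "b \<in> S" "set xs \<subseteq> S" "set ys \<subseteq> S" using 1 by auto
  define x where "x = wp xs"
  have x: "x \<in> carrier G" using S set_S_carrier by (auto simp: x_def)
  define g where "g = (\<lambda>t. x \<otimes> t \<otimes> inv x)"
  define k where "k = (\<lambda>t. (a \<otimes> b) \<otimes> t \<otimes> inv (a \<otimes> b))"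
  have p1: "inv_seq G ([a, b] @ ys) = [a, b] @ map k (inv_seq G ys)"
    using inv_seq_append[of "[a, b]" ys] S inv_seq_pair[OF S(1,2) 1(1)] by (simp add: k_def)
  have p2: "inv_seq G ([b, a] @ ys) = [b, a] @ map k (inv_seq G ys)"
    using inv_seq_append[of "[b, a]" ys] S inv_seq_pair[OF S(2,1) 1(1)[symmetric]] 1(1) by (simp add: k_def)
  have "inv_seq G (xs @ [a, b] @ ys) = inv_seq G xs @ [g a, g b] @ map g (map k (inv_seq G ys))"
    using inv_seq_append[OF S(3), of "[a, b] @ ys"] S unfolding p1 by (simp add: g_def x_def)
  moreover have "inv_seq G (xs @ [b, a] @ ys) = inv_seq G xs @ [g b, g a] @ map g (map k (inv_seq G ys))"
    using inv_seq_append[OF S(3), of "[b, a] @ ys"] S unfolding p2 by (simp add: g_def x_def)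
  moreover have "g a \<otimes> g b = g b \<otimes> g a"
  proof -
    have "g p \<otimes> g p' = x \<otimes> (p \<otimes> p') \<otimes> inv x" if "p \<in> carrier G" "p' \<in> carrier G" for p p'
    proof -
      have "inv x \<otimes> (x \<otimes> (p' \<otimes> inv x)) = p' \<otimes> inv x" using x that by (simp add: m_assoc[symmetric])
      then show ?thesis using x that by (simp add: g_def m_assoc)
    qed
    then show ?thesis using S 1(1) by simp
  qed
  ultimately show ?case by (metis comm_step.intros)
qed

lemma comm_equiv_inv_seq:
  "comm_equiv G ws ws' \<Longrightarrow> set ws \<subseteq> S \<Longrightarrow> comm_equiv G (inv_seq G ws) (inv_seq G ws')"
  unfolding comm_equiv_def
proof (induction rule: rtranclp_induct)
  case (step ys zs)
  have "set ys \<subseteq> S"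
    using step comm_equiv_set[of G ws ys] by (simp add: comm_equiv_def)
  with step comm_step_inv_seq[of ys zs] show ?case by (meson rtranclp.rtrancl_into_rtrancl)
qed simp

lemma comm_step_before:
  assumes "comm_step G L L'" "i < j" "j < length L" "L ! i \<otimes> L ! j \<noteq> L ! j \<otimes> L ! i"
  shows "\<exists>i' j'. i' < j' \<and> j' < length L' \<and> L' ! i' = L ! i \<and> L' ! j' = L ! j"
  using assms
proof (induction rule: comm_step.induct)
  case (1 a b xs ys)
  define n where "n = length xs"
  define sg where "sg = (\<lambda>k. if k = n then Suc n else if k = Suc n then n else k)"
  have nth: "(xs @ [b, a] @ ys) ! sg k = (xs @ [a, b] @ ys) ! k" if "k < length (xs @ [a, b] @ ys)" for k
    using that by (auto simp: sg_def n_def nth_append nth_Cons' less_Suc_eq)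
  have "\<not> (i = n \<and> j = Suc n)" using 1 by (auto simp: n_def nth_append)
  then have "sg i < sg j" "sg j < length (xs @ [b, a] @ ys)" using 1(2,3) by (auto simp: sg_def n_def)
  then show ?case using nth[of i] nth[of j] 1(2,3) by (intro exI[of _ "sg i"] exI[of _ "sg j"]) auto
qed

text \<open>Only commuting letters are ever swapped, so a noncommuting pair keeps its relative order
  throughout the commutation class.\<close>

lemma comm_equiv_before:
  assumes "comm_equiv G L L'" "i < j" "j < length L" "L ! i \<otimes> L ! j \<noteq> L ! j \<otimes> L ! i"
  shows "\<exists>i' j'. i' < j' \<and> j' < length L' \<and> L' ! i' = L ! i \<and> L' ! j' = L ! j"
  using assms(1) unfolding comm_equiv_def
proof (induction rule: rtranclp_induct)
  case (step L1 L2)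
  then obtain i' j' where "i' < j'" "j' < length L1" "L1 ! i' = L ! i" "L1 ! j' = L ! j" by blast
  with comm_step_before[OF step(2), of i' j'] assms(4) show ?case by metis
qed (use assms in blast)

lemma ex_T_word:
  assumes "w \<in> carrier G"
  obtains ts where "set ts \<subseteq> T" "wp ts = w" "length ts = len_T G S w"
proof -
  obtain ws where "set ws \<subseteq> S" "wp ws = w" using ex_S_word[OF assms] .
  then have "set ws \<subseteq> T" by auto
  from len_witness[OF this \<open>wp ws = w\<close>] that show ?thesis by blast
qed

lemma len_T_zero: assumes "w \<in> carrier G" shows "len_T G S w = 0 \<longleftrightarrow> w = \<one>"
proof
  assume "len_T G S w = 0"
  with ex_T_word[OF assms] show "w = \<one>" by (metis length_0_conv wp_Nil)
next
  assume "w = \<one>"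
  then show "len_T G S w = 0" using len_le[of "[]" T G] by simp
qed

lemma len_T_one: assumes "w \<in> carrier G" "len_T G S w = 1" shows "w \<in> T"
proof -
  obtain ts where ts: "set ts \<subseteq> T" "wp ts = w" "length ts = 1"
    using ex_T_word[OF assms(1)] assms(2) by metis
  then obtain t where "ts = [t]" by (auto simp: length_Suc_conv)
  then show ?thesis using ts by auto
qed

lemma len_T_T: assumes "t \<in> T" shows "len_T G S t = 1"
proof -
  have "len_T G S t \<le> 1" using len_le[of "[t]" T G] assms by simp
  moreover have "t \<noteq> \<one>"
  proof
    assume "t = \<one>"
    then have "proot t = (\<lambda>a. - proot t a)" using act_T_self[OF assms] by simp
    then show False using pos_asym[OF proot_Phi[OF assms]] assms pos_proot by metis
  qed
  then have "len_T G S t \<noteq> 0" using len_T_zero assms by auto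
  ultimately show ?thesis by simp
qed

lemma T_not_one: "t \<in> T \<Longrightarrow> t \<noteq> \<one>"
  using len_T_T len_T_zero[of \<one>] by fastforce

lemma len_T_mult_le:
  assumes "w \<in> carrier G" "v \<in> carrier G" shows "len_T G S (w \<otimes> v) \<le> len_T G S w + len_T G S v"
proof -
  obtain ws vs where *: "set ws \<subseteq> T" "wp ws = w" "length ws = len_T G S w"
    "set vs \<subseteq> T" "wp vs = v" "length vs = len_T G S v"
    using ex_T_word assms by metis
  then have "set ws \<subseteq> carrier G" "set vs \<subseteq> carrier G" by auto
  then show ?thesis using len_le[of "ws @ vs" T G] * by (simp add: wp_append)
qed

lemma bruhat_less:
  "(bruhat_cover G S)\<^sup>*\<^sup>* x y \<Longrightarrow> x = y \<or> len G S x < len G S y"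
  by (induction rule: rtranclp_induct) (auto simp: bruhat_cover_def)

text \<open>Each reflection adds a nonnegative multiple of a positive vector. The second conjunct is
  the invariant behind this: a vector obtuse to \<open>v\<close> and to all of \<open>xs\<close> is
  obtuse to the image.\<close>

lemma cone_pos:
  assumes "\<forall>x\<in>set xs. pos x \<and> bil x v \<le> 0" "pos v" "sorted_wrt (\<lambda>x y. bil x y \<le> 0) xs"
  shows "pos (R xs v) \<and> (\<forall>w. bil w v \<le> 0 \<longrightarrow> (\<forall>x\<in>set xs. bil w x \<le> 0) \<longrightarrow> bil w (R xs v) \<le> 0)"
  using assms
proof (induction xs)
  case (Cons x xs)
  define z where "z = R xs v"
  have IH: "pos z" "\<And>w. bil w v \<le> 0 \<Longrightarrow> (\<forall>x\<in>set xs. bil w x \<le> 0) \<Longrightarrow> bil w z \<le> 0"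
    using Cons by (auto simp: z_def)
  have xz: "bil x z \<le> 0" using Cons.prems by (intro IH(2)) auto
  have "pos (vref x z)" unfolding pos_def vref_def
  proof
    fix a
    have "z a \<ge> 0" "x a \<ge> 0" using IH(1) Cons.prems(1) by (auto simp: pos_def)
    then show "z a - bil x z * x a \<ge> 0" using mult_nonpos_nonneg[OF xz, of "x a"] by simp
  qed
  moreover have "bil w (vref x z) \<le> 0" if "bil w v \<le> 0" "\<forall>y\<in>set (x # xs). bil w y \<le> 0" for w
  proof -
    have "bil w z \<le> 0" using that by (intro IH(2)) auto
    moreover have "bil x z * bil w x \<ge> 0" using xz that by (intro mult_nonpos_nonpos) auto
    ultimately show ?thesis by (simp add: vref_def bil_diff2)
  qed
  ultimately show ?case by (simp add: z_def)
qed simp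

end

context cox_elt
begin

lemma card_S: "card S = r" using full distinct_cs distinct_card by metis

lemma cs_T: "set cs \<subseteq> T" using set_cs S_T by blast

lemma supp_T: "t \<in> T \<Longrightarrow> supp J (proot t)" using Phi_supp full by auto

lemma factors_T: "set ts \<subseteq> T \<Longrightarrow> wp ts = c \<Longrightarrow> factors (map proot ts)"
  by (rule factors_T_word) (auto intro: supp_T)

section \<open>Reduced T-words and maximal chains\<close>

definition twords :: "'a list set" where
  "twords = {ts. set ts \<subseteq> T \<and> wp ts = c \<and> length ts = r}"

lemma twordsD: "ts \<in> twords \<Longrightarrow> set ts \<subseteq> T \<and> wp ts = c \<and> length ts = r"
  by (simp add: twords_def)

lemma twords_comm_equiv: assumes "ts \<in> twords" "comm_equiv G ts ts'" shows "ts' \<in> twords"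
proof -
  have "set ts \<subseteq> carrier G" using assms by (auto simp: twords_def)
  then show ?thesis using assms comm_equiv_set[OF assms(2)] comm_equiv_wp[OF assms(2)]
    by (simp add: twords_def)
qed

lemma twords_E:
  assumes "ts \<in> twords" "i \<le> j" "j < r"
  shows "E (proot (ts ! i)) (proot (ts ! j)) = (if i = j then 1 else 0)"
  using factors_E[OF factors_T, of ts i j] assms by (auto simp: twords_def)

lemma twords_distinct: assumes "ts \<in> twords" shows "distinct ts"
proof -
  have "ts ! i \<noteq> ts ! j" if "i < j" "j < r" for i j
    using twords_E[OF assms, of i j] twords_E[OF assms, of i i] that by auto
  then show ?thesis using assms
    by (auto simp: distinct_conv_nth twords_def) (metis linorder_neqE_nat)
qed

lemma twords_bil:
  assumes "ts \<in> twords" "i < j" "j < r"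
  shows "bil (proot (ts ! i)) (proot (ts ! j)) = E (proot (ts ! j)) (proot (ts ! i))"
proof -
  have "ts ! i \<in> T" "ts ! j \<in> T" using assms twordsD[OF assms(1)] by auto
  then have "E (proot (ts ! i)) (proot (ts ! j)) + E (proot (ts ! j)) (proot (ts ! i))
      = bil (proot (ts ! i)) (proot (ts ! j))" by (intro E_sym supp_T)
  then show ?thesis using twords_E[OF assms(1), of i j] assms by simp
qed

lemma len_T_c: "len_T G S c = r"
proof (rule antisym)
  show "len_T G S c \<le> r" using len_le[OF cs_T, of G] by (simp add: c_def)
  obtain ts where ts: "set ts \<subseteq> T" "wp ts = c" "length ts = len_T G S c"
    using ex_T_word[OF c_carrier] .
  with factors_length[OF factors_T[OF ts(1,2)]] show "r \<le> len_T G S c" by simp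
qed

definition chain :: "'a list \<Rightarrow> 'a list" where
  "chain ts = map (\<lambda>i. wp (take i ts)) [0..<Suc (length ts)]"

lemma chain_nth: "i \<le> length ts \<Longrightarrow> chain ts ! i = wp (take i ts)"
  by (simp add: chain_def del: upt_Suc)

lemma length_chain [simp]: "length (chain ts) = Suc (length ts)" by (simp add: chain_def)

lemma take_T: "set ts \<subseteq> T \<Longrightarrow> wp (take i ts) \<in> carrier G"
  using set_take_subset[of i ts] by (intro wp_closed) blast

lemma wp_take_Suc:
  assumes "set ts \<subseteq> T" "i < length ts"
  shows "wp (take (Suc i) ts) = wp (take i ts) \<otimes> ts ! i"
proof -
  have "set (take i ts) \<subseteq> carrier G" "ts ! i \<in> carrier G"
    using assms set_take_subset[of i ts] nth_mem[OF assms(2)] by blast+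
  then show ?thesis using assms(2) by (simp add: take_Suc_conv_app_nth wp_append)
qed

lemma mult_wp_take_Suc:
  assumes "u \<in> carrier G" "set ts \<subseteq> T" "i < length ts"
  shows "u \<otimes> wp (take (Suc i) ts) = u \<otimes> wp (take i ts) \<otimes> ts ! i"
proof -
  have "ts ! i \<in> T" using assms nth_mem by blast
  then show ?thesis using wp_take_Suc[OF assms(2,3)] take_T[OF assms(2)] assms(1) by (simp add: m_assoc)
qed

lemma rw_chain: assumes "set ts \<subseteq> T" shows "rw G (chain ts) = ts"
proof (rule nth_equalityI)
  show "length (rw G (chain ts)) = length ts" by (simp add: rw_def)
  fix i assume "i < length (rw G (chain ts))"
  then have i: "i < length ts" by (simp add: rw_def)
  then have "rw G (chain ts) ! i = inv (wp (take i ts)) \<otimes> (wp (take i ts) \<otimes> ts ! i)"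
    using wp_take_Suc[OF assms i] by (simp add: rw_def chain_nth)
  also have "\<dots> = ts ! i"
    using take_T[OF assms, of i] assms nth_mem[OF i] by (simp add: m_assoc[symmetric] subset_iff)
  finally show "rw G (chain ts) ! i = ts ! i" .
qed

text \<open>Subadditivity on a prefix and its complement forces the prefix of length
  \<open>i\<close> to have reflection length exactly \<open>i\<close>; neighbours then differ by
  one, and nothing fits strictly between.\<close>

lemma chain_max: assumes "ts \<in> twords" shows "chain ts \<in> max_chains G S c"
proof -
  have ts: "set ts \<subseteq> T" "wp ts = c" "length ts = r" using twordsD[OF assms] by auto
  have lenT: "len_T G S (wp (take i ts)) = i" if "i \<le> r" for i
  proof (rule antisym)
    have sub: "set (take i ts) \<subseteq> T" "set (drop i ts) \<subseteq> T"
      using ts(1) set_take_subset[of i ts] set_drop_subset[of i ts] by blast+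
    show "len_T G S (wp (take i ts)) \<le> i" using len_le[OF sub(1), of G] ts(3) that by simp
    have cc: "set (take i ts) \<subseteq> carrier G" "set (drop i ts) \<subseteq> carrier G" using sub by auto
    then have "c = wp (take i ts) \<otimes> wp (drop i ts)"
      using ts(2) wp_append[OF cc] by simp
    then have "r \<le> len_T G S (wp (take i ts)) + (r - i)"
      using len_T_mult_le[of "wp (take i ts)" "wp (drop i ts)"] cc
        len_le[OF sub(2), of G] len_T_c ts(3) by (fastforce simp: wp_closed)
    then show "i \<le> len_T G S (wp (take i ts))" using that by simp
  qed
  have "abs_cover G S (chain ts ! i) (chain ts ! Suc i)" if i: "i < r" for i
  proof -
    define u v where uv: "u = wp (take i ts)" "v = wp (take (Suc i) ts)"
    have u: "u \<in> carrier G" "v \<in> carrier G" using take_T[OF ts(1)] by (simp_all add: uv)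
    have tT: "ts ! i \<in> T" using ts i by auto
    have v: "v = u \<otimes> ts ! i" using wp_take_Suc[OF ts(1)] i ts(3) by (simp add: uv)
    have iv: "inv u \<otimes> v = ts ! i" using u tT by (simp add: v m_assoc[symmetric])
    have l: "len_T G S u = i" "len_T G S v = Suc i" using lenT i by (simp_all add: uv)
    have "abs_le G S u v" using u l iv len_T_T[OF tT] by (simp add: abs_le_def)
    moreover have "u \<noteq> v" using l by auto
    moreover have "x = u \<or> x = v" if x: "abs_le G S u x" "abs_le G S x v" for x
    proof -
      have xc: "x \<in> carrier G" using x by (simp add: abs_le_def)
      have "len_T G S (inv u \<otimes> x) + len_T G S (inv x \<otimes> v) = 1" using x l by (simp add: abs_le_def)
      then have "len_T G S (inv u \<otimes> x) = 0 \<or> len_T G S (inv x \<otimes> v) = 0" by auto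
      then have "inv u \<otimes> x = \<one> \<or> inv x \<otimes> v = \<one>" using len_T_zero u xc by simp
      then show ?thesis using u xc by (metis inv_closed inv_equality inv_inv)
    qed
    ultimately show ?thesis using i ts(3) by (auto simp: abs_cover_def chain_nth uv[symmetric])
  qed
  then show ?thesis using ts by (auto simp: max_chains_def card_S chain_nth)
qed

text \<open>The \<open>r\<close> nontrivial steps have reflection lengths adding up to
  \<open>len_T G S c = r\<close>, so each step is a reflection.\<close>

lemma max_chainD:
  assumes "p \<in> max_chains G S c"
  shows "rw G p \<in> twords" "p = chain (rw G p)"
proof -
  have p: "length p = Suc r" "p ! 0 = \<one>" "p ! r = c" "\<And>i. i < r \<Longrightarrow> abs_cover G S (p ! i) (p ! Suc i)"
    using assms by (auto simp: max_chains_def card_S)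
  define ts where "ts = rw G p"
  have lts: "length ts = r" using p(1) by (simp add: ts_def rw_def)
  have tsi: "ts ! i = inv (p ! i) \<otimes> p ! Suc i" if "i < r" for i using that p(1) by (simp add: ts_def rw_def)
  have ab: "p ! i \<in> carrier G" "p ! Suc i \<in> carrier G" "p ! i \<noteq> p ! Suc i"
    "len_T G S (p ! Suc i) = len_T G S (p ! i) + len_T G S (ts ! i)" if "i < r" for i
    using p(4)[OF that] tsi[OF that] by (auto simp: abs_cover_def abs_le_def)
  have tc: "ts ! i \<in> carrier G" if "i < r" for i using ab[OF that] tsi[OF that] by simp
  have ge1: "len_T G S (ts ! i) \<ge> 1" if "i < r" for i
  proof -
    have "ts ! i \<noteq> \<one>"
      using tsi[OF that] ab[OF that] by (metis inv_closed inv_equality inv_inv)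
    then show ?thesis using len_T_zero[OF tc[OF that]] by simp
  qed
  have sum: "len_T G S (p ! i) = (\<Sum>k<i. len_T G S (ts ! k))" if "i \<le> r" for i
    using that
  proof (induction i)
    case 0
    then show ?case using p(2) len_T_zero[of \<one>] by simp
  next
    case (Suc i)
    then show ?case using ab(4)[of i] by simp
  qed
  have "(\<Sum>k<r. len_T G S (ts ! k)) = r" using sum[of r] p(3) len_T_c by simp
  then have tot: "(\<Sum>k<r. len_T G S (ts ! k)) = (\<Sum>k<r. 1)" by simp
  have eq1: "len_T G S (ts ! i) = 1" if "i < r" for i
  proof (rule ccontr)
    assume "len_T G S (ts ! i) \<noteq> 1"
    then have "1 < len_T G S (ts ! i)" using ge1[OF that] by simp
    then have "(\<Sum>k<r. 1) < (\<Sum>k<r. len_T G S (ts ! k))"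
      using ge1 that by (intro sum_strict_mono_ex1) auto
    then show False using tot by simp
  qed
  have "ts ! i \<in> T" if "i < r" for i using len_T_one[OF tc[OF that] eq1[OF that]] .
  then have T: "set ts \<subseteq> T" using lts by (auto simp: in_set_conv_nth)
  have pre: "p ! i = wp (take i ts)" if "i \<le> r" for i using that
  proof (induction i)
    case 0
    then show ?case using p(2) by simp
  next
    case (Suc i)
    then have i: "i < r" by simp
    have "p ! Suc i = p ! i \<otimes> ts ! i" using tsi[OF i] ab(1,2)[OF i] by (simp add: m_assoc[symmetric])
    then show ?case using Suc wp_take_Suc[OF T] lts by simp
  qed
  have "wp ts = c" using pre[of r] p(3) lts by simp
  then show "rw G p \<in> twords" using T lts by (simp add: twords_def ts_def)
  have "p = chain ts" by (rule nth_equalityI) (use p(1) lts pre chain_nth in auto)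
  then show "p = chain (rw G p)" by (simp add: ts_def)
qed

lemma comm_class_eqI:
  assumes "comm_equiv G (rw G p) (rw G p')" shows "comm_class G S c p = comm_class G S c p'"
  using assms by (auto simp: comm_class_def intro: comm_equiv_trans comm_equiv_sym)

lemma comm_class_self: "p \<in> max_chains G S c \<Longrightarrow> p \<in> comm_class G S c p"
  by (simp add: comm_class_def)

lemma concordant_if_covers:
  assumes "u \<in> carrier G" "ts \<in> twords"
    "\<And>i. i < r \<Longrightarrow> len G S (u \<otimes> wp (take (Suc i) ts)) = len G S (u \<otimes> wp (take i ts)) + 1"
  shows "concordant G S u (chain ts)"
proof -
  have ts: "set ts \<subseteq> T" "length ts = r" using twordsD[OF assms(2)] by auto
  have "bruhat_le G S (u \<otimes> chain ts ! i) (u \<otimes> chain ts ! Suc i)" if i: "i < r" for i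
  proof -
    have w: "wp (take i ts) \<in> carrier G" "wp (take (Suc i) ts) \<in> carrier G"
      using take_T[OF ts(1)] by auto
    have tT: "ts ! i \<in> T" using ts i by auto
    have "u \<otimes> wp (take (Suc i) ts) = u \<otimes> wp (take i ts) \<otimes> ts ! i"
      using mult_wp_take_Suc[OF assms(1) ts(1)] i ts(2) by simp
    then have "bruhat_cover G S (u \<otimes> wp (take i ts)) (u \<otimes> wp (take (Suc i) ts))"
      unfolding bruhat_cover_def using assms(1) w tT assms(3)[OF i] by auto
    then show ?thesis using i ts(2) w assms(1) by (auto simp: bruhat_le_def chain_nth)
  qed
  then show ?thesis by (simp add: concordant_def card_S)
qed

text \<open>A Bruhat relation between distinct elements raises the length. Conversely,
  \<open>r\<close> strict increases of total \<open>r\<close>, the total fixed by \<open>u\<close>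
  lying in \<open>W_plus\<close>, are increases by one, that is, covers.\<close>

lemma concordant_iff:
  assumes u: "u \<in> W_plus G S c" and ts: "ts \<in> twords"
  shows "concordant G S u (chain ts) \<longleftrightarrow> conc_word u ts"
proof -
  have uc: "u \<in> carrier G" "len G S (u \<otimes> c) = len G S u + r" using u by (auto simp: W_plus_def card_S)
  have t: "set ts \<subseteq> T" "length ts = r" "wp ts = c" using twordsD[OF ts] by auto
  define g where "g = (\<lambda>i. len G S (u \<otimes> wp (take i ts)))"
  have e: "u \<otimes> wp (take (Suc i) ts) = u \<otimes> wp (take i ts) \<otimes> ts ! i" if "i < r" for i
    using mult_wp_take_Suc[OF uc(1) t(1)] that t(2) by simp
  have step: "g i < g (Suc i) \<longleftrightarrow> pos (act (u \<otimes> wp (take i ts)) (proot (ts ! i)))" if i: "i < r" for i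
  proof -
    have tT: "ts ! i \<in> T" using t i by auto
    have w: "wp (take i ts) \<in> carrier G" using take_T[OF t(1)] .
    show ?thesis unfolding g_def e[OF i] using len_refl_iff[of "u \<otimes> wp (take i ts)" "ts ! i"] uc w tT by simp
  qed
  have iff: "conc_word u ts \<longleftrightarrow> (\<forall>i<r. g i < g (Suc i))" using conc_word_iff[OF uc(1) t(1)] step t(2) by simp
  show ?thesis
  proof
    assume co: "concordant G S u (chain ts)"
    have "g i < g (Suc i)" if i: "i < r" for i
    proof -
      have tT: "ts ! i \<in> T" using t i by auto
      have w: "wp (take i ts) \<in> carrier G" using take_T[OF t(1)] .
      have "(bruhat_cover G S)\<^sup>*\<^sup>* (u \<otimes> wp (take i ts)) (u \<otimes> wp (take (Suc i) ts))"
        using co i t(2) by (simp add: concordant_def card_S bruhat_le_def chain_nth)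
      from bruhat_less[OF this] have "ts ! i = \<one> \<or> g i < g (Suc i)"
        unfolding g_def e[OF i] using uc w tT r_cancel_one'[of "u \<otimes> wp (take i ts)" "ts ! i"] by auto
      then show ?thesis using T_not_one[OF tT] by simp
    qed
    then show "conc_word u ts" using iff by simp
  next
    assume "conc_word u ts"
    then have inc: "g i < g (Suc i)" if "i < r" for i using iff that by simp
    have g0: "g 0 = len G S u" using uc by (simp add: g_def)
    have gr: "g r = len G S u + r" using uc t by (simp add: g_def)
    have "g (Suc i) = g i + 1" if "i < r" for i
      by (rule unit_steps[of r]) (use inc g0 gr that in \<open>auto simp: Suc_le_eq\<close>)
    then show "concordant G S u (chain ts)"
      using concordant_if_covers[OF uc(1) ts] by (simp add: g_def)
  qed
qed

section \<open>The total order on reflections and sorted representatives of classes\<close>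

definition idx :: "'a \<Rightarrow> int" where "idx t = int (the_inv_into {..<length refl_seq} ((!) refl_seq) t)"

lemma idx_refl_seq: "i < length refl_seq \<Longrightarrow> idx (refl_seq ! i) = int i"
  unfolding idx_def using the_inv_into_f_f[of "(!) refl_seq" "{..<length refl_seq}" i] distinct_refl_seq
  by (simp add: inj_on_nth)

lemma ex_refl_seq: assumes "t \<in> T" obtains i where "i < length refl_seq" "refl_seq ! i = t"
  using assms set_refl_seq by (metis in_set_conv_nth)

lemma idx_inj: "t \<in> T \<Longrightarrow> t' \<in> T \<Longrightarrow> idx t = idx t' \<Longrightarrow> t = t'"
  by (metis ex_refl_seq idx_refl_seq int_int_eq)

lemma E_idx:
  assumes "t \<in> T" "t' \<in> T" "idx t < idx t'"
  shows "E (proot t) (proot t') \<ge> 0" "E (proot t') (proot t) \<le> 0"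
proof -
  obtain i j where "i < length refl_seq" "refl_seq ! i = t" "j < length refl_seq" "refl_seq ! j = t'" using assms ex_refl_seq by metis
  then show "E (proot t) (proot t') \<ge> 0" "E (proot t') (proot t) \<le> 0"
    using E_refl_seq[of i j] idx_refl_seq assms(3) by auto
qed

lemma refl_le_idx: assumes "refl_le G S cs t t'" shows "idx t \<le> idx t'"
proof -
  have "\<exists>i j. i \<le> j \<and> j < length (map pl live_pos) \<and> inv_seq G (map pl live_pos) ! i = t \<and> inv_seq G (map pl live_pos) ! j = t'"
    using assms comm_equiv_refl unfolding refl_le_def sorting_word_eq by blast
  then obtain i j where "i \<le> j" "j < length refl_seq" "refl_seq ! i = t" "refl_seq ! j = t'"
    by (auto simp: refl_seq_def)
  then show ?thesis using idx_refl_seq[of i] idx_refl_seq[of j] by simp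
qed

text \<open>A noncommuting pair keeps its order in the inversion sequence of every word of the
  class, so it is comparable.\<close>

lemma refl_le_or_commute:
  assumes "t \<in> T" "t' \<in> T" "idx t < idx t'" "\<not> refl_le G S cs t t'" shows "t \<otimes> t' = t' \<otimes> t"
proof (rule ccontr)
  assume nc: "t \<otimes> t' \<noteq> t' \<otimes> t"
  obtain i j where ij: "i < length refl_seq" "refl_seq ! i = t" "j < length refl_seq" "refl_seq ! j = t'" using assms ex_refl_seq by metis
  then have "i < j" using assms(3) idx_refl_seq by auto
  from assms(4) obtain ws where ws: "comm_equiv G (map pl live_pos) ws"
    "\<not> (\<exists>i j. i \<le> j \<and> j < length ws \<and> inv_seq G ws ! i = t \<and> inv_seq G ws ! j = t')"
    unfolding refl_le_def sorting_word_eq by blast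
  have "comm_equiv G refl_seq (inv_seq G ws)" unfolding refl_seq_def by (rule comm_equiv_inv_seq[OF ws(1) live_pos_word_S])
  from comm_equiv_before[OF this \<open>i < j\<close> ij(3)] nc ij obtain i' j' where
    "i' < j'" "j' < length (inv_seq G ws)" "inv_seq G ws ! i' = t" "inv_seq G ws ! j' = t'" by auto
  then show False using ws(2) by (metis length_inv_seq less_imp_le)
qed

text \<open>
  Words sorted for the total order of \<open>refl_seq\<close> represent the classes that are monotone for the partial
  order, because reflections incomparable in the latter commute.
\<close>

lemma twords_sort:
  fixes g :: "'a \<Rightarrow> int"
  assumes "inj_on g T" "ts \<in> twords" "sorted_wrt (\<lambda>a b. g b < g a \<longrightarrow> a \<otimes> b = b \<otimes> a) ts"
  shows "\<exists>ts'. comm_equiv G ts ts' \<and> ts' \<in> twords \<and> sorted_wrt (\<lambda>a b. g a < g b) ts'"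
proof -
  from comm_sort[OF assms(3)] obtain ts' where
    ts': "comm_equiv G ts ts'" "sorted_wrt (\<lambda>a b. g a \<le> g b) ts'" by blast
  have tw: "ts' \<in> twords" using twords_comm_equiv[OF assms(2) ts'(1)] .
  have "sorted_wrt (\<lambda>a b. g a < g b) ts'"
    unfolding sorted_wrt_iff_nth_less
  proof (intro allI impI)
    fix i j assume ij: "i < j" "j < length ts'"
    have "g (ts' ! i) \<le> g (ts' ! j)" using sorted_wrt_nth_less[OF ts'(2) ij] .
    moreover have "ts' ! i \<noteq> ts' ! j" using twords_distinct[OF tw] ij by (simp add: nth_eq_iff_index_eq)
    moreover have "ts' ! i \<in> T" "ts' ! j \<in> T" using twordsD[OF tw] ij by auto
    ultimately show "g (ts' ! i) < g (ts' ! j)" using assms(1) by (metis inj_onD order_le_less)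
  qed
  then show ?thesis using ts'(1) tw by blast
qed

lemma increasing_sort:
  assumes "ts \<in> twords" "sorted_wrt (\<lambda>a b. idx b < idx a \<longrightarrow> a \<otimes> b = b \<otimes> a) ts"
  shows "\<exists>ts'. comm_equiv G ts ts' \<and> ts' \<in> twords \<and> sorted_wrt (\<lambda>a b. idx a < idx b) ts'"
  using twords_sort[of idx ts] assms idx_inj by (auto simp: inj_on_def)

text \<open>Sorting by \<open>- idx\<close>; for this \<open>idx\<close> takes integer
  values.\<close>

lemma decreasing_sort:
  assumes "ts \<in> twords" "sorted_wrt (\<lambda>a b. idx a < idx b \<longrightarrow> a \<otimes> b = b \<otimes> a) ts"
  shows "\<exists>ts'. comm_equiv G ts ts' \<and> ts' \<in> twords \<and> sorted_wrt (\<lambda>a b. idx b < idx a) ts'"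
  using twords_sort[of "\<lambda>t. - idx t" ts] assms idx_inj by (auto simp: inj_on_def)

lemma decreasing_chain_sort:
  assumes "p \<in> max_chains G S c" "decreasing_chain G S cs p"
  shows "\<exists>ts'. comm_equiv G (rw G p) ts' \<and> ts' \<in> twords \<and> sorted_wrt (\<lambda>a b. idx b < idx a) ts'"
proof (rule decreasing_sort)
  show tw: "rw G p \<in> twords" using max_chainD(1)[OF assms(1)] .
  then have "rw G p ! i \<in> T" if "i < length (rw G p)" for i using twordsD[OF tw] that nth_mem by blast
  then show "sorted_wrt (\<lambda>a b. idx a < idx b \<longrightarrow> a \<otimes> b = b \<otimes> a) (rw G p)"
    using assms(2) refl_le_or_commute
    unfolding sorted_wrt_iff_nth_less decreasing_chain_def by (meson less_trans)
qed

lemma increasing_chain_sort: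
  assumes "p \<in> max_chains G S c" "increasing_chain G S cs p"
  shows "\<exists>ts'. comm_equiv G (rw G p) ts' \<and> ts' \<in> twords \<and> sorted_wrt (\<lambda>a b. idx a < idx b) ts'"
proof (rule increasing_sort)
  show tw: "rw G p \<in> twords" using max_chainD(1)[OF assms(1)] .
  then have "rw G p ! i \<in> T" if "i < length (rw G p)" for i using twordsD[OF tw] that nth_mem by blast
  then show "sorted_wrt (\<lambda>a b. idx b < idx a \<longrightarrow> a \<otimes> b = b \<otimes> a) (rw G p)"
    using assms(2) refl_le_or_commute
    unfolding sorted_wrt_iff_nth_less increasing_chain_def by (metis less_trans)
qed

lemma decreasing_chain_chain:
  assumes "ts \<in> twords" "sorted_wrt (\<lambda>a b. idx b < idx a) ts" shows "decreasing_chain G S cs (chain ts)"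
proof -
  have "rw G (chain ts) = ts" using rw_chain twordsD[OF assms(1)] by blast
  then show ?thesis using refl_le_idx sorted_wrt_nth_less[OF assms(2)]
    unfolding decreasing_chain_def by fastforce
qed

lemma increasing_chain_chain:
  assumes "ts \<in> twords" "sorted_wrt (\<lambda>a b. idx a < idx b) ts" shows "increasing_chain G S cs (chain ts)"
proof -
  have "rw G (chain ts) = ts" using rw_chain twordsD[OF assms(1)] by blast
  then show ?thesis using refl_le_idx sorted_wrt_nth_less[OF assms(2)]
    unfolding increasing_chain_def by fastforce
qed

text \<open>
  Obtuseness makes each \<open>\<gamma>\<^sub>i\<close> a positive root with \<open>c\<inverse> \<gamma>\<^sub>i\<close> negative, hence one of the \<open>PP n\<close>; dually,
  the roots of the word are the simple roots.
\<close>

lemma increasing_simple: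
  assumes tw: "ts \<in> twords" and inc: "sorted_wrt (\<lambda>a b. idx a < idx b) ts"
  shows "set ts = S"
proof -
  have ts: "set ts \<subseteq> T" "wp ts = c" "length ts = r" using twordsD[OF tw] by auto
  define bs where "bs = map proot ts"
  have lb: "length bs = r" using ts by (simp add: bs_def)
  have fac: "factors bs" unfolding bs_def by (rule factors_T[OF ts(1,2)])
  have norm: "\<forall>b\<in>set bs. bil b b = 2" using ts(1) by (auto simp: bs_def)
  have bpos: "pos (bs ! i)" if "i < r" for i
  proof -
    have "ts ! i \<in> T" using that ts(1,3) nth_mem[of i ts] by auto
    then show ?thesis using that ts(3) by (simp add: bs_def)
  qed
  have neg: "bil (bs ! i) (bs ! j) \<le> 0" if "i < j" "j < r" for i j
  proof -
    have "ts ! i \<in> T" "ts ! j \<in> T" using that ts by auto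
    moreover have "idx (ts ! i) < idx (ts ! j)" using sorted_wrt_nth_less[OF inc] that ts(3) by simp
    ultimately have "E (proot (ts ! j)) (proot (ts ! i)) \<le> 0" by (rule E_idx)
    then show ?thesis using twords_bil[OF tw that] that ts(3) by (simp add: bs_def)
  qed
  have gP: "gam bs i \<in> Phi" if "i < r" for i unfolding bs_def using gam_Phi[OF ts(1)] that ts(3) by simp
  have ex: "\<exists>n<r. gam bs i = PP n" if i: "i < r" for i
  proof (rule q_neg_PP[OF gP[OF i]])
    have "pos (R (take i bs) (bs ! i))"
    proof (rule cone_pos[THEN conjunct1])
      show "\<forall>x\<in>set (take i bs). pos x \<and> bil x (bs ! i) \<le> 0"
        using i lb neg bpos by (auto simp: in_set_conv_nth)
      show "sorted_wrt (\<lambda>x y. bil x y \<le> 0) (take i bs)"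
        using i lb neg by (auto simp: sorted_wrt_iff_nth_less)
    qed (rule bpos[OF i])
    then show "pos (gam bs i)" by (simp add: gam_def)
    have split: "bs = take i bs @ [bs ! i] @ drop (Suc i) bs"
      using i lb by (simp add: id_take_nth_drop[symmetric])
    have rv: "rev bs = rev (drop (Suc i) bs) @ [bs ! i] @ rev (take i bs)"
      using arg_cong[OF split, of rev] by simp
    have nt: "\<forall>b\<in>set (take i bs). bil b b = 2" using norm set_take_subset[of i bs] by blast
    have ni: "bil (bs ! i) (bs ! i) = 2" using norm i lb by simp
    \<comment> \<open>The prefix cancels, the reflection at \<open>i\<close> negates its own root,
      and the suffix, again obtuse, keeps that root inside the positive cone.\<close>
    have "q (gam bs i) = R (rev bs) (gam bs i)" using fac by (simp add: factors_def)
    also have "\<dots> = R (rev (drop (Suc i) bs)) (vref (bs ! i) (R (rev (take i bs)) (R (take i bs) (bs ! i))))"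
      unfolding rv gam_def by (simp add: R_append)
    also have "\<dots> = (\<lambda>a. - R (rev (drop (Suc i) bs)) (bs ! i) a)"
      by (simp add: R_rev_R[OF nt] vref_self[OF ni] lin_uminus[OF lin_R])
    finally have qg: "q (gam bs i) = (\<lambda>a. - R (rev (drop (Suc i) bs)) (bs ! i) a)" .
    have "pos (R (rev (drop (Suc i) bs)) (bs ! i))"
    proof (rule cone_pos[THEN conjunct1])
      have "bil x (bs ! i) \<le> 0 \<and> pos x" if "x \<in> set (drop (Suc i) bs)" for x
      proof -
        from that obtain k where k: "k < r - Suc i" "x = bs ! (Suc i + k)" using lb i
          by (auto simp: in_set_conv_nth)
        then show ?thesis using neg[of i "Suc i + k"] bpos[of "Suc i + k"] i
          by (auto simp: bil_sym[of "bs ! Suc (i + k)"])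
      qed
      then show "\<forall>x\<in>set (rev (drop (Suc i) bs)). pos x \<and> bil x (bs ! i) \<le> 0" by auto
      have "sorted_wrt (\<lambda>x y. bil y x \<le> 0) (drop (Suc i) bs)"
        unfolding sorted_wrt_iff_nth_less
      proof (intro allI impI)
        fix k l assume "k < l" "l < length (drop (Suc i) bs)"
        then show "bil (drop (Suc i) bs ! l) (drop (Suc i) bs ! k) \<le> 0"
          using neg[of "Suc i + k" "Suc i + l"] lb by (simp add: bil_sym)
      qed
      then show "sorted_wrt (\<lambda>x y. bil x y \<le> 0) (rev (drop (Suc i) bs))"
        by (simp add: sorted_wrt_rev)
    qed (rule bpos[OF i])
    then have "pos (\<lambda>a. - q (gam bs i) a)" by (simp add: qg)
    then show "\<not> pos (q (gam bs i))" using pos_asym[OF q_Phi[OF gP[OF i]]] by blast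
  qed
  then obtain sg where sg: "\<And>i. i < r \<Longrightarrow> sg i < r \<and> gam bs i = PP (sg i)" by metis
  \<comment> \<open>Pairing with \<open>gam bs i = PP (sg i)\<close> reads off a coordinate, so the
    duality of \<open>gam\<close> and \<open>bs\<close> says that the roots of the word are simple
    roots permuted by \<open>sg\<close>.\<close>
  have coord: "(bs ! j) (cs ! sg i) = (if i = j then 1 else 0)" if "i < r" "j < r" for i j
  proof -
    have "supp J (bs ! j)" using that(2) lb fac nth_mem[of j bs] by (simp add: factors_def)
    then have "(bs ! j) (cs ! sg i) = E (gam bs i) (bs ! j)" using E_PP[of "bs ! j" "sg i"] sg[OF that(1)] by simp
    then show ?thesis using factors_dual[OF fac lb that] by simp
  qed
  have "inj_on sg {..<r}"
  proof (rule inj_onI)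
    fix i j assume ij: "i \<in> {..<r}" "j \<in> {..<r}" and e: "sg i = sg j"
    have "(bs ! i) (cs ! sg j) = 1" using coord[of i i] ij unfolding e[symmetric] by simp
    moreover have "(bs ! i) (cs ! sg j) = (if j = i then 1 else 0)" using coord[of j i] ij by simp
    ultimately show "i = j" by (metis zero_neq_one)
  qed
  moreover have "sg ` {..<r} \<subseteq> {..<r}" using sg by auto
  ultimately have surj: "sg ` {..<r} = {..<r}" by (intro endo_inj_surj) auto
  have "ts ! j \<in> S" if j: "j < r" for j
  proof -
    have "bs ! j = sroot (cs ! sg j)"
    proof
      fix a
      show "(bs ! j) a = sroot (cs ! sg j) a"
      proof (cases "a \<in> J")
        case True
        then obtain n where n: "n < r" "a = cs ! n" by (auto simp: in_set_conv_nth)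
        then obtain i where i: "i < r" "sg i = n" using surj by (metis imageE lessThan_iff)
        have "sroot (cs ! sg j) a = (if i = j then 1 else 0)"
          using i n sg[OF j] \<open>inj_on sg {..<r}\<close> j distinct_cs
          by (auto simp: sroot_def nth_eq_iff_index_eq inj_on_def)
        then show ?thesis using coord[OF i(1) j] i n by simp
      next
        case False
        have "supp J (bs ! j)" using j lb fac nth_mem[of j bs] by (simp add: factors_def)
        moreover have "a \<noteq> cs ! sg j" using False sg[OF j] by auto
        ultimately show ?thesis using False by (simp add: supp_def sroot_def)
      qed
    qed
    then have "proot (ts ! j) = proot (cs ! sg j)" using j ts(3) sg[OF j] by (simp add: bs_def)
    moreover have "ts ! j \<in> T" using j ts by auto
    ultimately have "ts ! j = cs ! sg j" using proot_inj[of "ts ! j" "cs ! sg j"] sg[OF j] by auto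
    then show ?thesis using sg[OF j] by simp
  qed
  then have "set ts \<subseteq> S" using ts(3) by (auto simp: in_set_conv_nth)
  moreover have "card (set ts) = card S" using twords_distinct[OF tw] ts(3) card_S by (simp add: distinct_card)
  ultimately show ?thesis by (intro card_subset_eq) auto
qed

section \<open>The increasing class and the uniqueness of the decreasing class\<close>

lemma cs_twords: "cs \<in> twords" using cs_T by (simp add: twords_def c_def)

text \<open>For letters of \<open>cs\<close> in the wrong order the sign of \<open>E\<close> makes
  the pairing nonnegative. Simple roots are obtuse, so the pairing is zero, the letters commute, and
  \<open>cs\<close> can be sorted.\<close>

lemma ex_increasing:
  "\<exists>ts. comm_equiv G cs ts \<and> ts \<in> twords \<and> sorted_wrt (\<lambda>a b. idx a < idx b) ts"
proof (rule increasing_sort[OF cs_twords])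
  show "sorted_wrt (\<lambda>a b. idx b < idx a \<longrightarrow> a \<otimes> b = b \<otimes> a) cs"
    unfolding sorted_wrt_iff_nth_less
  proof (intro allI impI)
    fix i j assume ij: "i < j" "j < r" "idx (cs ! j) < idx (cs ! i)"
    have S: "cs ! i \<in> S" "cs ! j \<in> S" using ij by auto
    have ne: "cs ! i \<noteq> cs ! j" using ij distinct_cs by (simp add: nth_eq_iff_index_eq)
    have "E (proot (cs ! j)) (proot (cs ! i)) \<ge> 0" using E_idx(1)[OF _ _ ij(3)] S by auto
    then have "bil (proot (cs ! i)) (proot (cs ! j)) \<ge> 0" using twords_bil[OF cs_twords ij(1,2)] by simp
    moreover have "bil (proot (cs ! i)) (proot (cs ! j)) \<le> 0"
      using S ne by (simp add: bil_sroot_sroot cox_coeff_nonpos)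
    ultimately show "cs ! i \<otimes> cs ! j = cs ! j \<otimes> cs ! i"
      using commute_iff[of "cs ! i" "cs ! j"] S ne by auto
  qed
qed

text \<open>Simple letters raise the length by at most one each, while the total is
  \<open>r\<close>, so every step is a cover.\<close>

lemma increasing_concordant:
  assumes u: "u \<in> W_plus G S c" and ts: "ts \<in> twords" "set ts = S"
  shows "concordant G S u (chain ts)"
proof (rule concordant_if_covers)
  have uc: "len G S (u \<otimes> c) = len G S u + r" "u \<in> carrier G" using u by (auto simp: W_plus_def card_S)
  then show "u \<in> carrier G" by simp
  have t: "set ts \<subseteq> T" "length ts = r" "wp ts = c" using twordsD[OF ts(1)] by auto
  define g where "g = (\<lambda>i. len G S (u \<otimes> wp (take i ts)))"
  have up: "g (Suc i) \<le> g i + 1" if "i < r" for i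
  proof -
    have w: "wp (take i ts) \<in> carrier G" using take_T[OF t(1)] .
    have s: "ts ! i \<in> S" using nth_mem[of i ts] that unfolding ts(2) t(2) by simp
    have "u \<otimes> wp (take (Suc i) ts) = u \<otimes> wp (take i ts) \<otimes> ts ! i"
      using mult_wp_take_Suc[OF uc(2) t(1)] that t(2) by simp
    then show ?thesis unfolding g_def using len_mult_simple_le[of "u \<otimes> wp (take i ts)" "ts ! i"] uc w s by simp
  qed
  have g0: "g 0 = len G S u" and gr: "g r = len G S u + r" using uc t by (simp_all add: g_def)
  have "g (Suc i) = g i + 1" if "i < r" for i
    by (rule unit_steps[of r]) (use up g0 gr that in auto)
  then show "len G S (u \<otimes> wp (take (Suc i) ts)) = len G S (u \<otimes> wp (take i ts)) + 1"
    if "i < r" for i using that by (simp add: g_def)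
qed (rule ts(1))

text \<open>Uniqueness of the increasing class is obtained here as well: sorted increasing words all
  have the letter set \<open>S\<close>, and a strictly sorted word is determined by its
  letters.\<close>

theorem increasing_in_Class:
  assumes u: "u \<in> W_plus G S c" shows "increasing_class G S c cs \<in> Class G S c u"
proof -
  from ex_increasing obtain ts where ts: "ts \<in> twords" "sorted_wrt (\<lambda>a b. idx a < idx b) ts" by blast
  have S: "set ts = S" by (rule increasing_simple[OF ts])
  have rwc: "rw G (chain ts) = ts" using rw_chain twordsD[OF ts(1)] by blast
  have "increasing_class G S c cs = comm_class G S c (chain ts)"
    unfolding increasing_class_def
  proof (rule the_equality)
    show "is_increasing_class G S c cs (comm_class G S c (chain ts))"
      using chain_max[OF ts(1)] increasing_chain_chain[OF ts] by (auto simp: is_increasing_class_def)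
  next
    fix C assume "is_increasing_class G S c cs C"
    then obtain p where p: "p \<in> max_chains G S c" "C = comm_class G S c p" "increasing_chain G S cs p"
      by (auto simp: is_increasing_class_def)
    from increasing_chain_sort[OF p(1,3)] obtain ts' where
      ts': "comm_equiv G (rw G p) ts'" "ts' \<in> twords" "sorted_wrt (\<lambda>a b. idx a < idx b) ts'" by blast
    have "ts' = ts"
      using strictly_sorted_unique[OF ts'(3) ts(2)] increasing_simple[OF ts'(2,3)] S by simp
    then show "C = comm_class G S c (chain ts)"
      using p(2) ts'(1) rwc by (simp add: comm_class_eqI)
  qed
  then show ?thesis
    using chain_max[OF ts(1)] increasing_concordant[OF u ts(1) S] by (auto simp: Class_def)
qed

text \<open>Phrased for lists with triangular \<open>E\<close> and not for words of c, because the
  induction strips the common head from both lists and the tails no longer multiply to c.\<close>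

lemma unique_expansion:
  assumes "set xs \<subseteq> T" "set ys \<subseteq> T"
    and "sorted_wrt (\<lambda>a b. idx b < idx a) xs" "sorted_wrt (\<lambda>a b. idx b < idx a) ys"
    and "sorted_wrt (\<lambda>a b. E (proot a) (proot b) = 0) xs" "sorted_wrt (\<lambda>a b. E (proot a) (proot b) = 0) ys"
    and "\<And>t. t \<in> T \<Longrightarrow> E (proot t) (proot t) = 1"
    and "\<And>t. t \<in> set xs \<Longrightarrow> k t > 0" "\<And>t. t \<in> set ys \<Longrightarrow> l t > 0"
    and "\<And>a. (\<Sum>t\<in>set xs. k t * proot t a) = (\<Sum>t\<in>set ys. l t * proot t a)"
  shows "xs = ys"
  using assms
proof (induction "length xs + length ys" arbitrary: xs ys rule: less_induct)
  case less
  have Ex: "E (proot (hd zs)) (\<lambda>a. \<Sum>t\<in>set zs. m t * proot t a) = m (hd zs)"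
    if zs: "zs \<noteq> []" "set zs \<subseteq> T" "sorted_wrt (\<lambda>a b. idx b < idx a) zs"
      "sorted_wrt (\<lambda>a b. E (proot a) (proot b) = 0) zs" for zs m
  proof -
    obtain z ws where z: "zs = z # ws" using zs(1) by (cases zs) auto
    have "z \<notin> set ws" using zs(3) z by auto
    then have "E (proot z) (\<lambda>a. \<Sum>t\<in>set zs. m t * proot t a)
        = m z * E (proot z) (proot z) + (\<Sum>t\<in>set ws. m t * E (proot z) (proot t))"
      unfolding E_sum2 using z by simp
    also have "\<dots> = m z" using zs z less.prems(7)[of z] by simp
    finally show ?thesis by (simp add: z)
  qed
  have le: "E (proot t) (\<lambda>a. \<Sum>t'\<in>set zs. m t' * proot t' a) \<le> 0"
    if "t \<in> T" "set zs \<subseteq> T" "\<And>t'. t' \<in> set zs \<Longrightarrow> idx t' < idx t" "\<And>t'. t' \<in> set zs \<Longrightarrow> m t' > 0" for t zs m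
    unfolding E_sum2
  proof (rule sum_nonpos)
    fix t' assume "t' \<in> set zs"
    then show "m t' * E (proot t) (proot t') \<le> 0"
      using that E_idx(2)[of t' t] by (intro mult_nonneg_nonpos) (auto intro: less_imp_le)
  qed
  have eq: "(\<lambda>a. \<Sum>t\<in>set xs. k t * proot t a) = (\<lambda>a. \<Sum>t\<in>set ys. l t * proot t a)"
    using less.prems(10) by (simp add: fun_eq_iff)
  have hd_le: "idx (hd as) \<le> idx (hd bs)"
    if as: "as \<noteq> []" "bs \<noteq> []" "set as \<subseteq> T" "set bs \<subseteq> T" "sorted_wrt (\<lambda>a b. idx b < idx a) as"
      "sorted_wrt (\<lambda>a b. E (proot a) (proot b) = 0) as" "sorted_wrt (\<lambda>a b. idx b < idx a) bs"
      "\<And>t. t \<in> set as \<Longrightarrow> m t > 0" "\<And>t. t \<in> set bs \<Longrightarrow> n t > 0"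
      "(\<lambda>a. \<Sum>t\<in>set as. m t * proot t a) = (\<lambda>a. \<Sum>t\<in>set bs. n t * proot t a)" for as bs m n
  proof (rule ccontr)
    assume ne: "\<not> idx (hd as) \<le> idx (hd bs)"
    have "idx t' < idx (hd as)" if "t' \<in> set bs" for t'
      using that ne as(2,7) by (cases bs) force+
    then have "E (proot (hd as)) (\<lambda>a. \<Sum>t\<in>set bs. n t * proot t a) \<le> 0"
      using as by (intro le) auto
    moreover have "E (proot (hd as)) (\<lambda>a. \<Sum>t\<in>set as. m t * proot t a) > 0"
      using Ex[of as m] as by simp
    ultimately show False using as(10) by simp
  qed
  show ?case
  proof (cases "xs = [] \<or> ys = []")
    case True
    have E0: "E z (\<lambda>a. \<Sum>t\<in>{}. m t * proot t a) = 0" for z m unfolding E_sum2 by simp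
    show ?thesis
    proof (rule ccontr)
      assume "xs \<noteq> ys"
      with True consider "xs = []" "ys \<noteq> []" | "ys = []" "xs \<noteq> []" by auto
      then show False
      proof cases
        case 1
        then have "E (proot (hd ys)) (\<lambda>a. \<Sum>t\<in>set ys. l t * proot t a) = 0"
          using eq E0[of "proot (hd ys)" k] by simp
        then show False using Ex[of ys l] 1 less.prems(2,4,6) less.prems(9)[of "hd ys"] by simp
      next
        case 2
        then have "E (proot (hd xs)) (\<lambda>a. \<Sum>t\<in>set xs. k t * proot t a) = 0"
          using eq E0[of "proot (hd xs)" l] by simp
        then show False using Ex[of xs k] 2 less.prems(1,3,5) less.prems(8)[of "hd xs"] by simp
      qed
    qed
  next
    case False
    then obtain x xs' y ys' where xy: "xs = x # xs'" "ys = y # ys'" by (meson neq_Nil_conv)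
    have "idx x \<le> idx y" using hd_le[of xs ys k l] less.prems eq False xy by simp
    moreover have "idx y \<le> idx x" using hd_le[of ys xs l k] less.prems eq[symmetric] False xy by simp
    ultimately have "x = y" using idx_inj[of x y] less.prems(1,2) xy by auto
    have "k x = l x"
      using Ex[of xs k] Ex[of ys l] less.prems(1-6) eq xy \<open>x = y\<close> by simp
    have nx: "x \<notin> set xs'" "x \<notin> set ys'" using less.prems(3,4) xy \<open>x = y\<close> by auto
    have "xs' = ys'"
    proof (rule less.hyps)
      show "length xs' + length ys' < length xs + length ys" using xy by simp
      fix a
      show "(\<Sum>t\<in>set xs'. k t * proot t a) = (\<Sum>t\<in>set ys'. l t * proot t a)"
        using less.prems(10)[of a] xy nx \<open>x = y\<close> \<open>k x = l x\<close> by simp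
    qed (use less.prems xy in auto)
    then show ?thesis using xy \<open>x = y\<close> by simp
  qed
qed

lemma decreasing_unique:
  assumes u: "u \<in> carrier G"
    and xs: "xs \<in> twords" "sorted_wrt (\<lambda>a b. idx b < idx a) xs" "conc_word u xs"
    and ys: "ys \<in> twords" "sorted_wrt (\<lambda>a b. idx b < idx a) ys" "conc_word u ys"
  shows "xs = ys"
proof -
  define x where "x = act (inv u) rho2"
  have main: "\<exists>k. (\<forall>t\<in>set zs. k t > 0) \<and> (\<forall>a. x a - q x a = (\<Sum>t\<in>set zs. k t * proot t a))"
    if zs: "zs \<in> twords" "conc_word u zs" for zs
  proof -
    have z: "set zs \<subseteq> T" "wp zs = c" "length zs = r" using twordsD[OF zs(1)] by auto
    have dz: "distinct zs" by (rule twords_distinct[OF zs(1)])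
    \<comment> \<open>The telescoping coefficients belong to positions; reindexing by letters, which
      are distinct, allows two words to be compared.\<close>
    define k where "k = (\<lambda>t. bil (gam (map proot zs) (the_inv_into {..<length zs} ((!) zs) t)) x)"
    have ki: "k (zs ! i) = bil (gam (map proot zs) i) x" if "i < length zs" for i
      unfolding k_def using the_inv_into_f_f[of "(!) zs" "{..<length zs}" i] dz that by (simp add: inj_on_nth)
    have "k t > 0" if "t \<in> set zs" for t
    proof -
      from that obtain i where i: "i < length zs" "t = zs ! i" by (auto simp: in_set_conv_nth)
      then show ?thesis using ki conc_word_bil[OF u z(1) zs(2) i(1)] by (simp add: x_def)
    qed
    moreover have "x a - q x a = (\<Sum>t\<in>set zs. k t * proot t a)" for a
    proof -
      have "(\<Sum>t\<in>set zs. k t * proot t a) = (\<Sum>i<length zs. k (zs ! i) * proot (zs ! i) a)"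
        using sum.reindex_bij_betw[OF bij_betw_nth[OF dz HOL.refl HOL.refl], of "\<lambda>t. k t * proot t a"]
        by (simp add: lessThan_def)
      also have "\<dots> = (\<Sum>i<length zs. bil (gam (map proot zs) i) x * proot (zs ! i) a)"
        by (intro sum.cong HOL.refl) (simp add: ki)
      finally show ?thesis using q_telescope_T_word[OF z(1,2), of x a] by simp
    qed
    ultimately show ?thesis by blast
  qed
  from main[OF xs(1,3)] obtain k where k: "\<forall>t\<in>set xs. k t > 0" "\<forall>a. x a - q x a = (\<Sum>t\<in>set xs. k t * proot t a)" by blast
  from main[OF ys(1,3)] obtain l where l: "\<forall>t\<in>set ys. l t > 0" "\<forall>a. x a - q x a = (\<Sum>t\<in>set ys. l t * proot t a)" by blast
  have Es: "sorted_wrt (\<lambda>a b. E (proot a) (proot b) = 0) zs" if "zs \<in> twords" for zs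
    unfolding sorted_wrt_iff_nth_less using twords_E[OF that] twordsD[OF that] by auto
  have E1: "E (proot t) (proot t) = 1" if "t \<in> T" for t
    using E_sym[of "proot t" "proot t"] supp_T[OF that] that by simp
  show ?thesis
  proof (rule unique_expansion[of xs ys k l])
    show "(\<Sum>t\<in>set xs. k t * proot t a) = (\<Sum>t\<in>set ys. l t * proot t a)" for a
      using k(2) l(2) by simp
  qed (use xs ys k(1) l(1) Es[OF xs(1)] Es[OF ys(1)] E1 twordsD[OF xs(1)] twordsD[OF ys(1)] in \<open>simp_all\<close>)
qed

theorem unique_decreasing_in_Class:
  assumes u: "u \<in> W_plus G S c"
  shows "\<exists>!C. C \<in> Class G S c u \<and> is_decreasing_class G S c cs C"
proof (rule ex_ex1I)
  have uc: "u \<in> carrier G" "len G S (u \<otimes> wp cs) = len G S u + length cs"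
    using u by (auto simp: W_plus_def card_S c_def)
  from acute_concordant_exists[OF distinct_cs set_cs uc] obtain ts where
    ts: "length ts = r" "set ts \<subseteq> T" "wp ts = c" "acute ts" "conc_word u ts" by (auto simp: c_def)
  then have tw: "ts \<in> twords" by (simp add: twords_def)
  \<comment> \<open>For a pair in increasing order the sign of \<open>E\<close> gives a pairing
    \<le> 0 and acuteness gives \<ge> 0; so the roots are orthogonal, the letters commute, and the
    word can be sorted decreasingly.\<close>
  have "sorted_wrt (\<lambda>a b. idx a < idx b \<longrightarrow> a \<otimes> b = b \<otimes> a) ts"
    unfolding sorted_wrt_iff_nth_less
  proof (intro allI impI)
    fix i j assume ij: "i < j" "j < length ts" "idx (ts ! i) < idx (ts ! j)"
    have T: "ts ! i \<in> T" "ts ! j \<in> T" using ij ts by auto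
    have ne: "ts ! i \<noteq> ts ! j" using ij by auto
    have "bil (proot (ts ! i)) (proot (ts ! j)) \<le> 0"
      using twords_bil[OF tw ij(1)] E_idx(2)[OF T ij(3)] ij ts(1) by simp
    moreover have "bil (proot (ts ! i)) (proot (ts ! j)) \<ge> 0" using ts(4) ij by (auto simp: acute_def)
    ultimately show "ts ! i \<otimes> ts ! j = ts ! j \<otimes> ts ! i" using commute_iff[OF T ne] by simp
  qed
  from decreasing_sort[OF tw this] obtain ts' where
    ts': "comm_equiv G ts ts'" "ts' \<in> twords" "sorted_wrt (\<lambda>a b. idx b < idx a) ts'" by blast
  have "conc_word u ts'" by (rule conc_word_comm_equiv[OF ts'(1) uc(1) ts(2,5)])
  then have "concordant G S u (chain ts')" using concordant_iff[OF u ts'(2)] by simp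
  then show "\<exists>C. C \<in> Class G S c u \<and> is_decreasing_class G S c cs C"
    using chain_max[OF ts'(2)] decreasing_chain_chain[OF ts'(2,3)]
    by (intro exI[of _ "comm_class G S c (chain ts')"]) (auto simp: Class_def is_decreasing_class_def)
next
  have uc: "u \<in> carrier G" using u by (auto simp: W_plus_def)
  have norm: "\<exists>ts. ts \<in> twords \<and> sorted_wrt (\<lambda>a b. idx b < idx a) ts \<and> conc_word u ts \<and> C = comm_class G S c (chain ts)"
    if C: "C \<in> Class G S c u \<and> is_decreasing_class G S c cs C" for C
  proof -
    from C obtain p where p: "p \<in> max_chains G S c" "concordant G S u p" "C = comm_class G S c p"
      by (auto simp: Class_def)
    from C obtain p' where p': "p' \<in> max_chains G S c" "C = comm_class G S c p'" "decreasing_chain G S cs p'"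
      by (auto simp: is_decreasing_class_def)
    \<comment> \<open>The chain witnessing concordance and the one witnessing decrease may differ,
      so concordance is carried along the class to the sorted word.\<close>
    have "p' \<in> comm_class G S c p" using comm_class_self[OF p'(1)] p(3) p'(2) by simp
    then have "comm_equiv G (rw G p) (rw G p')" by (simp add: comm_class_def)
    moreover from decreasing_chain_sort[OF p'(1,3)] obtain ts where
      ts: "comm_equiv G (rw G p') ts" "ts \<in> twords" "sorted_wrt (\<lambda>a b. idx b < idx a) ts" by blast
    ultimately have eq: "comm_equiv G (rw G p) ts" by (metis comm_equiv_trans)
    have tp: "rw G p \<in> twords" "p = chain (rw G p)" using max_chainD[OF p(1)] by auto
    have "conc_word u (rw G p)" using concordant_iff[OF u tp(1)] p(2) tp(2) by simp
    then have "conc_word u ts" using conc_word_comm_equiv[OF eq uc] twordsD[OF tp(1)] by simp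
    moreover have "rw G (chain ts) = ts" using rw_chain twordsD[OF ts(2)] by blast
    then have "C = comm_class G S c (chain ts)" using p(3) eq by (simp add: comm_class_eqI)
    ultimately show ?thesis using ts by blast
  qed
  fix C D assume CD: "C \<in> Class G S c u \<and> is_decreasing_class G S c cs C"
    "D \<in> Class G S c u \<and> is_decreasing_class G S c cs D"
  from norm[OF CD(1)] obtain xs where xs: "xs \<in> twords" "sorted_wrt (\<lambda>a b. idx b < idx a) xs" "conc_word u xs"
    "C = comm_class G S c (chain xs)" by blast
  from norm[OF CD(2)] obtain ys where ys: "ys \<in> twords" "sorted_wrt (\<lambda>a b. idx b < idx a) ys" "conc_word u ys"
    "D = comm_class G S c (chain ys)" by blast
  show "C = D" using decreasing_unique[OF uc xs(1-3) ys(1-3)] xs(4) ys(4) by simp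
qed

lemma len_c: "len G S c = r"
proof -
  have "len G S (wp (take i cs)) = i" if "i \<le> r" for i using that
  proof (induction i)
    case (Suc i)
    have w: "wp (take i cs) \<in> carrier G" using take_S set_S_carrier by blast
    have "pos (act (wp (take i cs)) (sroot (cs ! i)))"
      using PP_pos[of i] Suc.prems by (simp add: PP_def act_wp[OF take_S])
    then have "len G S (wp (take i cs) \<otimes> cs ! i) = i + 1"
      using tits_iff[OF w, of "cs ! i"] len_mult_simple_cases[OF w, of "cs ! i"] Suc by auto
    then show ?case using Suc.prems take_S[of i]
      by (simp add: take_Suc_conv_app_nth wp_append set_S_carrier)
  qed simp
  from this[of r] show ?thesis by (simp add: c_def)
qed

text \<open>If \<open>s\<close> were missing, \<open>q\<close> would fix the coordinate at
  \<open>s\<close>. But \<open>PP i\<close> for \<open>s = cs ! i\<close> has coordinate 1 there and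
  becomes negative. The length \<open>r\<close> then excludes repetitions.\<close>

lemma reduced_word_full:
  assumes "reduced_word G S ws c" shows "distinct ws \<and> set ws = S"
proof -
  have ws: "set ws \<subseteq> S" "wp ws = c" "length ws = r"
    using assms len_c by (auto simp: reduced_word_def)
  have "S \<subseteq> set ws"
  proof
    fix s assume s: "s \<in> S"
    then obtain i where i: "i < r" "s = cs ! i" using full by (metis in_set_conv_nth)
    show "s \<in> set ws"
    proof (rule ccontr)
      assume ns: "s \<notin> set ws"
      have "wp (rev ws) = inv c"
        using ws simple_involution by (subst wp_rev_involutions) auto
      then have "q = wact (rev ws)" using act_wp[of "rev ws"] ws(1) by (simp add: q_def)
      then have "q (PP i) s = PP i s" using ns by (simp add: wact_outside)
      then have "pos (q (PP i))"
        using PP_coord[of i i] i pos_coeff[OF q_Phi[OF PP_Phi[OF i(1)]], of s] by simp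
      then show False using q_PP_neg[OF i(1)] by simp
    qed
  qed
  then have "set ws = S" using ws by auto
  then show ?thesis using ws(3) card_S by (simp add: card_distinct)
qed

end

theorem theorem1p8:
  fixes G :: "('a, 'b) monoid_scheme" and S :: "'a set" and c u :: 'a and cw :: "'a list"
  assumes "coxeter_system G S"
    and "finite (carrier G)"
    and "standard_coxeter_element G S c"
    and "reduced_word G S cw c"
    and "u \<in> W_plus G S c"
  shows "increasing_class G S c cw \<in> Class G S c u \<and>
    (\<exists>!C. C \<in> Class G S c u \<and> is_decreasing_class G S c cw C)"
proof -
  interpret coxeter_system G S by fact
  interpret finite_coxeter G S by unfold_locales fact
  from assms(3) obtain ws where ws: "distinct ws" "set ws = S" "word_prod G ws = c"
    by (auto simp: standard_coxeter_element_def)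
  \<comment> \<open>\<open>c\<close> is given as a product over all of \<open>S\<close>,
    \<open>cw\<close> only as a reduced word. This interpretation shows that \<open>cw\<close> lists
    \<open>S\<close> without repetition; a second one runs the argument for \<open>cw\<close>, from
    which the order is defined.\<close>
  interpret A: cox_elt G S ws by unfold_locales (use ws in auto)
  have "A.c = c" using ws by (simp add: A.c_def)
  with A.reduced_word_full[of cw] assms(4) have cw: "distinct cw" "set cw = S" by auto
  interpret B: cox_elt G S cw by unfold_locales (use cw in auto)
  have "B.c = c" using assms(4) by (simp add: B.c_def reduced_word_def)
  then show ?thesis
    using B.increasing_in_Class[of u] B.unique_decreasing_in_Class[of u] assms(5) by simp
qed

end
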